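(* In the grid-based current status model described in the context, with fixed scale constant $c>0$ and sparsity exponent $\gamma=1/3$ (so the grid spacing is $\delta_n=cn^{-1/3}$), suppose that $F$ and $G$ are continuously differentiable in a neighborhood of $x_0\in(a,b)$ with derivatives $f$ and $g$, that $f(x_0)>0$ and $g(x_0)>0$, and that $g$ is Lipschitz continuous in a neighborhood of $x_0$. Let $\mathbb X_n(ci)=n^{1/3}\big(\hat F(t_l+cin^{-1/3})-F(t_l)\big)$ for integers $i$ (with $t_l + cin^{-1/3}\in[a,b]$), and let $\alpha=\sqrt{F(x_0)(1-F(x_0))/g(x_0)}$, $\beta=f(x_0)/2$. Then for each nonnegative integer $N$, as $n\to\infty$, $$\{\mathbb X_n(ci):\ i=-N,\dots,N\}\ \xrightarrow{d}\ \{\mathbb X_{c,\alpha,\beta}(ci):\ i=-N,\dots,N\}.$$ Consequently, $n^{1/3}\big(\hat F(t_l)-F(t_l)\big)\xrightarrow{d}\mathbb X_{c,\alpha,\beta}(0)$.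
   Context: Model. $F$ is a distribution function with Lebesgue density $f$ concentrated on $[a',b']$ with $0\le a'<b'<\infty$ (or on $[a',\infty)$, in which case put $b'=\infty$), and $a'\le a<b<b'$. $G$ is an absolutely continuous distribution function whose support contains $[a,b]$, with Lebesgue density $g$. For $c>0$ and $\gamma\in(0,1]$ let $\delta=\delta_n=cn^{-\gamma}$, $K=K_n=\lfloor (b-a)/\delta_n\rfloor$ and $t_i=t_{i,n}=a+i\delta_n$, $i=1,\dots,K$. Let $H_n$ be the discrete distribution on $\{t_1,\dots,t_K\}$ with $H_n\{t_1\}=G(t_1)$, $H_n\{t_i\}=G(t_i)-G(t_{i-1})$ for $2\le i\le K-1$, and $H_n\{t_K\}=1-G(t_{K-1})$. For each $n$, $T_{1},\dots,T_{n}$ are i.i.d. $F$, $X_{1},\dots,X_{n}$ are i.i.d. $H_n$, the two samples are independent (triangular array; dependence on $n$ suppressed), and one observes $(X_i,Y_i)$, $Y_i=1\{T_i\le X_i\}$, $i=1,\dots,n$. Grid point of interest. $x_0\in(a,b)$ is fixed; $t_l=t_{l,n}$ is the largest grid point $\le x_0$ (exists for $n$ large). NPMLE. $\hat F$ is the nonparametric maximum likelihood estimator of $F$ under monotonicity: with $N_i=\sum_{j}1\{X_j=t_i\}$, $Z_i=\sum_{j}Y_j1\{X_j=t_i\}$ and $\bar Z_i=Z_i/N_i$, the vector $(\hat F(t_1),\dots,\hat F(t_K))$ is the weighted isotonic regression, i.e. minimizes $\sum_{i=1}^K N_i(\bar Z_i-F_i)^2$ over $F_1\le\dots\le F_K$,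 and $\hat F$ is extended to $[a,b]$ as a right-continuous step function, constant on each $[t_i,t_{i+1})$ and on $[t_K,b]$, and equal to $0$ on $[a,t_1)$. Equivalently, with $G_n(t)=n^{-1}\sum_j 1\{X_j\le t\}$ and $V_n(t)=n^{-1}\sum_j Y_j1\{X_j\le t\}$, $\hat F(x)$ is the left derivative at $G_n(x)$ of the greatest convex minorant of the point set $\{(G_n(t),V_n(t)):t\in[a,b]\}$ (this also fixes the values at grid points with $N_i=0$; by convention $\hat F(x)=0$ if $G_n(x)=0$). Limit process. For $c,\kappa_1,\kappa_2>0$ and $W$ a standard two-sided Brownian motion with $W(0)=0$, let $\mathcal P_{c,\kappa_1,\kappa_2}(k)=\big(ck,\ \kappa_1W(ck)+\kappa_2c^2k(1+k)\big)\in\mathbb R^2$, $k\in\mathbb Z$. For $i\in\mathbb Z$, $\mathbb X_{c,\kappa_1,\kappa_2}(ci)$ is the left derivative at the point $ci$ of the greatest convex minorant (a piecewise linear convex function on $\mathbb R$) of the point set $\{\mathcal P_{c,\kappa_1,\kappa_2}(k):k\in\mathbb Z\}$. *)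

theory Defs
  imports "HOL-Probability.Probability"
begin

section \<open>Distribution functions, supports and smoothness near a point\<close>

definition cdf_with_density :: "(real \<Rightarrow> real) \<Rightarrow> (real \<Rightarrow> real) \<Rightarrow> bool" where
  "cdf_with_density F f \<longleftrightarrow>
     f \<in> borel_measurable borel \<and> (\<forall>x. 0 \<le> f x) \<and>
     prob_space (density lborel f) \<and> F = cdf (density lborel f)"

definition measure_support :: "'a::topological_space measure \<Rightarrow> 'a set" where
  "measure_support \<mu> = {x. \<forall>U. open U \<and> x \<in> U \<longrightarrow> 0 < emeasure \<mu> U}"

definition C1_near :: "(real \<Rightarrow> real) \<Rightarrow> (real \<Rightarrow> real) \<Rightarrow> real \<Rightarrow> bool" where
  "C1_near F f x \<longleftrightarrow>
     (\<exists>U. open U \<and> x \<in> U \<and> continuous_on U f \<and> (\<forall>u\<in>U. (F has_real_derivative f u) (at u)))"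

definition lipschitz_near :: "(real \<Rightarrow> real) \<Rightarrow> real \<Rightarrow> bool" where
  "lipschitz_near g x \<longleftrightarrow> (\<exists>U L. open U \<and> x \<in> U \<and> L-lipschitz_on U g)"


section \<open>Convergence in distribution\<close>

text \<open>
  The random elements \<open>\<xi> n\<close> may live on different probability spaces.  Measurability of \<open>\<xi> n\<close> is
  only required for large \<open>n\<close>, since the local process below is only meaningful for large \<open>n\<close>.
\<close>

definition converges_in_distribution ::
    "(nat \<Rightarrow> 'a measure) \<Rightarrow> (nat \<Rightarrow> 'a \<Rightarrow> 'c::topological_space) \<Rightarrow> 'b measure \<Rightarrow> ('b \<Rightarrow> 'c) \<Rightarrow> bool"
  where
  "converges_in_distribution M \<xi> M' \<eta> \<longleftrightarrow>
     (\<forall>\<^sub>F n in sequentially. \<xi> n \<in> borel_measurable (M n)) \<and>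
     \<eta> \<in> borel_measurable M' \<and>
     (\<forall>h :: 'c \<Rightarrow> real. continuous_on UNIV h \<and> bounded (range h) \<longrightarrow>
        (\<lambda>n. \<integral>\<omega>. h (\<xi> n \<omega>) \<partial>M n) \<longlonglongrightarrow> (\<integral>\<omega>. h (\<eta> \<omega>) \<partial>M'))"


section \<open>Greatest convex minorants\<close>

definition gcm :: "(real \<times> real) set \<Rightarrow> real \<Rightarrow> real" where
  "gcm S x = Sup {h x | h. convex_on (convex hull (fst ` S)) h \<and> (\<forall>(u, v)\<in>S. h u \<le> v)}"

definition gcm_left_slope :: "(real \<times> real) set \<Rightarrow> real \<Rightarrow> real" where
  "gcm_left_slope S x = vector_derivative (gcm S) (at_left x)"


section \<open>The grid and the design distribution\<close>

definition grid_step :: "real \<Rightarrow> real \<Rightarrow> nat \<Rightarrow> real" where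
  "grid_step c \<gamma> n = c * real n powr (- \<gamma>)"

definition grid_size :: "real \<Rightarrow> real \<Rightarrow> real \<Rightarrow> nat" where
  "grid_size a b \<delta> = nat \<lfloor>(b - a) / \<delta>\<rfloor>"

definition grid_point :: "real \<Rightarrow> real \<Rightarrow> nat \<Rightarrow> real" where
  "grid_point a \<delta> i = a + real i * \<delta>"

definition last_grid_point :: "real \<Rightarrow> real \<Rightarrow> real \<Rightarrow> real \<Rightarrow> real" where
  "last_grid_point a b \<delta> x =
     Max {t \<in> grid_point a \<delta> ` {1..grid_size a b \<delta>}. t \<le> x}"

text \<open>These weights form a probability vector only if \<open>grid_size a b \<delta> \<ge> 2\<close>.\<close>

definition design_weight :: "(real \<Rightarrow> real) \<Rightarrow> real \<Rightarrow> real \<Rightarrow> real \<Rightarrow> nat \<Rightarrow> real" where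
  "design_weight G a b \<delta> i =
     (if i = 1 then G (grid_point a \<delta> 1)
      else if i = grid_size a b \<delta> then 1 - G (grid_point a \<delta> (i - 1))
      else G (grid_point a \<delta> i) - G (grid_point a \<delta> (i - 1)))"

definition design_distribution :: "(real \<Rightarrow> real) \<Rightarrow> real \<Rightarrow> real \<Rightarrow> real \<Rightarrow> real measure" where
  "design_distribution G a b \<delta> =
     distr (point_measure {1..grid_size a b \<delta>} (\<lambda>i. ennreal (design_weight G a b \<delta> i)))
           borel (grid_point a \<delta>)"


section \<open>Current status data\<close>

definition current_status_sample ::
    "'a measure \<Rightarrow> nat \<Rightarrow> (real \<Rightarrow> real) \<Rightarrow> real measure \<Rightarrow>
     (nat \<Rightarrow> 'a \<Rightarrow> real) \<Rightarrow> (nat \<Rightarrow> 'a \<Rightarrow> real) \<Rightarrow> bool" where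
  "current_status_sample M n F H T X \<longleftrightarrow>
     prob_space M \<and>
     prob_space.indep_vars M (\<lambda>_. borel) T {1..n} \<and>
     prob_space.indep_vars M (\<lambda>_. borel) X {1..n} \<and>
     prob_space.indep_var M
       (\<Pi>\<^sub>M j\<in>{1..n}. borel) (\<lambda>\<omega>. \<lambda>j\<in>{1..n}. T j \<omega>)
       (\<Pi>\<^sub>M j\<in>{1..n}. borel) (\<lambda>\<omega>. \<lambda>j\<in>{1..n}. X j \<omega>) \<and>
     (\<forall>j\<in>{1..n}. cdf (distr M borel (T j)) = F) \<and>
     (\<forall>j\<in>{1..n}. distr M borel (X j) = H)"

definition status :: "real \<Rightarrow> real \<Rightarrow> real" where
  "status T X = (if T \<le> X then 1 else 0)"


section \<open>The nonparametric maximum likelihood estimator\<close>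

definition emp_G :: "nat \<Rightarrow> (nat \<Rightarrow> real) \<Rightarrow> real \<Rightarrow> real" where
  "emp_G n x t = real (card {j \<in> {1..n}. x j \<le> t}) / real n"

definition emp_V :: "nat \<Rightarrow> (nat \<Rightarrow> real) \<Rightarrow> (nat \<Rightarrow> real) \<Rightarrow> real \<Rightarrow> real" where
  "emp_V n x y t = (\<Sum>j \<in> {j \<in> {1..n}. x j \<le> t}. y j) / real n"

text \<open>
  The estimator is defined through the cumulative sum diagram, whose points are the
  \<open>(emp_G n x t, emp_V n x y t)\<close>; this also determines it at grid points without observations.
  The facts \<open>npmle_isotonic_regression\<close>, \<open>npmle_step\<close> and \<open>npmle_zero\<close> below show that, for
  observation times on the grid, it is the weighted isotonic regression of the success frequencies,
  extended to a step function.
\<close>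

definition npmle :: "real \<Rightarrow> real \<Rightarrow> nat \<Rightarrow> (nat \<Rightarrow> real) \<Rightarrow> (nat \<Rightarrow> real) \<Rightarrow> real \<Rightarrow> real" where
  "npmle a b n x y s =
     (if emp_G n x s = 0 then 0
      else gcm_left_slope ((\<lambda>t. (emp_G n x t, emp_V n x y t)) ` {a..b}) (emp_G n x s))"


lemma three_points:
  fixes g :: "real \<Rightarrow> real"
  assumes "convex_on A g" "x \<in> A" "z \<in> A" "x < y" "y < z"
  shows "(z - x) * g y \<le> (z - y) * g x + (y - x) * g z"
proof -
  define t where "t = (y - x) / (z - x)"
  have t: "0 \<le> t" "t \<le> 1" and zx: "z - x > 0" using assms by (auto simp: t_def field_simps)
  have e: "t * (z - x) = y - x" using zx by (simp add: t_def)
  have y: "(1 - t) *\<^sub>R x + t *\<^sub>R z = y" using e by (simp add: algebra_simps)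
  have "g y \<le> (1 - t) * g x + t * g z"
    using convex_onD[OF assms(1) t assms(2,3)] y by simp
  then have "(z - x) * g y \<le> (z - x) * ((1 - t) * g x + t * g z)" using zx by simp
  also have "\<dots> = ((z - x) - t * (z - x)) * g x + (t * (z - x)) * g z" by (simp add: algebra_simps)
  finally show ?thesis unfolding e by simp
qed

definition chord :: "(real \<Rightarrow> real) \<Rightarrow> real \<Rightarrow> real \<Rightarrow> real \<Rightarrow> real" where
  "chord g p q x = g p + (g q - g p) / (q - p) * (x - p)"

lemma chord_mult: "p < q \<Longrightarrow> (q - p) * chord g p q x = (q - x) * g p + (x - p) * g q"
proof -
  assume "p < q"
  then have "(q - p) * ((g q - g p) / (q - p) * (x - p)) = (g q - g p) * (x - p)" by simp
  then show ?thesis unfolding chord_def by (simp add: algebra_simps)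
qed

lemma chord_ends: "p < q \<Longrightarrow> chord g p q p = g p" "p < q \<Longrightarrow> chord g p q q = g q"
  by (auto simp: chord_def)

lemma chord_inside:
  assumes "convex_on {l..r} g" "l \<le> p" "p < q" "q \<le> r" "p \<le> x" "x \<le> q"
  shows "g x \<le> chord g p q x"
proof (cases "x = p \<or> x = q")
  case True then show ?thesis using chord_ends assms by auto
next
  case False
  then have "(q - p) * g x \<le> (q - x) * g p + (x - p) * g q"
    using assms by (intro three_points[of "{l..r}"]) auto
  then have "(q - p) * g x \<le> (q - p) * chord g p q x" using chord_mult assms by simp
  then show ?thesis using assms by simp
qed

lemma chord_outside:
  assumes "convex_on {l..r} g" "l \<le> p" "p < q" "q \<le> r" "l \<le> x" "x \<le> r" "x \<le> p \<or> q \<le> x"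
  shows "chord g p q x \<le> g x"
proof (cases "x = p \<or> x = q")
  case True then show ?thesis using chord_ends assms by auto
next
  case False
  have "(q - p) * chord g p q x \<le> (q - p) * g x"
  proof (cases "x < p")
    case True
    then have "(q - x) * g p \<le> (q - p) * g x + (p - x) * g q"
      using assms by (intro three_points[of "{l..r}"]) auto
    then show ?thesis unfolding chord_mult[OF assms(3)] by (simp add: algebra_simps)
  next
    case False
    with \<open>\<not> (x = p \<or> x = q)\<close> have "q < x" using assms by auto
    then have "(x - p) * g q \<le> (x - q) * g p + (q - p) * g x"
      using assms by (intro three_points[of "{l..r}"]) auto
    then show ?thesis unfolding chord_mult[OF assms(3)] by (simp add: algebra_simps)
  qed
  then show ?thesis using assms by simp
qed

lemma convex_affine: "convex_on {l..r} (\<lambda>x::real. u + s * (x - w) :: real)"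
proof (rule convex_onI)
  fix t x y :: real
  show "u + s * ((1 - t) *\<^sub>R x + t *\<^sub>R y - w) \<le> (1 - t) * (u + s * (x - w)) + t * (u + s * (y - w))"
    by (simp add: algebra_simps)
qed simp

lemma convex_max:
  assumes "convex_on {l..r::real} g" "convex_on {l..r} h"
  shows "convex_on {l..r} (\<lambda>x. max (g x) (h x))"
proof (rule convex_onI)
  fix t x y :: real assume t: "0 < t" "t < 1" and xy: "x \<in> {l..r}" "y \<in> {l..r}"
  have m: "(1 - t) * u + t * v \<le> (1 - t) * max u u' + t * max v v'" 
          "(1 - t) * u' + t * v' \<le> (1 - t) * max u u' + t * max v v'" for u v u' v' :: real
    using t by (intro add_mono mult_left_mono; simp)+
  show "max (g ((1 - t) *\<^sub>R x + t *\<^sub>R y)) (h ((1 - t) *\<^sub>R x + t *\<^sub>R y))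
        \<le> (1 - t) * max (g x) (h x) + t * max (g y) (h y)"
    using convex_onD[OF assms(1) _ _ xy, of t] convex_onD[OF assms(2) _ _ xy, of t] t
    by (intro max.boundedI order_trans[OF _ m(1)] order_trans[OF _ m(2)]) auto
qed simp

context
  fixes S :: "(real \<times> real) set" and l r vl vr :: real
  assumes fin: "finite S" and lr: "l \<le> r" and L: "(l, vl) \<in> S" and R: "(r, vr) \<in> S"
    and rng: "fst ` S \<subseteq> {l..r}"
begin

abbreviation (input) "minorant h \<equiv> convex_on {l..r} h \<and> (\<forall>(u, v)\<in>S. h u \<le> v)"

lemma hull_abscissae: "convex hull (fst ` S) = {l..r}"
proof
  show "convex hull (fst ` S) \<subseteq> {l..r}" using rng by (simp add: hull_minimal)
  have "{l, r} \<subseteq> fst ` S" using L R by force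
  then have "convex hull {l, r} \<subseteq> convex hull (fst ` S)" by (rule hull_mono)
  then show "{l..r} \<subseteq> convex hull (fst ` S)"
    using lr by (simp add: segment_convex_hull[symmetric] closed_segment_eq_real_ivl)
qed

lemma gcm_eq: "gcm S x = Sup {h x | h. minorant h}" unfolding gcm_def hull_abscissae ..

lemma minorant_le:
  assumes "minorant h" "x \<in> {l..r}" shows "h x \<le> max vl vr"
proof -
  have b: "h l \<le> vl" "h r \<le> vr" using assms L R by auto
  show ?thesis
  proof (cases "x = l \<or> x = r")
    case False
    then have *: "l < x" "x < r" using assms by auto
    then have "(r - l) * h x \<le> (r - x) * h l + (x - l) * h r"
      using assms by (intro three_points[of "{l..r}"]) auto
    also have "\<dots> \<le> (r - x) * max vl vr + (x - l) * max vl vr"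
      using b * by (intro add_mono mult_left_mono) auto
    also have "\<dots> = (r - l) * max vl vr" by (simp add: algebra_simps)
    finally show ?thesis using * by simp
  qed (use b in auto)
qed

lemma gcm_greatest: "minorant h \<Longrightarrow> x \<in> {l..r} \<Longrightarrow> h x \<le> gcm S x"
  unfolding gcm_eq
  by (rule cSup_upper) (blast, rule bdd_aboveI[of _ "max vl vr"], use minorant_le in blast)

lemma minorant_ex: "\<exists>h. minorant h"
proof -
  have "convex_on {l..r} (\<lambda>_. Min (snd ` S))" by (rule convex_onI) (auto simp: algebra_simps)
  moreover have "\<forall>(u,v)\<in>S. Min (snd ` S) \<le> v" using fin by (auto intro!: Min_le image_eqI)
  ultimately show ?thesis by blast
qed

lemma gcm_least: "(\<And>h. minorant h \<Longrightarrow> h x \<le> B) \<Longrightarrow> gcm S x \<le> B"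
  unfolding gcm_eq using minorant_ex by (intro cSup_least) auto

lemma gcm_below: "(u, v) \<in> S \<Longrightarrow> gcm S u \<le> v" by (rule gcm_least) auto

lemma gcm_convex: "convex_on {l..r} (gcm S)"
proof (rule convex_onI)
  fix t x y :: real assume t: "0 < t" "t < 1" and xy: "x \<in> {l..r}" "y \<in> {l..r}"
  show "gcm S ((1 - t) *\<^sub>R x + t *\<^sub>R y) \<le> (1 - t) * gcm S x + t * gcm S y"
  proof (rule gcm_least)
    fix h assume h: "minorant h"
    have "h ((1 - t) *\<^sub>R x + t *\<^sub>R y) \<le> (1 - t) * h x + t * h y"
      using h t xy by (intro convex_onD) auto
    also have "\<dots> \<le> (1 - t) * gcm S x + t * gcm S y"
      using h t xy by (intro add_mono mult_left_mono gcm_greatest) auto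
    finally show "h ((1 - t) *\<^sub>R x + t *\<^sub>R y) \<le> (1 - t) * gcm S x + t * gcm S y" .
  qed
qed simp

lemma gcm_minorant: "minorant (gcm S)" using gcm_convex gcm_below by auto

lemma gcm_chord:
  assumes "l \<le> p" "p < q" "q \<le> r" "p \<le> x" "x \<le> q"
    and ok: "\<And>u v. (u, v) \<in> S \<Longrightarrow> p < u \<Longrightarrow> u < q \<Longrightarrow> chord (gcm S) p q u \<le> v"
  shows "gcm S x = chord (gcm S) p q x"
proof (rule antisym)
  show "gcm S x \<le> chord (gcm S) p q x" using assms gcm_convex by (intro chord_inside) auto
  let ?h = "\<lambda>x. max (gcm S x) (chord (gcm S) p q x)"
  have "convex_on {l..r} ?h"
    unfolding chord_def by (intro convex_max gcm_convex convex_affine)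
  moreover have "?h u \<le> v" if "(u, v) \<in> S" for u v
  proof (cases "p < u \<and> u < q")
    case True then show ?thesis using ok that gcm_below by auto
  next
    case False
    have "chord (gcm S) p q u \<le> gcm S u"
      using assms gcm_convex False that rng by (intro chord_outside) force+
    then show ?thesis using gcm_below[OF that] by simp
  qed
  ultimately have "minorant ?h" by auto
  then have "?h x \<le> gcm S x" using assms by (intro gcm_greatest) auto
  then show "chord (gcm S) p q x \<le> gcm S x" by simp
qed

lemma gcm_left_slope_gap:
  assumes "l \<le> p" "p < q" "q \<le> r" and gap: "\<And>u v. (u, v) \<in> S \<Longrightarrow> u \<le> p \<or> q \<le> u"
  shows "gcm_left_slope S q = (gcm S q - gcm S p) / (q - p)"
proof -
  let ?m = "(gcm S q - gcm S p) / (q - p)"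
  have eq: "gcm S x = chord (gcm S) p q x" if "p \<le> x" "x \<le> q" for x
    using assms that gap by (intro gcm_chord) force+
  have "(chord (gcm S) p q has_vector_derivative ?m) (at_left q)"
    unfolding chord_def has_real_derivative_iff_has_vector_derivative[symmetric]
    using \<open>p < q\<close> by (auto intro!: derivative_eq_intros)
  moreover have "\<forall>\<^sub>F x in nhds q. x \<in> {..<q} \<longrightarrow> gcm S x = chord (gcm S) p q x"
    using eventually_nhds_in_open[of "{p<..}" q] \<open>p < q\<close>
    by (auto elim!: eventually_mono intro: eq)
  ultimately have "(gcm S has_vector_derivative ?m) (at_left q)"
    using eq[of q] \<open>p < q\<close> by (subst has_vector_derivative_cong_ev[where g = "chord (gcm S) p q"]) auto
  then show ?thesis unfolding gcm_left_slope_def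
    by (intro vector_derivative_within) auto
qed

lemma gcm_no_kink:
  assumes "l \<le> p" "p < q" "q < s" "s \<le> r"
    and gap: "\<And>u v. (u, v) \<in> S \<Longrightarrow> u \<le> p \<or> u = q \<or> s \<le> u"
    and d: "d > 0" "\<And>v. (q, v) \<in> S \<Longrightarrow> gcm S q + d \<le> v"
  shows "(gcm S q - gcm S p) / (q - p) = (gcm S s - gcm S q) / (s - q)"
proof (rule ccontr)
  let ?m = "(gcm S q - gcm S p) / (q - p)" and ?m' = "(gcm S s - gcm S q) / (s - q)"
  assume ne: "?m \<noteq> ?m'"
  define e where "e = min (min (q - p) (s - q)) (d / (1 + \<bar>?m' - ?m\<bar>))"
  have e: "e > 0" "e \<le> q - p" "e \<le> s - q" and e2: "e \<le> d / (1 + \<bar>?m' - ?m\<bar>)"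
    using assms by (auto simp: e_def)
  have "e * (1 + \<bar>?m' - ?m\<bar>) \<le> d" using e2 by (subst (asm) pos_le_divide_eq) auto
  then have ed: "e * \<bar>?m' - ?m\<bar> \<le> d" using e by (simp add: distrib_left)
  have eq1: "gcm S x = chord (gcm S) p q x" if "p \<le> x" "x \<le> q" for x
    using assms that gap by (intro gcm_chord) force+
  have eq2: "gcm S x = chord (gcm S) q s x" if "q \<le> x" "x \<le> s" for x
    using assms that gap by (intro gcm_chord) force+
  have 1: "gcm S (q - e) = gcm S q - ?m * e"
  proof -
    have "gcm S (q - e) = gcm S p + ?m * (q - p) - ?m * e"
      using e by (subst eq1) (auto simp: chord_def right_diff_distrib)
    moreover have "?m * (q - p) = gcm S q - gcm S p" using assms by simp
    ultimately show ?thesis by simp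
  qed
  have 2: "gcm S (q + e) = gcm S q + ?m' * e"
    using e by (subst eq2) (auto simp: chord_def)
  have c: "chord (gcm S) (q - e) (q + e) q = gcm S q + (?m' - ?m) * e / 2"
  proof -
    have "(gcm S q + M' * e - (gcm S q - M * e)) / (q + e - (q - e)) * (q - (q - e)) = (M' - M) * e / 2 + M * e"
      for M M' using e by (simp add: field_simps)
    from this[of ?m' ?m] show ?thesis unfolding chord_def 1 2 by linarith
  qed
  have "gcm S q = chord (gcm S) (q - e) (q + e) q"
  proof (rule gcm_chord)
    fix u v assume uv: "(u, v) \<in> S" "q - e < u" "u < q + e"
    then have u: "u = q" using gap[OF uv(1)] e by auto
    have "(?m' - ?m) * e / 2 \<le> \<bar>?m' - ?m\<bar> * e / 2" using e by (simp add: mult_right_mono)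
    also have "\<dots> \<le> d" using ed d by (simp add: mult.commute)
    finally show "chord (gcm S) (q - e) (q + e) u \<le> v" using d(2)[of v] uv(1) unfolding u c by linarith
  qed (use assms e in auto)
  then show False using c ne e by simp
qed

end

lemma gcm_slopes_mono:
  fixes g :: "real \<Rightarrow> real"
  assumes "convex_on {l..r} g" "l \<le> p" "p < q" "q < s" "s \<le> r"
  shows "(g q - g p) / (q - p) \<le> (g s - g q) / (s - q)"
proof -
  have "(s - p) * g q \<le> (s - q) * g p + (q - p) * g s"
    using assms by (intro three_points[of "{l..r}"]) auto
  then have "(g q - g p) * (s - q) \<le> (g s - g q) * (q - p)" by (simp add: algebra_simps)
  then show ?thesis using assms by (simp add: field_simps)
qed


lemma isotonic_slopes:
  fixes G V :: "nat \<Rightarrow> real" and K :: nat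
  assumes G0: "G 0 = 0" and V0: "V 0 = 0"
    and stepG: "\<And>i. i < K \<Longrightarrow> G i \<le> G (Suc i)"
    and stepV: "\<And>i. i < K \<Longrightarrow> V i \<le> V (Suc i)"
    and stepE: "\<And>i. i < K \<Longrightarrow> G (Suc i) = G i \<Longrightarrow> V (Suc i) = V i"
  defines "S \<equiv> (\<lambda>i. (G i, V i)) ` {0..K}"
  defines "m \<equiv> (\<lambda>i. if G i = 0 then 0 else gcm_left_slope S (G i))"
  shows "\<And>i. i < K \<Longrightarrow> m i \<le> m (Suc i)" (is "PROP ?mono")
    and "\<And>u. (\<And>i. 1 \<le> i \<Longrightarrow> i < K \<Longrightarrow> u i \<le> u (Suc i)) \<Longrightarrow>
       (\<Sum>i=1..K. ((V i - V (i - 1)) - m i * (G i - G (i - 1))) * (u i - m i)) \<le> 0" (is "PROP ?var")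
proof -
  have GV: "G i \<le> G j \<and> V i \<le> V j \<and> (G j = G i \<longrightarrow> V j = V i)" if "i \<le> j" "j \<le> K" for i j
    using that
  proof (induction j rule: dec_induct)
    case (step k)
    then have "G i \<le> G k \<and> V i \<le> V k \<and> (G k = G i \<longrightarrow> V k = V i)" by simp
    moreover have "G k \<le> G (Suc k)" "V k \<le> V (Suc k)" "G (Suc k) = G k \<longrightarrow> V (Suc k) = V k"
      using stepG[of k] stepV[of k] stepE[of k] step by auto
    ultimately show ?case by fastforce
  qed simp
  have same: "V i = V j" if "G i = G j" "i \<le> K" "j \<le> K" for i j
    using GV[of i j] GV[of j i] that by (metis nat_le_linear)
  have less: "i < j" if "G i < G j" "i \<le> K" "j \<le> K" for i j
    using GV[of j i] that by (meson not_le)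
  have nn: "0 \<le> G i" "0 \<le> V i" "G i \<le> G K" "V i \<le> V K" if "i \<le> K" for i
    using GV[of 0 i] GV[of i K] that G0 V0 by auto
  have fin: "finite S" and L: "(0, 0) \<in> S" and R: "(G K, V K) \<in> S"
    using G0 V0 by (auto simp: S_def image_iff intro: bexI[of _ 0])
  have rng: "fst ` S \<subseteq> {0..G K}" using nn by (auto simp: S_def)
  have r: "0 \<le> G K" using nn[of K] by simp
  note ctx = fin r L R rng
  let ?g = "gcm S"
  note cvx = gcm_convex[OF ctx]
  have below: "?g (G i) \<le> V i" if "i \<le> K" for i
    using gcm_below[OF ctx] that by (auto simp: S_def)
  have g0: "?g x \<ge> 0" if "x \<in> {0..G K}" for x
    using gcm_greatest[OF ctx, of "\<lambda>_. 0" x] that nn convex_affine[of 0 "G K" 0 0 0]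
    by (auto simp: S_def)
  have pred: "\<exists>j<i. G j < G i \<and> (\<forall>k\<le>K. G k \<le> G j \<or> G i \<le> G k)" if "i \<le> K" "G i > 0" for i
  proof -
    define j where "j = Max {j. j \<le> K \<and> G j < G i}"
    have ne: "finite {j. j \<le> K \<and> G j < G i}" "{j. j \<le> K \<and> G j < G i} \<noteq> {}"
      using that G0 by (auto intro: exI[of _ 0])
    have j: "j \<le> K" "G j < G i" using Max_in[OF ne] by (auto simp: j_def)
    have "G k \<le> G j" if "k \<le> K" "G k < G i" for k
    proof -
      have "k \<le> j" unfolding j_def using ne that by (intro Max_ge) auto
      then show ?thesis using GV[of k j] j by auto
    qed
    then show ?thesis using j less[of j i] \<open>i \<le> K\<close> by (metis not_le)
  qed
  have gap: "\<And>u v. (u, v) \<in> S \<Longrightarrow> u \<le> G j \<or> G i \<le> u" if "\<forall>k\<le>K. G k \<le> G j \<or> G i \<le> G k" for i j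
    using that by (auto simp: S_def)
  have slope: "m i = (?g (G i) - ?g (G j)) / (G i - G j)"
    if "i \<le> K" "j \<le> K" "G j < G i" "\<forall>k\<le>K. G k \<le> G j \<or> G i \<le> G k" for i j
    unfolding m_def using that nn gcm_left_slope_gap[OF ctx, of "G j" "G i"] gap[OF that(4)] 
    by (auto simp: order.strict_iff_not)
  have step_gap: "\<forall>k\<le>K. G k \<le> G i \<or> G (Suc i) \<le> G k" if "i < K" for i
    using GV[of _ i] GV[of "Suc i"] that by (metis Suc_leI less_imp_le not_le)
  have m_nn: "0 \<le> m (Suc i)" if i: "i < K" "G i = 0" for i
  proof (cases "G (Suc i) = 0")
    case False
    then have "0 < G (Suc i)" using nn[of "Suc i"] i by auto
    moreover have "?g 0 \<le> 0" using below[of 0] G0 V0 by simp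
    ultimately show ?thesis
      using slope[of "Suc i" i] step_gap[OF i(1)] i g0[of "G (Suc i)"] nn[of "Suc i"] by simp
  qed (simp add: m_def)
  show M: "PROP ?mono"
  proof -
    fix i assume i: "i < K"
    consider "G (Suc i) = G i" | "G i = 0" | "0 < G i" "G i < G (Suc i)"
      using stepG[OF i] nn[of i] i by fastforce
    then show "m i \<le> m (Suc i)"
    proof cases
      case 1 then show ?thesis by (simp add: m_def)
    next
      case 2 then show ?thesis using m_nn[OF i 2] by (simp add: m_def)
    next
      case 3
      obtain j where j: "j < i" "G j < G i" "\<forall>k\<le>K. G k \<le> G j \<or> G i \<le> G k"
        using pred[of i] 3 i by auto
      show ?thesis
        using slope[of i j] slope[of "Suc i" i] step_gap[OF i] i j 3 nn
          gcm_slopes_mono[OF cvx, of "G j" "G i" "G (Suc i)"] by auto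
    qed
  qed
  define D where "D i = V i - ?g (G i)" for i
  have D_nn: "0 \<le> D i" if "i \<le> K" for i using below[OF that] by (simp add: D_def)
  have D_0: "D i = 0" if "i \<le> K" "G i = 0" for i
  proof -
    have "V i = 0" using same[of i 0] that G0 V0 by simp
    then show ?thesis using D_nn[of i] g0[of 0] that r by (simp add: D_def)
  qed
  have D_K: "D i = 0" if "i \<le> K" "G i = G K" for i
  proof (cases "G K = 0")
    case True then show ?thesis using D_0[of i] that by simp
  next
    case False
    then have pos: "0 < G K" using r by simp
    obtain j where j: "j < K" "G j < G K" "\<forall>k\<le>K. G k \<le> G j \<or> G K \<le> G k"
      using pred[of K] pos by auto
    define s where "s = V K / (G K - G j)"
    have s: "s * (G K - G j) = V K" "0 \<le> s" using j nn[of K] by (auto simp: s_def)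
    have "V K + s * (G k - G K) \<le> V k" if k: "k \<le> K" for k
    proof (cases "G K \<le> G k")
      case True
      then have "G k = G K" using nn[of k] k by simp
      then show ?thesis using same[of k K] k by simp
    next
      case False
      then have "G k \<le> G j" using j k by auto
      then have "s * (G K - G j) \<le> s * (G K - G k)" using s by (intro mult_left_mono) auto
      then have "V K \<le> s * (G K - G k)" using s by simp
      then show ?thesis using nn[of k] k by (simp add: algebra_simps)
    qed
    then have "V K + s * (G K - G K) \<le> ?g (G K)"
      using r convex_affine[of 0 "G K"] 
      by (intro gcm_greatest[OF ctx, of "\<lambda>x. V K + s * (x - G K)"]) (auto simp: S_def)
    then have "V K \<le> ?g (G K)" by simp
    moreover have "V i = V K" using same[of i K] that by simp
    ultimately show ?thesis using D_nn[of i] that by (simp add: D_def)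
  qed
  have kink: "D i * (m (Suc i) - m i) = 0" if i: "i < K" for i
  proof (cases "D i = 0 \<or> G (Suc i) = G i")
    case True then show ?thesis by (auto simp: m_def)
  next
    case False
    then have pos: "0 < D i" "0 < G i" "G i < G (Suc i)"
      using D_nn[of i] D_0[of i] nn[of i] i stepG[OF i] by (auto simp: less_le)
    obtain j where j: "j < i" "G j < G i" "\<forall>k\<le>K. G k \<le> G j \<or> G i \<le> G k"
      using pred[of i] pos i by auto
    have "(?g (G i) - ?g (G j)) / (G i - G j) = (?g (G (Suc i)) - ?g (G i)) / (G (Suc i) - G i)"
    proof (rule gcm_no_kink[OF ctx, where d = "D i"])
      show "u \<le> G j \<or> u = G i \<or> G (Suc i) \<le> u" if "(u, v) \<in> S" for u v
        using gap[OF j(3) that] gap[OF step_gap[OF i] that] by auto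
      show "?g (G i) + D i \<le> v" if v: "(G i, v) \<in> S" for v
      proof -
        obtain k where k: "k \<le> K" "G i = G k" "v = V k" using v by (auto simp: S_def)
        then show ?thesis using same[of i k] i by (simp add: D_def)
      qed
    qed (use pos j i nn in auto)
    then show ?thesis using slope[of i j] slope[of "Suc i" i] step_gap[OF i] i j pos by simp
  qed
  show "PROP ?var"
  proof -
    fix u :: "nat \<Rightarrow> real" assume u: "\<And>i. 1 \<le> i \<Longrightarrow> i < K \<Longrightarrow> u i \<le> u (Suc i)"
    have inc: "(V (Suc i) - V i) - m (Suc i) * (G (Suc i) - G i) = D (Suc i) - D i" if i: "i < K" for i
    proof (cases "G (Suc i) = G i")
      case True then show ?thesis using stepE[OF i] by (simp add: D_def)
    next
      case False
      then have "G i < G (Suc i)" using stepG[OF i] by simp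
      then have "m (Suc i) * (G (Suc i) - G i) = ?g (G (Suc i)) - ?g (G i)"
        using slope[of "Suc i" i] step_gap[OF i] i by simp
      then show ?thesis by (simp add: D_def)
    qed
    have part: "(\<Sum>i=1..k. ((V i - V (i - 1)) - m i * (G i - G (i - 1))) * (u i - m i))
        \<le> D k * (u k - m k)" if "k \<le> K" for k
      using that
    proof (induction k)
      case 0 then show ?case using D_0[of 0] G0 by simp
    next
      case (Suc k)
      have "D k * (u k - m k) \<le> D k * (u (Suc k) - m (Suc k))"
      proof (cases "k = 0")
        case False
        then have "D k * u k \<le> D k * u (Suc k)"
          using Suc.prems by (intro mult_left_mono u D_nn) auto
        moreover have "D k * m (Suc k) = D k * m k"
          using kink[of k] Suc.prems by (simp add: right_diff_distrib)
        ultimately show ?thesis unfolding right_diff_distrib by linarith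
      qed (use D_0[of 0] G0 in simp)
      moreover have "((V (Suc k) - V k) - m (Suc k) * (G (Suc k) - G k)) * (u (Suc k) - m (Suc k))
          = D (Suc k) * (u (Suc k) - m (Suc k)) - D k * (u (Suc k) - m (Suc k))"
        using inc[of k] Suc.prems by (simp only: left_diff_distrib[symmetric] Suc_le_lessD)
      moreover have "(\<Sum>i=1..k. ((V i - V (i - 1)) - m i * (G i - G (i - 1))) * (u i - m i))
          \<le> D k * (u k - m k)"
        using Suc by simp
      ultimately show ?case by simp
    qed
    show "(\<Sum>i=1..K. ((V i - V (i - 1)) - m i * (G i - G (i - 1))) * (u i - m i)) \<le> 0"
      using part[of K] D_K[of K] by simp
  qed
qed

lemma grid_point_less_iff: "0 < \<delta> \<Longrightarrow> grid_point a \<delta> i < grid_point a \<delta> k \<longleftrightarrow> i < k"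
  by (simp add: grid_point_def)

lemma grid_point_le_iff: "0 < \<delta> \<Longrightarrow> grid_point a \<delta> i \<le> grid_point a \<delta> k \<longleftrightarrow> i \<le> k"
  by (simp add: grid_point_def)

context
  fixes a b \<delta> :: real and n :: nat and x y :: "nat \<Rightarrow> real"
  assumes \<delta>: "0 < \<delta>" and n: "0 < n" and ab: "a \<le> b"
    and x: "\<And>j. j \<in> {1..n} \<Longrightarrow> x j \<in> grid_point a \<delta> ` {1..grid_size a b \<delta>}"
    and y: "\<And>j. j \<in> {1..n} \<Longrightarrow> 0 \<le> y j"
begin

lemma observed_upto:
  assumes "grid_point a \<delta> i \<le> s" "s < grid_point a \<delta> (Suc i)"
  shows "{j \<in> {1..n}. x j \<le> s} = {j \<in> {1..n}. x j \<le> grid_point a \<delta> i}"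
proof -
  have "x j \<le> s \<longleftrightarrow> x j \<le> grid_point a \<delta> i" if j: "j \<in> {1..n}" for j
  proof -
    obtain k where k: "x j = grid_point a \<delta> k" using x[OF j] by auto
    have "k \<le> i" if "grid_point a \<delta> k \<le> s"
      using order.strict_trans1[OF that assms(2)] \<delta> by (simp add: grid_point_less_iff)
    moreover have "grid_point a \<delta> k \<le> s" if "k \<le> i"
      using order_trans[OF _ assms(1)] that \<delta> by (simp add: grid_point_le_iff)
    ultimately show ?thesis using k \<delta> by (auto simp: grid_point_le_iff)
  qed
  then show ?thesis by blast
qed

lemma npmle_step:
  assumes "grid_point a \<delta> i \<le> s" "s < grid_point a \<delta> (Suc i)"
  shows "npmle a b n x y s = npmle a b n x y (grid_point a \<delta> i)"
proof -
  have "emp_G n x s = emp_G n x (grid_point a \<delta> i)"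
    by (simp only: emp_G_def observed_upto[OF assms])
  then show ?thesis by (simp only: npmle_def)
qed

lemma npmle_zero:
  assumes "a \<le> s" "s < grid_point a \<delta> 1" shows "npmle a b n x y s = 0"
proof -
  have "{j \<in> {1..n}. x j \<le> grid_point a \<delta> 0} = {}"
    using x \<delta> by (fastforce simp: grid_point_le_iff)
  then show ?thesis
    using npmle_step[of 0 s] assms by (simp add: npmle_def emp_G_def grid_point_def)
qed

text \<open>
  The vector of values at the grid points is nondecreasing and minimizes the weighted sum of
  squares; the second sum on the left gives uniqueness at grid points with \<open>N i > 0\<close>.
  (If \<open>N i = 0\<close> then \<open>Z i / N i = 0\<close>, but the weight of that term is 0.)
\<close>

lemma npmle_isotonic_regression:
  defines "K \<equiv> grid_size a b \<delta>"
    and "N \<equiv> (\<lambda>i. real (card {j \<in> {1..n}. x j = grid_point a \<delta> i}))"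
    and "Z \<equiv> (\<lambda>i. \<Sum>j | j \<in> {1..n} \<and> x j = grid_point a \<delta> i. y j)"
    and "m \<equiv> (\<lambda>i. npmle a b n x y (grid_point a \<delta> i))"
  shows "mono_on {1..K} m"
    and "mono_on {1..K} u \<Longrightarrow>
      (\<Sum>i=1..K. N i * (Z i / N i - m i)\<^sup>2) + (\<Sum>i=1..K. N i * (u i - m i)\<^sup>2)
        \<le> (\<Sum>i=1..K. N i * (Z i / N i - u i)\<^sup>2)"
proof -
  let ?t = "grid_point a \<delta>"
  define G where "G i = emp_G n x (?t i)" for i
  define V where "V i = emp_V n x y (?t i)" for i
  define S where "S = (\<lambda>i. (G i, V i)) ` {0..K}"
  have obs0: "{j \<in> {1..n}. x j \<le> ?t 0} = {}" using x \<delta> by (fastforce simp: grid_point_le_iff)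
  have split: "{j \<in> {1..n}. x j \<le> ?t (Suc i)} = {j \<in> {1..n}. x j \<le> ?t i} \<union> {j \<in> {1..n}. x j = ?t (Suc i)}"
    (is "?A = ?B \<union> ?C") for i
    using x \<delta> by (fastforce simp: grid_point_le_iff grid_point_def le_Suc_eq)
  have disj: "{j \<in> {1..n}. x j \<le> ?t i} \<inter> {j \<in> {1..n}. x j = ?t (Suc i)} = {}" for i
    using \<delta> by (auto simp: grid_point_le_iff)
  have stepG: "G (Suc i) - G i = N (Suc i) / n" for i
    unfolding G_def emp_G_def split N_def
    by (subst card_Un_disjoint[OF _ _ disj]) (auto simp: add_divide_distrib)
  have stepV: "V (Suc i) - V i = Z (Suc i) / n" for i
    unfolding V_def emp_V_def split Z_def
    by (subst sum.union_disjoint[OF _ _ disj]) (auto simp: add_divide_distrib)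
  have N0: "0 \<le> N i" and Z0: "0 \<le> Z i" for i using y by (auto simp: N_def Z_def intro!: sum_nonneg)
  have NZ: "Z i = 0" if "N i = 0" for i
  proof -
    have "{j \<in> {1..n}. x j = ?t i} = {}" using that by (simp add: N_def)
    then show ?thesis unfolding Z_def by (simp only: sum.empty)
  qed
  have init: "G 0 = 0" "V 0 = 0" unfolding G_def V_def emp_G_def emp_V_def obs0 by simp_all
  have Kb: "?t K \<le> b"
  proof -
    have "real K \<le> (b - a) / \<delta>" using \<delta> ab by (simp add: K_def grid_size_def)
    then show ?thesis using \<delta> by (simp add: grid_point_def field_simps)
  qed
  have S: "(\<lambda>t. (emp_G n x t, emp_V n x y t)) ` {a..b} = S"
  proof
    show "S \<subseteq> (\<lambda>t. (emp_G n x t, emp_V n x y t)) ` {a..b}"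
    proof -
      have "?t i \<in> {a..b}" if "i \<le> K" for i
      proof -
        have "?t 0 \<le> ?t i" "?t i \<le> ?t K" using that \<delta> by (auto simp: grid_point_le_iff)
        then show ?thesis using Kb by (simp add: grid_point_def)
      qed
      then show ?thesis by (auto simp: S_def G_def V_def)
    qed
    show "(\<lambda>t. (emp_G n x t, emp_V n x y t)) ` {a..b} \<subseteq> S"
    proof (clarify)
      fix s assume s: "s \<in> {a..b}"
      define i where "i = nat \<lfloor>(s - a) / \<delta>\<rfloor>"
      have "real i \<le> (s - a) / \<delta>" "(s - a) / \<delta> < real (Suc i)"
        using s \<delta> unfolding i_def by (simp, subst of_nat_Suc, simp, linarith)
      then have i: "?t i \<le> s" "s < ?t (Suc i)" using \<delta> by (auto simp: grid_point_def field_simps)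
      have "i \<le> K" using s \<delta> by (auto simp: i_def K_def grid_size_def intro!: nat_mono floor_mono divide_right_mono)
      moreover have "emp_G n x s = G i" "emp_V n x y s = V i"
        by (simp_all only: G_def V_def emp_G_def emp_V_def observed_upto[OF i])
      ultimately show "(emp_G n x s, emp_V n x y s) \<in> S" by (auto simp: S_def)
    qed
  qed
  have m: "m i = (if G i = 0 then 0 else gcm_left_slope S (G i))" for i
    by (simp add: m_def npmle_def S G_def)
  have st: "G i \<le> G (Suc i)" "V i \<le> V (Suc i)" "G (Suc i) = G i \<Longrightarrow> V (Suc i) = V i" for i
  proof -
    have "0 \<le> G (Suc i) - G i" "0 \<le> V (Suc i) - V i"
      unfolding stepG stepV using N0[of "Suc i"] Z0[of "Suc i"] by simp_all
    then show "G i \<le> G (Suc i)" "V i \<le> V (Suc i)" by simp_all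
    assume "G (Suc i) = G i"
    then have "N (Suc i) = 0" using stepG[of i] n by simp
    then show "V (Suc i) = V i" using stepV[of i] NZ[of "Suc i"] by simp
  qed
  have mstep: "m i \<le> m (Suc i)" if "i < K" for i
    unfolding m S_def by (rule isotonic_slopes(1)) (use init st that in blast)+
  show "mono_on {1..K} m"
  proof (rule mono_onI)
    fix i j assume "i \<in> {1..K}" "j \<in> {1..K}" "i \<le> j"
    then have "j \<le> K" by simp
    with \<open>i \<le> j\<close> show "m i \<le> m j"
    proof (induction j rule: dec_induct)
      case (step k)
      then show ?case using mstep[of k] by simp
    qed simp
  qed
  assume u: "mono_on {1..K} u"
  have "(\<Sum>i=1..K. ((V i - V (i - 1)) - m i * (G i - G (i - 1))) * (u i - m i)) \<le> 0"
  proof -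
    have u': "u i \<le> u (Suc i)" if "1 \<le> i" "i < K" for i using that u by (auto simp: mono_on_def)
    show ?thesis
      unfolding m S_def by (rule isotonic_slopes(2)) (use init st u' in blast)+
  qed
  also have "(\<Sum>i=1..K. ((V i - V (i - 1)) - m i * (G i - G (i - 1))) * (u i - m i))
      = (\<Sum>i=1..K. (Z i - m i * N i) * (u i - m i)) / n"
    unfolding sum_divide_distrib
  proof (rule sum.cong[OF refl])
    fix i assume "i \<in> {1..K}"
    then obtain k where "i = Suc k" by (cases i) auto
    then show "((V i - V (i - 1)) - m i * (G i - G (i - 1))) * (u i - m i)
        = (Z i - m i * N i) * (u i - m i) / n"
      by (simp add: stepG stepV diff_divide_distrib left_diff_distrib)
  qed
  finally have var: "(\<Sum>i=1..K. (Z i - m i * N i) * (u i - m i)) \<le> 0"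
    using n by (simp add: divide_le_0_iff)
  have "N i * (Z i / N i - u i)\<^sup>2 = N i * (Z i / N i - m i)\<^sup>2 + N i * (u i - m i)\<^sup>2
      - 2 * ((Z i - m i * N i) * (u i - m i))" for i
  proof (cases "N i = 0")
    case True then show ?thesis using NZ[of i] by simp
  next
    case False
    define w where "w = Z i / N i"
    have "Z i = N i * w" using False by (simp add: w_def)
    then show ?thesis unfolding w_def[symmetric] by (simp add: power2_eq_square algebra_simps)
  qed
  then have "(\<Sum>i=1..K. N i * (Z i / N i - u i)\<^sup>2)
      = (\<Sum>i=1..K. N i * (Z i / N i - m i)\<^sup>2) + (\<Sum>i=1..K. N i * (u i - m i)\<^sup>2)
        - 2 * (\<Sum>i=1..K. (Z i - m i * N i) * (u i - m i))"
    by (simp add: sum.distrib sum_subtractf sum_distrib_left)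
  with var show "(\<Sum>i=1..K. N i * (Z i / N i - m i)\<^sup>2) + (\<Sum>i=1..K. N i * (u i - m i)\<^sup>2)
        \<le> (\<Sum>i=1..K. N i * (Z i / N i - u i)\<^sup>2)" by linarith
qed

end


section \<open>The limit process\<close>

definition two_sided_brownian_motion :: "'b measure \<Rightarrow> (real \<Rightarrow> 'b \<Rightarrow> real) \<Rightarrow> bool" where
  "two_sided_brownian_motion M W \<longleftrightarrow>
     prob_space M \<and>
     (\<forall>t. W t \<in> borel_measurable M) \<and>
     (AE \<omega> in M. W 0 \<omega> = 0) \<and>
     (AE \<omega> in M. continuous_on UNIV (\<lambda>t. W t \<omega>)) \<and>
     (\<forall>s t. s < t \<longrightarrow>
        distributed M lborel (\<lambda>\<omega>. W t \<omega> - W s \<omega>) (normal_density 0 (sqrt (t - s)))) \<and>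
     (\<forall>\<tau> k. strict_mono_on {..k::nat} \<tau> \<longrightarrow>
        prob_space.indep_vars M (\<lambda>_. borel) (\<lambda>i \<omega>. W (\<tau> (Suc i)) \<omega> - W (\<tau> i) \<omega>) {..<k})"

text \<open>The drift is \<open>k (1 + k)\<close> rather than \<open>k\<^sup>2\<close>, so the point set is not symmetric around \<open>k = 0\<close>.\<close>

definition limit_point :: "real \<Rightarrow> real \<Rightarrow> real \<Rightarrow> (real \<Rightarrow> real) \<Rightarrow> int \<Rightarrow> real \<times> real" where
  "limit_point c \<kappa>\<^sub>1 \<kappa>\<^sub>2 w k =
     (c * of_int k, \<kappa>\<^sub>1 * w (c * of_int k) + \<kappa>\<^sub>2 * c\<^sup>2 * of_int k * (1 + of_int k))"

definition limit_slope :: "real \<Rightarrow> real \<Rightarrow> real \<Rightarrow> (real \<Rightarrow> real) \<Rightarrow> int \<Rightarrow> real" where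
  "limit_slope c \<kappa>\<^sub>1 \<kappa>\<^sub>2 w i = gcm_left_slope (range (limit_point c \<kappa>\<^sub>1 \<kappa>\<^sub>2 w)) (c * of_int i)"


section \<open>The local process of the estimator\<close>

text \<open>
  The estimator is only of interest on \<open>[a, b]\<close>; for fixed \<open>i\<close> and \<open>a < x\<^sub>0 < b\<close>, the argument
  of \<open>npmle\<close> lies there for all large \<open>n\<close>.
\<close>

definition local_process ::
    "(real \<Rightarrow> real) \<Rightarrow> real \<Rightarrow> real \<Rightarrow> real \<Rightarrow> real \<Rightarrow> nat \<Rightarrow> (nat \<Rightarrow> real) \<Rightarrow> (nat \<Rightarrow> real) \<Rightarrow> int \<Rightarrow> real"
  where
  "local_process F a b c x\<^sub>0 n x y i =
     (let t\<^sub>l = last_grid_point a b (grid_step c (1/3) n) x\<^sub>0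
      in real n powr (1/3) *
           (npmle a b n x y (t\<^sub>l + c * of_int i * real n powr (- (1/3))) - F t\<^sub>l))"

end

theory Submission
  imports Defs
begin

text \<open>
  Near \<open>x\<^sub>0\<close> the estimator is the left slope of the greatest convex minorant of the cusum points,
  and so is the limit process for its lattice points. If a line through one
  point on either side of \<open>x\<^sub>0\<close> lies below all these points, then the slopes in between are given by
  the max-min formula restricted to a finite window. They are then a continuous function of
  finitely many cell sums.

  For the estimator such lines, with slopes \<open>F(t\<^sub>l) \<plusminus> B n powr (-1/3)\<close>, exist with probability close to one:
  the drift of the cusum points away from the line is quadratic in the number of cells and the
  variance is linear, so that a union bound over Chebyshev inequalities suffices. For the limit
  process the window is eventually large enough almost surely. The joint characteristic function
  of the cell sums is an \<open>n\<close>-th power by independence and converges to that of the increments of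
  Brownian motion with drift; convergence of characteristic functions is turned into weak
  convergence in several dimensions by trigonometric approximation on large cubes.
\<close>

section \<open>Max-min formula on a window\<close>

text \<open>The window must be fixed before n grows, so the order of choices matters. The line
  through the point at N has to stay below the points on its left from distance 1 on, but on its
  right only beyond the window. A large B makes the left requirement likely at every distance; on
  the right it costs a term linear in the distance, which the quadratic drift absorbs after some m0
  cells, and R is taken beyond those. The mirror image with slope offset -B passes through -N-1,
  because a left slope at -N needs a point strictly to its left.

  Means are compared with L m^(3/2): a sum over m cells has variance of order m, so a mean of this
  size gives Chebyshev bounds of order 1/(L m)^2, summable with total O(1/L^2), while quadratic
  drift still dominates m^(3/2).

  Inside the window a cell holds about n^(2/3) observations. Its centred sum, divided by n^(1/3), is
  asymptotically normal, and its count, divided by n^(2/3), tends to a constant.\<close>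

lemma gcm_left_slope_affine:
  assumes "p < x" and eq: "\<And>y. p \<le> y \<Longrightarrow> y \<le> x \<Longrightarrow> gcm S y = \<tau> + \<sigma> * y"
  shows "gcm_left_slope S x = \<sigma>"
proof -
  have "((\<lambda>y. \<tau> + \<sigma> * y) has_vector_derivative \<sigma>) (at_left x)"
    unfolding has_real_derivative_iff_has_vector_derivative[symmetric]
    by (auto intro!: derivative_eq_intros)
  moreover have "\<forall>\<^sub>F y in nhds x. y \<in> {..<x} \<longrightarrow> gcm S y = \<tau> + \<sigma> * y"
    using eventually_nhds_in_open[of "{p<..}" x] assms by (auto elim!: eventually_mono intro: eq)
  ultimately have "(gcm S has_vector_derivative \<sigma>) (at_left x)"
    using eq[of x] assms
    by (subst has_vector_derivative_cong_ev[where g = "\<lambda>y. \<tau> + \<sigma> * y"]) auto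
  then show ?thesis unfolding gcm_left_slope_def by (intro vector_derivative_within) auto
qed

text \<open>The line is itself a minorant and, by convexity, the largest one between its contact
  points, so the supremum in \<open>gcm\<close> is attained there. Finiteness of \<open>S\<close> is
  not assumed, because the lattice of the limit process is infinite.\<close>

lemma gcm_left_slope_contact_line:
  assumes below: "\<And>u v. (u, v) \<in> S \<Longrightarrow> \<tau> + \<sigma> * u \<le> v"
    and touch: "(p, \<tau> + \<sigma> * p) \<in> S" "(q, \<tau> + \<sigma> * q) \<in> S"
    and x: "p < x" "x \<le> q"
  shows "gcm_left_slope S x = \<sigma>"
proof -
  let ?D = "convex hull (fst ` S)"
  have line: "convex_on ?D (\<lambda>u. \<tau> + \<sigma> * u)"
    by (rule convex_onI) (auto simp: algebra_simps)
  have pq: "p \<in> ?D" "q \<in> ?D" using touch by (force intro: hull_inc)+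
  have eq: "gcm S y = \<tau> + \<sigma> * y" if y: "p \<le> y" "y \<le> q" for y
    unfolding gcm_def
  proof (rule cSup_eq_maximum)
    show "\<tau> + \<sigma> * y \<in> {h y |h. convex_on ?D h \<and> (\<forall>(u, v)\<in>S. h u \<le> v)}"
      by (intro CollectI exI[of _ "\<lambda>u. \<tau> + \<sigma> * u"]) (use line below in auto)
    fix z assume "z \<in> {h y |h. convex_on ?D h \<and> (\<forall>(u, v)\<in>S. h u \<le> v)}"
    then obtain h where h: "z = h y" "convex_on ?D h" "\<And>u v. (u, v) \<in> S \<Longrightarrow> h u \<le> v" by auto
    have b: "h p \<le> \<tau> + \<sigma> * p" "h q \<le> \<tau> + \<sigma> * q" using h(3) touch by auto
    show "z \<le> \<tau> + \<sigma> * y"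
    proof (cases "y = p \<or> y = q")
      case True then show ?thesis using b h(1) by auto
    next
      case False
      then have "p < y" "y < q" using y by auto
      then have "(q - p) * h y \<le> (q - y) * h p + (y - p) * h q"
        using three_points[OF h(2) pq] by blast
      also have "\<dots> \<le> (q - y) * (\<tau> + \<sigma> * p) + (y - p) * (\<tau> + \<sigma> * q)"
        using b y by (intro add_mono mult_left_mono) auto
      also have "\<dots> = (q - p) * (\<tau> + \<sigma> * y)" by (simp add: algebra_simps)
      finally show ?thesis using \<open>p < y\<close> \<open>y < q\<close> h(1) by simp
    qed
  qed
  show ?thesis
  proof (rule gcm_left_slope_affine[of p])
    show "gcm S y = \<tau> + \<sigma> * y" if "p \<le> y" "y \<le> x" for y using eq that x by auto
  qed (fact x)
qed

text \<open>The max-min formula of isotonic regression. Left ends lie strictly before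
  \<open>i\<close> and right ends from \<open>i\<close> on, which makes it the slope of the segment
  arriving at \<open>i\<close> from the left.\<close>

definition maxmin_slope :: "int \<Rightarrow> (int \<Rightarrow> real) \<Rightarrow> (int \<Rightarrow> real) \<Rightarrow> int \<Rightarrow> real" where
  "maxmin_slope R x y i = (MAX j\<in>{-R..i-1}. MIN m\<in>{i..R}. (y m - y j) / (x m - x j))"

lemma maxmin_slope_contact:
  fixes x y :: "int \<Rightarrow> real"
  assumes x: "strict_mono_on {-R..R} x" and i: "-R < i" "i \<le> R"
  defines "\<sigma> \<equiv> maxmin_slope R x y i"
  obtains \<tau> j m where "j \<in> {-R..i-1}" "m \<in> {i..R}" "y j = \<tau> + \<sigma> * x j" "y m = \<tau> + \<sigma> * x m"
    "\<And>k. k \<in> {-R..R} \<Longrightarrow> \<tau> + \<sigma> * x k \<le> y k"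
proof -
  let ?s = "\<lambda>j m. (y m - y j) / (x m - x j)"
  let ?f = "\<lambda>j. MIN m\<in>{i..R}. ?s j m"
  have lt: "x j < x m" if "j \<in> {-R..i-1}" "m \<in> {i..R}" for j m
    using strict_mono_onD[OF x, of j m] that by auto
  have "\<sigma> \<in> ?f ` {-R..i-1}" unfolding \<sigma>_def maxmin_slope_def using i by (intro Max_in) auto
  then obtain j where j: "j \<in> {-R..i-1}" "\<sigma> = ?f j" by auto
  have "?f j \<in> ?s j ` {i..R}" using i by (intro Min_in) auto
  then obtain m where m: "m \<in> {i..R}" "\<sigma> = ?s j m" using j by auto
  have right: "y j + \<sigma> * (x k - x j) \<le> y k" if k: "k \<in> {i..R}" for k
  proof -
    have "\<sigma> \<le> ?s j k" unfolding j(2) using k by (intro Min_le) auto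
    then show ?thesis using lt[OF j(1) k] by (simp add: field_simps)
  qed
  \<comment> \<open>A point left of \<open>i\<close> below the line would see every point from
    \<open>i\<close> on along a chord steeper than \<sigma>, so its inner minimum would exceed the
    maximum.\<close>
  have left: "y j + \<sigma> * (x k - x j) \<le> y k" if k: "k \<in> {-R..i-1}" for k
  proof (rule ccontr)
    assume "\<not> ?thesis"
    then have c: "y k < y j + \<sigma> * (x k - x j)" by simp
    have "\<sigma> < ?s k m'" if m': "m' \<in> {i..R}" for m'
    proof -
      have "\<sigma> * (x m' - x k) < y m' - y k" using right[OF m'] c by (simp add: algebra_simps)
      then show ?thesis using lt[OF k m'] by (simp add: field_simps)
    qed
    then have "\<sigma> < ?f k" using i by (subst Min_gr_iff) auto
    also have "?f k \<le> \<sigma>" unfolding \<sigma>_def maxmin_slope_def using k by (intro Max_ge) auto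
    finally show False by simp
  qed
  have "y m = y j + \<sigma> * (x m - x j)" using m lt[OF j(1) m(1)] by simp
  moreover have "y j + \<sigma> * (x k - x j) \<le> y k" if "k \<in> {-R..R}" for k
    using left[of k] right[of k] that by (cases "k < i") auto
  ultimately show thesis
    using j m(1) by (intro that[of j m "y j - \<sigma> * x j"]) (auto simp: algebra_simps)
qed

text \<open>
  The contact line of the window has slope between \<open>sl\<close> and \<open>sr\<close>, because it touches on both
  sides of \<open>i\<close>; it therefore also lies below the points outside the window.
\<close>

lemma gcm_left_slope_window:
  assumes x: "strict_mono_on {-R..R} x"
    and i: "-R \<le> lo" "lo < i" "i \<le> hi" "hi \<le> R"
    and window: "\<And>k. k \<in> {-R..R} \<Longrightarrow> (x k, y k) \<in> S"
    and cover: "\<And>u v. (u, v) \<in> S \<Longrightarrow> (\<exists>k\<in>{-R..R}. u = x k \<and> v = y k)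
        \<or> x hi \<le> u \<and> y hi + sr * (u - x hi) \<le> v \<or> u \<le> x lo \<and> y lo + sl * (u - x lo) \<le> v"
    and hi: "\<And>k. k \<in> {-R..<hi} \<Longrightarrow> y hi + sr * (x k - x hi) \<le> y k"
    and lo: "\<And>k. k \<in> {lo<..R} \<Longrightarrow> y lo + sl * (x k - x lo) \<le> y k"
  shows "gcm_left_slope S (x i) = maxmin_slope R x y i"
proof -
  define \<sigma> where "\<sigma> = maxmin_slope R x y i"
  obtain \<tau> j m where *: "j \<in> {-R..i-1}" "m \<in> {i..R}" "y j = \<tau> + \<sigma> * x j" "y m = \<tau> + \<sigma> * x m"
    "\<And>k. k \<in> {-R..R} \<Longrightarrow> \<tau> + \<sigma> * x k \<le> y k"
    using maxmin_slope_contact[OF x, of i y thesis] i unfolding \<sigma>_def[symmetric] by force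
  have lt: "x j < x k" if "-R \<le> j" "j < k" "k \<le> R" for j k
    using strict_mono_onD[OF x, of j k] that by auto
  have above: "\<tau> + \<sigma> * x hi \<le> y hi" "\<tau> + \<sigma> * x lo \<le> y lo" using *(5) i by auto
  \<comment> \<open>The contact line touches at \<open>j\<close>, left of \<open>hi\<close>, where
    the line of slope \<open>sr\<close> is not higher, and it passes not above the point at
    \<open>hi\<close>, which the latter line goes through.\<close>
  have sr: "\<sigma> \<le> sr"
  proof -
    have "y hi + sr * (x j - x hi) \<le> y j" using hi[of j] *(1) i by auto
    then have "(\<sigma> - sr) * (x hi - x j) \<le> 0" using *(3) above by (simp add: algebra_simps)
    moreover have "x j < x hi" using lt[of j hi] *(1) i by auto
    ultimately show ?thesis by (simp add: mult_le_0_iff)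
  qed
  have sl: "sl \<le> \<sigma>"
  proof -
    have "y lo + sl * (x m - x lo) \<le> y m" using lo[of m] *(2) i by auto
    then have "(sl - \<sigma>) * (x m - x lo) \<le> 0" using *(4) above by (simp add: algebra_simps)
    moreover have "x lo < x m" using lt[of lo m] *(2) i by auto
    ultimately show ?thesis by (simp add: mult_le_0_iff)
  qed
  have "\<tau> + \<sigma> * u \<le> v" if uv: "(u, v) \<in> S" for u v
  proof -
    from cover[OF uv] consider k where "k \<in> {-R..R}" "u = x k" "v = y k"
      | "x hi \<le> u" "y hi + sr * (u - x hi) \<le> v" | "u \<le> x lo" "y lo + sl * (u - x lo) \<le> v"
      by blast
    then show ?thesis
    proof cases
      case 1 then show ?thesis using *(5) by auto
    next
      case 2
      have "\<sigma> * (u - x hi) \<le> sr * (u - x hi)" using sr 2 by (intro mult_right_mono) auto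
      then show ?thesis using 2 above(1) by (simp add: algebra_simps)
    next
      case 3
      have "\<sigma> * (u - x lo) \<le> sl * (u - x lo)" using sl 3 by (intro mult_right_mono_neg) auto
      then show ?thesis using 3 above(2) by (simp add: algebra_simps)
    qed
  qed
  moreover have "x j < x i" using lt[of j i] *(1) i by auto
  moreover have "x i \<le> x m"
    using lt[of i m] *(2) i by (cases "i = m") auto
  moreover have "(x j, y j) \<in> S" "(x m, y m) \<in> S" using window *(1,2) i by auto
  ultimately show ?thesis
    using gcm_left_slope_contact_line[of S \<tau> \<sigma> "x j" "x m" "x i"] *(3,4) by (simp add: \<sigma>_def)
qed

text \<open>
  The first component of an index is the cell of the grid relative to the point of interest; the
  second one selects the increment of the centred process or the increment of the design.
  Truncation from below by \<open>q\<close> makes the map continuous.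
\<close>

definition window_slope :: "real \<Rightarrow> int \<Rightarrow> (int \<times> bool \<Rightarrow> real) \<Rightarrow> int \<Rightarrow> real" where
  "window_slope q R v i = (MAX j\<in>{-R..i-1}. MIN m\<in>{i..R}.
     (\<Sum>k\<in>{j<..m}. v (k, True)) / (\<Sum>k\<in>{j<..m}. max q (v (k, False))))"

text \<open>Increasing affine maps commute with \<open>Max\<close> and \<open>Min\<close>, so
  centring by \<theta> and rescaling by \<open>r\<close> may be verified chord by chord.\<close>

lemma window_slope_eq_maxmin:
  assumes i: "-R < i" "i \<le> R" and r: "0 \<le> r"
    and eq: "\<And>j m. j \<in> {-R..i-1} \<Longrightarrow> m \<in> {i..R} \<Longrightarrow>
      (\<Sum>k\<in>{j<..m}. v (k, True)) / (\<Sum>k\<in>{j<..m}. max q (v (k, False)))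
        = r * ((y m - y j) / (x m - x j) - \<theta>)"
  shows "window_slope q R v i = r * (maxmin_slope R x y i - \<theta>)"
proof -
  have m: "mono (\<lambda>s. r * (s - \<theta>))" using r by (intro monoI mult_left_mono) auto
  have "(MIN m\<in>{i..R}. (\<Sum>k\<in>{j<..m}. v (k, True)) / (\<Sum>k\<in>{j<..m}. max q (v (k, False))))
      = r * ((MIN m\<in>{i..R}. (y m - y j) / (x m - x j)) - \<theta>)" if "j \<in> {-R..i-1}" for j
    using i that by (subst mono_Min_commute[OF m]) (auto simp: image_image eq)
  then show ?thesis unfolding maxmin_slope_def window_slope_def
    using i by (subst mono_Max_commute[OF m]) (auto simp: image_image)
qed

lemma continuous_on_Max_image:
  fixes f :: "'i \<Rightarrow> 'a::topological_space \<Rightarrow> 'b::linorder_topology"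
  assumes "finite I" "I \<noteq> {}" "\<And>i. i \<in> I \<Longrightarrow> continuous_on A (f i)"
  shows "continuous_on A (\<lambda>x. MAX i\<in>I. f i x)"
  using assms
proof (induction rule: finite_ne_induct)
  case (insert i I)
  then show ?case by (auto intro!: continuous_intros)
qed auto

lemma continuous_on_Min_image:
  fixes f :: "'i \<Rightarrow> 'a::topological_space \<Rightarrow> 'b::linorder_topology"
  assumes "finite I" "I \<noteq> {}" "\<And>i. i \<in> I \<Longrightarrow> continuous_on A (f i)"
  shows "continuous_on A (\<lambda>x. MIN i\<in>I. f i x)"
  using assms
proof (induction rule: finite_ne_induct)
  case (insert i I)
  then show ?case by (auto intro!: continuous_intros)
qed auto

lemma continuous_window_slope:
  assumes "0 < q" "-R < i" "i \<le> R"
  shows "continuous_on UNIV (\<lambda>v. window_slope q R v i)"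
  unfolding window_slope_def
proof (intro continuous_on_Max_image continuous_on_Min_image)
  fix j m assume jm: "j \<in> {-R..i-1}" "m \<in> {i..R}"
  have "0 < (\<Sum>k\<in>{j<..m}. max q (v (k, False)))" for v :: "int \<times> bool \<Rightarrow> real"
    using assms jm by (intro sum_pos) (auto simp: less_max_iff_disj)
  then show "continuous_on UNIV (\<lambda>v. (\<Sum>k\<in>{j<..m}. v (k, True)) / (\<Sum>k\<in>{j<..m}. max q (v (k, False))))"
    by (intro continuous_intros continuous_on_product_coordinates ballI less_imp_neq[symmetric])
qed (use assms in auto)

section \<open>Measurability of convex minorant slopes\<close>

text \<open>Finite truncations of the lattice. Their minorants are continuous in the ordinates, and
  the minorant of the whole lattice is obtained as a countable limit, which is what measurability
  needs.\<close>

definition window_points :: "real \<Rightarrow> (int \<Rightarrow> real) \<Rightarrow> nat \<Rightarrow> (real \<times> real) set" where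
  "window_points c p R = (\<lambda>k. (c * of_int k, p k)) ` {- int R..int R}"

lemma window_points_hull:
  assumes "0 < c"
  shows "finite (window_points c p R)" "- (c * real R) \<le> c * real R"
    "(- (c * real R), p (- int R)) \<in> window_points c p R" "(c * real R, p (int R)) \<in> window_points c p R"
    "fst ` window_points c p R \<subseteq> {- (c * real R)..c * real R}"
proof -
  have "- (c * real R) \<le> c * of_int k \<and> c * of_int k \<le> c * real R"
    if "- int R \<le> k" "k \<le> int R" for k
  proof -
    have "\<bar>c * of_int k\<bar> \<le> c * real R"
      unfolding abs_mult using assms that by (intro mult_mono) (auto simp flip: of_int_abs)
    then show ?thesis by linarith
  qed
  then show "fst ` window_points c p R \<subseteq> {- (c * real R)..c * real R}"
    by (auto simp: window_points_def)
qed (use assms in \<open>auto simp: window_points_def image_iff intro: bexI[of _ "- int R"] bexI[of _ "int R"]\<close>)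

text \<open>Lowering a minorant of one point set by \<open>e\<close> yields a minorant of the
  other.\<close>

lemma gcm_window_points_lipschitz:
  assumes c: "0 < c" and x: "x \<in> {- (c * real R)..c * real R}"
    and pq: "\<And>k. k \<in> {- int R..int R} \<Longrightarrow> \<bar>p k - q k\<bar> \<le> e"
  shows "\<bar>gcm (window_points c p R) x - gcm (window_points c q R) x\<bar> \<le> e"
proof -
  have *: "gcm (window_points c p R) x \<le> gcm (window_points c q R) x + e"
    if pq: "\<And>k. k \<in> {- int R..int R} \<Longrightarrow> \<bar>p k - q k\<bar> \<le> e" for p q
  proof (rule gcm_least[OF window_points_hull[OF c]])
    fix h assume h: "convex_on {- (c * real R)..c * real R} h \<and> (\<forall>(u, v)\<in>window_points c p R. h u \<le> v)"
    have "h x + - e \<le> gcm (window_points c q R) x"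
    proof (rule gcm_greatest[OF window_points_hull[OF c] _ x], intro conjI ballI)
      show "convex_on {- (c * real R)..c * real R} (\<lambda>x. h x + - e)"
        using h by (intro convex_on_add convex_on_const[THEN iffD2]) auto
      show "case z of (u, v) \<Rightarrow> h u + - e \<le> v" if "z \<in> window_points c q R" for z
      proof -
        from that obtain k where k: "k \<in> {- int R..int R}" "z = (c * of_int k, q k)"
          by (auto simp: window_points_def)
        then have "h (c * of_int k) \<le> p k" using h by (auto simp: window_points_def)
        then show ?thesis using pq[OF k(1)] k(2) by auto
      qed
    qed
    then show "h x \<le> gcm (window_points c q R) x + e" by simp
  qed
  show ?thesis using *[of p q] *[of q p] pq by (auto simp: abs_minus_commute abs_le_iff)
qed

lemma continuous_gcm_window_points:
  assumes c: "0 < c" and x: "x \<in> {- (c * real R)..c * real R}"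
  shows "continuous_on UNIV (\<lambda>p. gcm (window_points c p R) x)"
  unfolding continuous_on_def
proof (intro ballI tendstoI)
  fix p :: "int \<Rightarrow> real" and e :: real assume e: "0 < e"
  have "\<forall>\<^sub>F q in at p. \<forall>k\<in>{- int R..int R}. dist (q k) (p k) < e / 2"
  proof (intro eventually_ball_finite ballI)
    fix k
    have "((\<lambda>q. q k) \<longlongrightarrow> p k) (at p)"
      using continuous_on_product_coordinates[of k] by (auto simp: continuous_on_def)
    then show "\<forall>\<^sub>F q in at p. dist (q k) (p k) < e / 2" using e by (intro tendstoD) auto
  qed simp
  then show "\<forall>\<^sub>F q in at p. dist (gcm (window_points c q R) x) (gcm (window_points c p R) x) < e"
  proof (rule eventually_mono)
    fix q assume "\<forall>k\<in>{- int R..int R}. dist (q k) (p k) < e / 2"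
    then have "\<bar>gcm (window_points c q R) x - gcm (window_points c p R) x\<bar> \<le> e / 2"
      by (intro gcm_window_points_lipschitz[OF c x]) (auto simp: dist_real_def less_imp_le)
    then show "dist (gcm (window_points c q R) x) (gcm (window_points c p R) x) < e"
      using e by (simp add: dist_real_def)
  qed
qed

lemma gcm_window_points_antimono:
  assumes c: "0 < c" and x: "x \<in> {- (c * real R)..c * real R}" and R: "R \<le> R'"
  shows "gcm (window_points c p R') x \<le> gcm (window_points c p R) x"
proof (rule gcm_least[OF window_points_hull[OF c]])
  have sub: "{- (c * real R)..c * real R} \<subseteq> {- (c * real R')..c * real R'}"
    using c R by (auto intro: order_trans[OF _ mult_left_mono] mult_left_mono)
  fix h assume h: "convex_on {- (c * real R')..c * real R'} h \<and> (\<forall>(u, v)\<in>window_points c p R'. h u \<le> v)"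
  show "h x \<le> gcm (window_points c p R) x"
    using h convex_on_subset[OF conjunct1[OF h] sub] R
    by (intro gcm_greatest[OF window_points_hull[OF c] _ x]) (auto simp: window_points_def)
qed

text \<open>Between neighbouring abscissae there is no constraint, hence no kink. Convergence of the
  truncated minorants at lattice points therefore gives convergence everywhere.\<close>

lemma gcm_window_points_affine:
  assumes c: "0 < c" and i: "- int R < i" "i \<le> int R"
    and x: "c * (of_int i - 1) \<le> x" "x \<le> c * of_int i"
  shows "gcm (window_points c p R) x = chord (gcm (window_points c p R)) (c * (of_int i - 1)) (c * of_int i) x"
proof (rule gcm_chord[OF window_points_hull[OF c]])
  have "- real R \<le> of_int i - 1" "of_int i \<le> real R" using i by linarith+
  then have "c * - real R \<le> c * (of_int i - 1)" "c * of_int i \<le> c * real R"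
    using c by (intro mult_left_mono; simp)+
  then show "- (c * real R) \<le> c * (of_int i - 1)" "c * of_int i \<le> c * real R" by simp_all
  fix u v assume uv: "(u, v) \<in> window_points c p R" "c * (of_int i - 1) < u" "u < c * of_int i"
  then obtain k :: int where "of_int i - 1 < (of_int k :: real)" "(of_int k :: real) < of_int i"
    using c by (auto simp: window_points_def)
  then have "i - 1 < k" "k < i" by linarith+
  then have False by simp
  then show "chord (gcm (window_points c p R)) (c * (of_int i - 1)) (c * of_int i) u \<le> v" ..
qed (use c x in \<open>auto simp: algebra_simps\<close>)

text \<open>The offset \<open>nat \<bar>i\<bar>\<close> keeps \<open>c * i\<close> inside the window
  for every \<open>R\<close>, so the sequence is decreasing from its first term on.\<close>

definition grid_minorant :: "real \<Rightarrow> (int \<Rightarrow> real) \<Rightarrow> int \<Rightarrow> nat \<Rightarrow> real" where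
  "grid_minorant c p i R = gcm (window_points c p (R + nat \<bar>i\<bar>)) (c * of_int i)"

lemma grid_in_window: "0 < c \<Longrightarrow> nat \<bar>i\<bar> \<le> R \<Longrightarrow> c * of_int i \<in> {- (c * real R)..c * real R}"
proof -
  assume *: "0 < c" "nat \<bar>i\<bar> \<le> R"
  have "\<bar>c * of_int i\<bar> \<le> c * real R"
    unfolding abs_mult using * by (intro mult_mono) (auto simp flip: of_int_abs)
  then show ?thesis by (auto simp: abs_le_iff)
qed

lemma lattice_hull:
  assumes "0 < c" shows "convex hull (fst ` range (\<lambda>k::int. (c * of_int k, p k))) = (UNIV :: real set)"
proof -
  have "x \<in> convex hull (fst ` range (\<lambda>k::int. (c * of_int k, p k)))" for x
  proof -
    let ?k = "\<lfloor>x / c\<rfloor>"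
    have "c * of_int j \<in> fst ` range (\<lambda>k::int. (c * of_int k, p k))" for j by force
    then have "{c * of_int ?k, c * of_int (?k + 1)} \<subseteq> fst ` range (\<lambda>k::int. (c * of_int k, p k))"
      by blast
    then have "convex hull {c * of_int ?k, c * of_int (?k + 1)}
        \<subseteq> convex hull (fst ` range (\<lambda>k::int. (c * of_int k, p k)))" by (rule hull_mono)
    moreover have "c * of_int ?k \<le> x" "x \<le> c * of_int (?k + 1)"
      using floor_divide_lower[OF assms, of x] floor_divide_upper[OF assms, of x]
      by (simp_all add: algebra_simps)
    then have "x \<in> closed_segment (c * of_int ?k) (c * of_int (?k + 1))"
      unfolding closed_segment_eq_real_ivl by (metis atLeastAtMost_iff order_trans)
    ultimately show ?thesis unfolding segment_convex_hull by blast
  qed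
  then show ?thesis by auto
qed

text \<open>The pointwise limit of the truncated minorants is convex and below all points. A convex
  minorant of the whole lattice restricts to each window and so stays below the limit; hence the
  limit is the greatest one.\<close>

lemma gcm_lattice_limit:
  assumes c: "0 < c" and S: "S = range (\<lambda>k::int. (c * of_int k, p k))"
    and conv: "\<And>i. convergent (grid_minorant c p i)"
  shows "convex_on UNIV (\<lambda>x. lim (\<lambda>R. gcm (window_points c p R) x))" (is "convex_on _ ?H")
    and "(\<lambda>R. gcm (window_points c p R) x) \<longlonglongrightarrow> gcm S x"
proof -
  have grid: "convergent (\<lambda>R. gcm (window_points c p R) (c * of_int i))" for i :: int
    using conv[of i] unfolding grid_minorant_def
    by (subst (asm) convergent_ignore_initial_segment[of _ "nat \<bar>i\<bar>"])
  have all: "(\<lambda>R. gcm (window_points c p R) x) \<longlonglongrightarrow> ?H x" for x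
  proof -
    define i where "i = \<lceil>x / c\<rceil>"
    have x: "c * (of_int i - 1) \<le> x" "x \<le> c * of_int i"
    proof -
      have "of_int i - 1 \<le> x / c" "x / c \<le> of_int i" unfolding i_def by linarith+
      then show "c * (of_int i - 1) \<le> x" "x \<le> c * of_int i" using c by (auto simp: field_simps)
    qed
    have "convergent (\<lambda>R. chord (gcm (window_points c p R)) (c * (of_int i - 1)) (c * of_int i) x)"
      using grid[of i] grid[of "i - 1"] unfolding chord_def divide_inverse
      by (intro convergent_add convergent_mult convergent_const convergent_diff) auto
    then obtain L where L: "(\<lambda>R. chord (gcm (window_points c p R)) (c * (of_int i - 1)) (c * of_int i) x) \<longlonglongrightarrow> L"
      by (auto simp: convergent_def)
    have "\<forall>\<^sub>F R in sequentially. chord (gcm (window_points c p R)) (c * (of_int i - 1)) (c * of_int i) x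
        = gcm (window_points c p R) x"
      using eventually_gt_at_top[of "nat \<bar>i\<bar>"]
    proof eventually_elim
      case (elim R)
      then show ?case using gcm_window_points_affine[OF c _ _ x, of R p] by auto
    qed
    from Lim_transform_eventually[OF L this]
    have "convergent (\<lambda>R. gcm (window_points c p R) x)" by (auto simp: convergent_def)
    then show ?thesis by (simp add: convergent_LIMSEQ_iff)
  qed
  have inwin: "\<forall>\<^sub>F R in sequentially. x \<in> {- (c * real R)..c * real R}" for x :: real
  proof -
    have "\<forall>\<^sub>F R in sequentially. \<bar>x\<bar> / c \<le> real R" by real_asymp
    then show ?thesis by eventually_elim (use c in \<open>auto simp: field_simps\<close>)
  qed
  show cvx: "convex_on UNIV ?H"
  proof (rule convex_onI)
    fix t x y :: real assume t: "0 < t" "t < 1"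
    let ?z = "(1 - t) *\<^sub>R x + t *\<^sub>R y"
    have "\<forall>\<^sub>F R in sequentially. gcm (window_points c p R) ?z
        \<le> (1 - t) * gcm (window_points c p R) x + t * gcm (window_points c p R) y"
      using inwin[of x] inwin[of y]
    proof eventually_elim
      case (elim R)
      then show ?case using t by (intro convex_onD[OF gcm_convex[OF window_points_hull[OF c]]]) auto
    qed
    then show "?H ?z \<le> (1 - t) * ?H x + t * ?H y"
      by (rule tendsto_le[OF _ tendsto_add[OF tendsto_mult[OF tendsto_const all] tendsto_mult[OF tendsto_const all]] all, rotated]) simp
  qed simp
  have S_def: "gcm S x = Sup {h x |h. convex_on UNIV h \<and>
      (\<forall>(u, v)\<in>range (\<lambda>k::int. (c * of_int k, p k)). h u \<le> v)}"
    unfolding gcm_def S lattice_hull[OF c] ..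
  have "gcm S x = ?H x"
    unfolding S_def
  proof (rule cSup_eq_maximum)
    have "?H (c * of_int k) \<le> p k" for k :: int
    proof (rule LIMSEQ_le_const2[OF all], intro exI[of _ "nat \<bar>k\<bar>"] allI impI)
      fix R assume "nat \<bar>k\<bar> \<le> R"
      then have "k \<in> {- int R..int R}" by auto
      then show "gcm (window_points c p R) (c * of_int k) \<le> p k"
        unfolding window_points_def
        by (intro gcm_below[OF window_points_hull[OF c, unfolded window_points_def]] imageI)
    qed
    then show "?H x \<in> {h x |h. convex_on UNIV h \<and> (\<forall>(u, v)\<in>range (\<lambda>k::int. (c * of_int k, p k)). h u \<le> v)}"
      using cvx by (intro CollectI exI[of _ ?H]) auto
    fix z assume "z \<in> {h x |h. convex_on UNIV h \<and> (\<forall>(u, v)\<in>range (\<lambda>k::int. (c * of_int k, p k)). h u \<le> v)}"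
    then obtain h where h: "z = h x" "convex_on UNIV h" "\<And>k. h (c * of_int k) \<le> p k" by auto
    have "\<forall>\<^sub>F R in sequentially. h x \<le> gcm (window_points c p R) x"
      using inwin[of x]
    proof eventually_elim
      case (elim R)
      then show ?case using h convex_on_subset[OF h(2)]
        by (intro gcm_greatest[OF window_points_hull[OF c]]) (auto simp: window_points_def)
    qed
    then show "z \<le> ?H x" unfolding h(1) by (rule tendsto_le[OF _ all tendsto_const, rotated]) simp
  qed
  then show "(\<lambda>R. gcm (window_points c p R) x) \<longlonglongrightarrow> gcm S x" using all[of x] by simp
qed

text \<open>
  If there is no convex minorant at all, then \<^const>\<open>gcm\<close> is the supremum of the empty set and
  hence constant.
\<close>

lemma gcm_left_slope_lattice:
  assumes c: "0 < c" and S: "S = range (\<lambda>k::int. (c * of_int k, p k))"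
  shows "gcm_left_slope S (c * of_int i) =
    (if \<forall>i. Cauchy (grid_minorant c p i)
     then (lim (grid_minorant c p i) - lim (grid_minorant c p (i - 1))) / c else 0)"
proof (cases "\<forall>i. Cauchy (grid_minorant c p i)")
  case True
  then have conv: "\<And>i. convergent (grid_minorant c p i)" by (simp add: real_Cauchy_convergent)
  note lim = gcm_lattice_limit(2)[OF c S conv]
  have gl: "lim (grid_minorant c p i) = gcm S (c * of_int i)" for i
    unfolding grid_minorant_def by (rule limI) (rule LIMSEQ_ignore_initial_segment[OF lim])
  have aff: "gcm S x = chord (gcm S) (c * (of_int i - 1)) (c * of_int i) x"
    if x: "c * (of_int i - 1) \<le> x" "x \<le> c * of_int i" for x
  proof (rule LIMSEQ_unique[OF lim])
    have "(\<lambda>R. chord (gcm (window_points c p R)) (c * (of_int i - 1)) (c * of_int i) x)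
        \<longlonglongrightarrow> chord (gcm S) (c * (of_int i - 1)) (c * of_int i) x"
      unfolding chord_def using c by (intro tendsto_intros lim) auto
    moreover have "\<forall>\<^sub>F R in sequentially. chord (gcm (window_points c p R)) (c * (of_int i - 1)) (c * of_int i) x
        = gcm (window_points c p R) x"
      using eventually_gt_at_top[of "nat \<bar>i\<bar>"]
    proof eventually_elim
      case (elim R)
      then show ?case using gcm_window_points_affine[OF c _ _ x, of R p] by auto
    qed
    ultimately show "(\<lambda>R. gcm (window_points c p R) x)
        \<longlonglongrightarrow> chord (gcm S) (c * (of_int i - 1)) (c * of_int i) x"
      by (rule Lim_transform_eventually)
  qed
  define \<sigma> where "\<sigma> = (gcm S (c * of_int i) - gcm S (c * (of_int i - 1))) / c"
  have "gcm_left_slope S (c * of_int i) = \<sigma>"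
  proof (rule gcm_left_slope_affine)
    show "c * (of_int i - 1) < c * of_int i" using c by simp
    fix y assume "c * (of_int i - 1) \<le> y" "y \<le> c * of_int i"
    from aff[OF this] c
    show "gcm S y = (gcm S (c * (of_int i - 1)) - \<sigma> * (c * (of_int i - 1))) + \<sigma> * y"
      by (simp add: chord_def \<sigma>_def right_diff_distrib diff_divide_distrib[symmetric])
  qed
  then show ?thesis using True gl[of i] gl[of "i - 1"] by (simp add: \<sigma>_def)
next
  case False
  have "gcm S x = Sup {}" for x
  proof -
    \<comment> \<open>A convex minorant of the whole lattice would bound each decreasing sequence
      from below and force it to converge.\<close>
    have "\<not> (convex_on UNIV h \<and> (\<forall>(u, v)\<in>S. h u \<le> v))" for h
    proof
      assume h: "convex_on UNIV h \<and> (\<forall>(u, v)\<in>S. h u \<le> v)"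
      have "Cauchy (grid_minorant c p i)" for i
      proof -
        have "decseq (grid_minorant c p i)" unfolding grid_minorant_def
          by (intro decseq_SucI gcm_window_points_antimono c grid_in_window) auto
        moreover have "h (c * of_int i) \<le> grid_minorant c p i R" for R unfolding grid_minorant_def
          using h convex_on_subset[OF conjunct1[OF h]]
          by (intro gcm_greatest[OF window_points_hull[OF c]] grid_in_window[OF c])
            (auto simp: window_points_def S)
        ultimately show ?thesis
          by (metis decseq_convergent LIMSEQ_imp_Cauchy)
      qed
      with False show False by blast
    qed
    then have "{h x |h. convex_on UNIV h \<and> (\<forall>(u, v)\<in>S. h u \<le> v)} = {}"
      for x by blast
    moreover have "convex hull (fst ` S) = UNIV" unfolding S by (rule lattice_hull[OF c])
    ultimately show ?thesis unfolding gcm_def by (simp only:)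
  qed
  then have "gcm_left_slope S (c * of_int i) = 0"
    by (intro gcm_left_slope_affine[of "c * of_int i - 1" _ _ "Sup {}"]) auto
  then show ?thesis using False by auto
qed

text \<open>Measurability is needed for all paths, including those of a null set on which no
  minorant may exist. The case distinction consists of countably many Cauchy conditions and is
  therefore an event.\<close>

lemma measurable_limit_slope:
  assumes c: "0 < c" and W: "\<And>t. W t \<in> borel_measurable \<Omega>"
  shows "(\<lambda>\<omega>. limit_slope c \<kappa>1 \<kappa>2 (\<lambda>t. W t \<omega>) i) \<in> borel_measurable \<Omega>"
proof -
  define p where "p = (\<lambda>\<omega> k. \<kappa>1 * W (c * of_int k) \<omega> + \<kappa>2 * c\<^sup>2 * of_int k * (1 + of_int k))"
  have p: "p \<in> borel_measurable \<Omega>"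
    unfolding p_def by (intro measurable_coordinatewise_then_product borel_measurable_add
      borel_measurable_times borel_measurable_const W)
  have [measurable]: "(\<lambda>\<omega>. grid_minorant c (p \<omega>) i R) \<in> borel_measurable \<Omega>" for i R
    unfolding grid_minorant_def
    by (rule measurable_compose[OF p borel_measurable_continuous_onI])
      (intro continuous_gcm_window_points c grid_in_window, simp)
  have "(\<lambda>\<omega>. if \<forall>i. Cauchy (grid_minorant c (p \<omega>) i)
     then (lim (grid_minorant c (p \<omega>) i) - lim (grid_minorant c (p \<omega>) (i - 1))) / c else 0)
     \<in> borel_measurable \<Omega>"
    by (intro measurable_If borel_measurable_divide borel_measurable_diff borel_measurable_lim_metric
        borel_measurable_const sets.sets_Collect_countable_All sets_Collect_Cauchy) measurable
  then show ?thesis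
    unfolding limit_slope_def limit_point_def p_def
    by (subst gcm_left_slope_lattice[OF c refl])
qed

section \<open>Measurability of the estimator\<close>

lemma emp_points:
  fixes x u :: "nat \<Rightarrow> real"
  shows "emp_G n x s = real (card {j \<in> {1..n}. x j \<le> s}) / real n"
    and "emp_V n x (\<lambda>j. status (u j) (x j)) s
      = real (card ({j \<in> {1..n}. x j \<le> s} \<inter> {j \<in> {1..n}. u j \<le> x j})) / real n"
proof -
  have "(\<Sum>j\<in>{j \<in> {1..n}. x j \<le> s}. status (u j) (x j))
      = (\<Sum>j\<in>{j \<in> {1..n}. x j \<le> s} \<inter> {j \<in> {1..n}. u j \<le> x j}. 1)"
    by (rule sum.mono_neutral_cong_right) (auto simp: status_def)
  then show "emp_V n x (\<lambda>j. status (u j) (x j)) s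
      = real (card ({j \<in> {1..n}. x j \<le> s} \<inter> {j \<in> {1..n}. u j \<le> x j})) / real n"
    by (simp add: emp_V_def)
qed (simp add: emp_G_def)

text \<open>If some threshold works, then so does the smallest candidate, the maximum of
  \<open>a\<close> and the observations in \<open>J\<close>. This replaces an uncountable union over
  \<open>s\<close> by finitely many inequalities between observations.\<close>

lemma sublevel_set_realizable:
  fixes x :: "nat \<Rightarrow> real"
  assumes "J \<subseteq> {1..n}"
  shows "(\<exists>s\<in>{a..b}. J = {j \<in> {1..n}. x j \<le> s}) \<longleftrightarrow>
    a \<le> b \<and> (\<forall>j\<in>J. x j \<le> b) \<and> (\<forall>i\<in>{1..n} - J. a < x i \<and> (\<forall>j\<in>J. x j < x i))" (is "_ \<longleftrightarrow> ?R")
proof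
  assume R: ?R
  have fJ: "finite J" using assms finite_subset by blast
  let ?s = "Max (insert a (x ` J))"
  have "?s \<in> {a..b}" using R fJ by auto
  moreover have "J = {j \<in> {1..n}. x j \<le> ?s}"
  proof (intro set_eqI iffI)
    fix j assume j: "j \<in> {j \<in> {1..n}. x j \<le> ?s}"
    show "j \<in> J"
    proof (rule ccontr)
      assume "j \<notin> J"
      then have "?s < x j" using R fJ j by (subst Max_less_iff) auto
      then show False using j by simp
    qed
  qed (use fJ assms in auto)
  ultimately show "\<exists>s\<in>{a..b}. J = {j \<in> {1..n}. x j \<le> s}" by blast
qed force

text \<open>
  For observation times off the grid, which occur with probability 0 but need not be absent, the
  estimator is still a function of finitely many events.
\<close>

lemma measurable_npmle:
  fixes X T :: "nat \<Rightarrow> 'a \<Rightarrow> real"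
  assumes [measurable]: "\<And>j. j \<in> {1..n} \<Longrightarrow> X j \<in> borel_measurable M" "\<And>j. j \<in> {1..n} \<Longrightarrow> T j \<in> borel_measurable M"
  shows "(\<lambda>\<omega>. npmle a b n (\<lambda>j. X j \<omega>) (\<lambda>j. status (T j \<omega>) (X j \<omega>)) s) \<in> borel_measurable M"
proof -
  define I where "I = {1..n}"
  have I: "finite I" "\<And>j. j \<in> I \<Longrightarrow> j \<in> {1..n}" by (auto simp: I_def)
  define S where "S \<omega> = {J. \<exists>s\<in>{a..b}. J = {j \<in> I. X j \<omega> \<le> s}}" for \<omega>
  define J where "J \<omega> = {j \<in> I. X j \<omega> \<le> s}" for \<omega>
  define Y where "Y \<omega> = {j \<in> I. T j \<omega> \<le> X j \<omega>}" for \<omega>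
  \<comment> \<open>The cusum diagram depends on the data only through the index sets cut out by
    thresholds and the set of successes. As \<Phi> lives on a finite discrete space, nothing about
    \<open>gcm\<close> as a function of the points has to be measurable.\<close>
  define \<Phi> where "\<Phi> d = (case d of (S, J, Y) \<Rightarrow> if real (card J) / real n = 0 then 0
      else gcm_left_slope ((\<lambda>J. (real (card J) / real n, real (card (J \<inter> Y)) / real n)) ` S) (real (card J) / real n))"
    for d :: "nat set set \<times> nat set \<times> nat set"
  have eq: "npmle a b n (\<lambda>j. X j \<omega>) (\<lambda>j. status (T j \<omega>) (X j \<omega>)) s = \<Phi> (S \<omega>, J \<omega>, Y \<omega>)" for \<omega>
  proof -
    have "(\<lambda>t. (emp_G n (\<lambda>j. X j \<omega>) t, emp_V n (\<lambda>j. X j \<omega>) (\<lambda>j. status (T j \<omega>) (X j \<omega>)) t)) ` {a..b}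
        = (\<lambda>J. (real (card J) / real n, real (card (J \<inter> Y \<omega>)) / real n)) ` S \<omega>"
      unfolding emp_points S_def Y_def I_def by auto
    then show ?thesis unfolding npmle_def \<Phi>_def by (simp only: prod.case emp_points(1) J_def I_def)
  qed
  have setcol: "{\<omega> \<in> space M. {j \<in> I. P j \<omega>} = C} \<in> sets M"
    if "\<And>j. j \<in> I \<Longrightarrow> {\<omega> \<in> space M. P j \<omega>} \<in> sets M" "C \<subseteq> I" for P C
  proof -
    have "{\<omega> \<in> space M. {j \<in> I. P j \<omega>} = C} = {\<omega> \<in> space M. \<forall>j\<in>I. P j \<omega> \<longleftrightarrow> j \<in> C}" using that(2) by auto
    also have "\<dots> \<in> sets M" using that I by (intro sets.sets_Collect_finite_All) auto
    finally show ?thesis .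
  qed
  have X_le: "{\<omega> \<in> space M. X j \<omega> \<le> r} \<in> sets M" "{\<omega> \<in> space M. r < X j \<omega>} \<in> sets M" if "j \<in> I" for j r
    using I(2)[OF that] by measurable
  have XX: "{\<omega> \<in> space M. X j \<omega> < X i \<omega>} \<in> sets M" "{\<omega> \<in> space M. T j \<omega> \<le> X j \<omega>} \<in> sets M" if "j \<in> I" "i \<in> I" for i j
    using I(2)[OF that(1)] I(2)[OF that(2)] by measurable
  have S_ev: "{\<omega> \<in> space M. S \<omega> = A} \<in> sets M" if A: "A \<subseteq> Pow I" for A
  proof -
    have "{\<omega> \<in> space M. J \<in> S \<omega>} \<in> sets M" if J: "J \<in> Pow I" for J
    proof -
      have fJ: "finite J" using J I finite_subset by blast
      have "{\<omega> \<in> space M. J \<in> S \<omega>} = {\<omega> \<in> space M. a \<le> b \<and> (\<forall>j\<in>J. X j \<omega> \<le> b) \<and> (\<forall>i\<in>I - J. a < X i \<omega> \<and> (\<forall>j\<in>J. X j \<omega> < X i \<omega>))}"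
        unfolding S_def I_def using sublevel_set_realizable[of J n a b] J by (simp add: I_def)
      also have "\<dots> \<in> sets M"
        using J I fJ X_le XX by (intro sets.sets_Collect_conj sets.sets_Collect_finite_All sets.sets_Collect_const) auto
      finally show ?thesis .
    qed
    then have "{\<omega> \<in> space M. \<forall>J\<in>Pow I. J \<in> S \<omega> \<longleftrightarrow> J \<in> A} \<in> sets M"
      using I by (intro sets.sets_Collect_finite_All) auto
    also have "{\<omega> \<in> space M. \<forall>J\<in>Pow I. J \<in> S \<omega> \<longleftrightarrow> J \<in> A} = {\<omega> \<in> space M. S \<omega> = A}"
      using A by (fastforce simp: S_def)
    finally show ?thesis .
  qed
  have "(\<lambda>\<omega>. (S \<omega>, J \<omega>, Y \<omega>)) \<in> M \<rightarrow>\<^sub>M count_space (Pow (Pow I) \<times> Pow I \<times> Pow I)"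
  proof (rule measurable_count_space_eq2[THEN iffD2], goal_cases)
    case 1 show ?case using I by simp
  next
    case 2 show ?case
    proof (intro conjI ballI)
    show "(\<lambda>\<omega>. (S \<omega>, J \<omega>, Y \<omega>)) \<in> space M \<rightarrow> Pow (Pow I) \<times> Pow I \<times> Pow I"
      by (auto simp: S_def J_def Y_def)
    fix d assume "d \<in> Pow (Pow I) \<times> Pow I \<times> Pow I"
    then obtain A B C where d: "d = (A, B, C)" "A \<subseteq> Pow I" "B \<subseteq> I" "C \<subseteq> I" by auto
    have "(\<lambda>\<omega>. (S \<omega>, J \<omega>, Y \<omega>)) -` {d} \<inter> space M
        = {\<omega> \<in> space M. S \<omega> = A} \<inter> ({\<omega> \<in> space M. J \<omega> = B} \<inter> {\<omega> \<in> space M. Y \<omega> = C})" by (auto simp: d(1))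
    also have "\<dots> \<in> sets M"
      unfolding J_def Y_def using d X_le XX by (intro sets.Int S_ev setcol) auto
    finally show "(\<lambda>\<omega>. (S \<omega>, J \<omega>, Y \<omega>)) -` {d} \<inter> space M \<in> sets M" .
    qed
  qed
  then have "(\<lambda>\<omega>. \<Phi> (S \<omega>, J \<omega>, Y \<omega>)) \<in> borel_measurable M"
    by (rule measurable_compose) simp
  then show ?thesis unfolding eq .
qed

section \<open>Tail bounds for cell sums\<close>

text \<open>Independence of the two vectors and independence within each factorise the probabilities
  of all products of rectangles, and rectangles are an intersection-stable generator of the product
  sigma-algebra.\<close>

lemma (in prob_space) indep_vars_pair:
  fixes X Y :: "'i \<Rightarrow> 'a \<Rightarrow> 'b::second_countable_topology"
  assumes I: "finite I" "I \<noteq> {}"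
    and X: "indep_vars (\<lambda>_. borel) X I" and Y: "indep_vars (\<lambda>_. borel) Y I"
    and XY: "indep_var (\<Pi>\<^sub>M i\<in>I. borel) (\<lambda>\<omega>. \<lambda>i\<in>I. X i \<omega>) (\<Pi>\<^sub>M i\<in>I. borel) (\<lambda>\<omega>. \<lambda>i\<in>I. Y i \<omega>)"
  shows "indep_vars (\<lambda>_. borel \<Otimes>\<^sub>M borel) (\<lambda>i \<omega>. (X i \<omega>, Y i \<omega>)) I"
    and "\<And>i A B. i \<in> I \<Longrightarrow> A \<in> sets borel \<Longrightarrow> B \<in> sets borel \<Longrightarrow>
      prob {\<omega> \<in> space M. X i \<omega> \<in> A \<and> Y i \<omega> \<in> B}
        = prob {\<omega> \<in> space M. X i \<omega> \<in> A} * prob {\<omega> \<in> space M. Y i \<omega> \<in> B}"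
proof -
  have rv: "random_variable borel (X i)" "random_variable borel (Y i)" if "i \<in> I" for i
    using X Y that by (auto simp: indep_vars_def2)
  have joint: "prob {\<omega> \<in> space M. \<forall>i\<in>I. X i \<omega> \<in> A i \<and> Y i \<omega> \<in> B i}
      = (\<Prod>i\<in>I. prob {\<omega> \<in> space M. X i \<omega> \<in> A i}) * (\<Prod>i\<in>I. prob {\<omega> \<in> space M. Y i \<omega> \<in> B i})"
    if A: "\<And>i. i \<in> I \<Longrightarrow> A i \<in> sets borel" and B: "\<And>i. i \<in> I \<Longrightarrow> B i \<in> sets borel" for A B
  proof -
    have "prob ((\<lambda>\<omega>. (\<lambda>i\<in>I. X i \<omega>, \<lambda>i\<in>I. Y i \<omega>)) -` (PiE I A \<times> PiE I B) \<inter> space M)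
        = prob ((\<lambda>\<omega>. \<lambda>i\<in>I. X i \<omega>) -` PiE I A \<inter> space M) * prob ((\<lambda>\<omega>. \<lambda>i\<in>I. Y i \<omega>) -` PiE I B \<inter> space M)"
      using I A B by (intro indep_varD[OF XY] sets_PiM_I_finite) auto
    moreover have "(\<lambda>\<omega>. (\<lambda>i\<in>I. X i \<omega>, \<lambda>i\<in>I. Y i \<omega>)) -` (PiE I A \<times> PiE I B) \<inter> space M
        = {\<omega> \<in> space M. \<forall>i\<in>I. X i \<omega> \<in> A i \<and> Y i \<omega> \<in> B i}" by (auto simp: PiE_iff)
    moreover have "(\<lambda>\<omega>. \<lambda>i\<in>I. X i \<omega>) -` PiE I A \<inter> space M = (\<Inter>i\<in>I. X i -` A i \<inter> space M)"
      "(\<lambda>\<omega>. \<lambda>i\<in>I. Y i \<omega>) -` PiE I B \<inter> space M = (\<Inter>i\<in>I. Y i -` B i \<inter> space M)"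
      using I by (auto simp: PiE_iff)
    moreover have "prob (\<Inter>i\<in>I. X i -` A i \<inter> space M) = (\<Prod>i\<in>I. prob (X i -` A i \<inter> space M))"
      using I A by (intro indep_varsD[OF X]) auto
    moreover have "prob (\<Inter>i\<in>I. Y i -` B i \<inter> space M) = (\<Prod>i\<in>I. prob (Y i -` B i \<inter> space M))"
      using I B by (intro indep_varsD[OF Y]) auto
    moreover have "X i -` A i \<inter> space M = {\<omega> \<in> space M. X i \<omega> \<in> A i}"
      "Y i -` B i \<inter> space M = {\<omega> \<in> space M. Y i \<omega> \<in> B i}" for i by auto
    ultimately show ?thesis by (simp only:)
  qed
  have single: "prob {\<omega> \<in> space M. X i \<omega> \<in> A \<and> Y i \<omega> \<in> B}
      = prob {\<omega> \<in> space M. X i \<omega> \<in> A} * prob {\<omega> \<in> space M. Y i \<omega> \<in> B}"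
    if i: "i \<in> I" and A: "A \<in> sets borel" and B: "B \<in> sets borel" for i A B
  proof -
    \<comment> \<open>Whole spaces in all other coordinates isolate the single index
      \<open>i\<close>.\<close>
    let ?A = "\<lambda>j. if j = i then A else UNIV" and ?B = "\<lambda>j. if j = i then B else UNIV"
    have "(\<Prod>j\<in>I. prob {\<omega> \<in> space M. X j \<omega> \<in> ?A j}) = (\<Prod>j\<in>I. if j = i then prob {\<omega> \<in> space M. X i \<omega> \<in> A} else 1)"
      "(\<Prod>j\<in>I. prob {\<omega> \<in> space M. Y j \<omega> \<in> ?B j}) = (\<Prod>j\<in>I. if j = i then prob {\<omega> \<in> space M. Y i \<omega> \<in> B} else 1)"
      by (auto intro!: prod.cong simp: prob_space)
    moreover have "{\<omega> \<in> space M. \<forall>j\<in>I. X j \<omega> \<in> ?A j \<and> Y j \<omega> \<in> ?B j} = {\<omega> \<in> space M. X i \<omega> \<in> A \<and> Y i \<omega> \<in> B}"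
      using i by auto
    ultimately show ?thesis using joint[of ?A ?B] A B I i by simp
  qed
  then show "\<And>i A B. i \<in> I \<Longrightarrow> A \<in> sets borel \<Longrightarrow> B \<in> sets borel \<Longrightarrow>
      prob {\<omega> \<in> space M. X i \<omega> \<in> A \<and> Y i \<omega> \<in> B}
        = prob {\<omega> \<in> space M. X i \<omega> \<in> A} * prob {\<omega> \<in> space M. Y i \<omega> \<in> B}" .
  let ?E = "{a \<times> b | a b. a \<in> sets (borel :: 'b measure) \<and> b \<in> sets (borel :: 'b measure)}"
  let ?B = "borel \<Otimes>\<^sub>M borel :: ('b \<times> 'b) measure"
  have E: "sets ?B = sigma_sets (space ?B) ?E" "Int_stable ?E" "space ?B \<in> ?E" "?E \<subseteq> Pow (space ?B)"
  proof -
    show "sets ?B = sigma_sets (space ?B) ?E" by (simp add: sets_pair_measure space_pair_measure)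
    show "Int_stable ?E" by (rule Int_stable_pair_measure_generator)
    show "space ?B \<in> ?E" by (intro CollectI exI[of _ UNIV]) (simp add: space_pair_measure)
    show "?E \<subseteq> Pow (space ?B)" by (simp add: space_pair_measure)
  qed
  have "\<forall>A\<in>(\<Pi> i\<in>I. ?E). prob (\<Inter>j\<in>I. (\<lambda>\<omega>. (X j \<omega>, Y j \<omega>)) -` A j \<inter> space M)
        = (\<Prod>j\<in>I. prob ((\<lambda>\<omega>. (X j \<omega>, Y j \<omega>)) -` A j \<inter> space M))"
    proof
      fix A assume "A \<in> (\<Pi> i\<in>I. ?E)"
      then have A: "A i \<in> ?E" if "i \<in> I" for i using that by (rule Pi_mem)
      have "\<forall>i\<in>I. \<exists>ab. A i = fst ab \<times> snd ab \<and> fst ab \<in> sets borel \<and> snd ab \<in> sets borel"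
      proof
        fix i assume "i \<in> I"
        from A[OF this] obtain a b where "A i = a \<times> b" "a \<in> sets borel" "b \<in> sets borel" by blast
        then show "\<exists>ab. A i = fst ab \<times> snd ab \<and> fst ab \<in> sets borel \<and> snd ab \<in> sets borel"
          by (intro exI[of _ "(a, b)"]) simp
      qed
      from bchoice[OF this] obtain ab where "\<forall>i\<in>I. A i = fst (ab i) \<times> snd (ab i) \<and> fst (ab i) \<in> sets borel \<and> snd (ab i) \<in> sets borel" ..
      then have ab: "\<And>i. i \<in> I \<Longrightarrow> A i = fst (ab i) \<times> snd (ab i)"
        "\<And>i. i \<in> I \<Longrightarrow> fst (ab i) \<in> sets borel" "\<And>i. i \<in> I \<Longrightarrow> snd (ab i) \<in> sets borel" by auto
      have 1: "(\<Inter>j\<in>I. (\<lambda>\<omega>. (X j \<omega>, Y j \<omega>)) -` A j \<inter> space M)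
          = {\<omega> \<in> space M. \<forall>i\<in>I. X i \<omega> \<in> fst (ab i) \<and> Y i \<omega> \<in> snd (ab i)}"
        using ab(1) I by (auto simp: mem_Times_iff)
      have 2: "(\<lambda>\<omega>. (X j \<omega>, Y j \<omega>)) -` A j \<inter> space M = {\<omega> \<in> space M. X j \<omega> \<in> fst (ab j) \<and> Y j \<omega> \<in> snd (ab j)}"
        if "j \<in> I" for j using ab(1)[OF that] by (auto simp: mem_Times_iff)
      show "prob (\<Inter>j\<in>I. (\<lambda>\<omega>. (X j \<omega>, Y j \<omega>)) -` A j \<inter> space M)
          = (\<Prod>j\<in>I. prob ((\<lambda>\<omega>. (X j \<omega>, Y j \<omega>)) -` A j \<inter> space M))"
      proof -
        have "prob {\<omega> \<in> space M. \<forall>i\<in>I. X i \<omega> \<in> fst (ab i) \<and> Y i \<omega> \<in> snd (ab i)}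
            = (\<Prod>i\<in>I. prob {\<omega> \<in> space M. X i \<omega> \<in> fst (ab i)}) * (\<Prod>i\<in>I. prob {\<omega> \<in> space M. Y i \<omega> \<in> snd (ab i)})"
          by (rule joint[OF ab(2,3)])
        also have "\<dots> = (\<Prod>i\<in>I. prob {\<omega> \<in> space M. X i \<omega> \<in> fst (ab i)} * prob {\<omega> \<in> space M. Y i \<omega> \<in> snd (ab i)})"
          by (rule prod.distrib[symmetric])
        also have "\<dots> = (\<Prod>j\<in>I. prob ((\<lambda>\<omega>. (X j \<omega>, Y j \<omega>)) -` A j \<inter> space M))"
          by (intro prod.cong refl) (simp only: 2 single ab(2,3))
        finally show ?thesis unfolding 1 .
      qed
    qed
  note product = this
  have m: "random_variable ?B (\<lambda>\<omega>. (X i \<omega>, Y i \<omega>))" if "i \<in> I" for i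
    using rv[OF that] by (rule measurable_Pair)
  show "indep_vars (\<lambda>_. ?B) (\<lambda>i \<omega>. (X i \<omega>, Y i \<omega>)) I"
    by (rule indep_vars_finite[where M' = "\<lambda>_. ?B" and X = "\<lambda>i \<omega>. (X i \<omega>, Y i \<omega>)" and E = "\<lambda>_. ?E",
          OF I(2,1) E(1) m E(2-4), THEN iffD2, OF _ product])
qed

text \<open>A negative sum deviates from its positive mean by at least that mean, so Chebyshev
  applies; second moments stand in for variances.\<close>

lemma (in prob_space) indep_sum_neg_prob:
  fixes \<zeta> :: "'i \<Rightarrow> 'a \<Rightarrow> real" and \<mu> v C :: real
  assumes I: "finite I" "I \<noteq> {}" and indep: "indep_vars (\<lambda>_. borel) \<zeta> I"
    and C: "\<And>i \<omega>. i \<in> I \<Longrightarrow> \<bar>\<zeta> i \<omega>\<bar> \<le> C"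
    and mean: "\<And>i. i \<in> I \<Longrightarrow> expectation (\<zeta> i) = \<mu>"
    and second: "\<And>i. i \<in> I \<Longrightarrow> expectation (\<lambda>\<omega>. (\<zeta> i \<omega>)\<^sup>2) \<le> v"
    and \<mu>: "0 < \<mu>"
  shows "prob {\<omega> \<in> space M. (\<Sum>i\<in>I. \<zeta> i \<omega>) < 0} \<le> v / (card I * \<mu>\<^sup>2)"
proof -
  have m[measurable]: "random_variable borel (\<zeta> i)" if "i \<in> I" for i
    using indep that by (auto simp: indep_vars_def2)
  have C0: "0 \<le> C" using C I by (metis abs_ge_zero ex_in_conv order_trans)
  have int: "integrable M (\<zeta> i)" if "i \<in> I" for i
    using C[OF that] m[OF that] by (intro integrable_const_bound[of _ C]) auto
  have int2: "integrable M (\<lambda>\<omega>. \<zeta> i \<omega> * \<zeta> j \<omega>)" if "i \<in> I" "j \<in> I" for i j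
    using C that m C0 by (intro integrable_const_bound[of _ "C * C"]) (auto simp: abs_mult intro!: mult_mono AE_I2)
  have cov: "expectation (\<lambda>\<omega>. \<zeta> i \<omega> * \<zeta> j \<omega>) \<le> \<mu>\<^sup>2 + (if i = j then v else 0)" if ij: "i \<in> I" "j \<in> I" for i j
  proof (cases "i = j")
    case True
    have "expectation (\<lambda>\<omega>. \<zeta> i \<omega> * \<zeta> i \<omega>) \<le> v" using second[OF ij(1)] by (simp add: power2_eq_square)
    then show ?thesis using True by (simp add: add_increasing)
  next
    case False
    have "expectation (\<lambda>\<omega>. \<Prod>k\<in>{i, j}. \<zeta> k \<omega>) = (\<Prod>k\<in>{i, j}. expectation (\<zeta> k))"
      using ij int by (intro indep_vars_lebesgue_integral indep_vars_subset[OF indep]) auto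
    then show ?thesis using False mean ij by (simp add: power2_eq_square)
  qed
  let ?S = "\<lambda>\<omega>. \<Sum>i\<in>I. \<zeta> i \<omega>"
  have S[measurable]: "random_variable borel ?S" by measurable
  have sq: "(?S \<omega>)\<^sup>2 = (\<Sum>i\<in>I. \<Sum>j\<in>I. \<zeta> i \<omega> * \<zeta> j \<omega>)" for \<omega>
    by (simp add: power2_eq_square sum_product)
  have iS: "integrable M ?S" "integrable M (\<lambda>\<omega>. (?S \<omega>)\<^sup>2)"
    unfolding sq using int int2 by auto
  have ES: "expectation ?S = card I * \<mu>" using int mean by simp
  have "expectation (\<lambda>\<omega>. (?S \<omega>)\<^sup>2) = (\<Sum>i\<in>I. \<Sum>j\<in>I. expectation (\<lambda>\<omega>. \<zeta> i \<omega> * \<zeta> j \<omega>))"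
    unfolding sq using int2 by simp
  also have "\<dots> \<le> (\<Sum>i\<in>I. \<Sum>j\<in>I. \<mu>\<^sup>2 + (if i = j then v else 0))"
    using cov by (intro sum_mono)
  also have "\<dots> = (card I)\<^sup>2 * \<mu>\<^sup>2 + card I * v"
    using I by (simp add: sum.distrib sum.delta power2_eq_square algebra_simps)
  finally have second_S: "expectation (\<lambda>\<omega>. (?S \<omega>)\<^sup>2) \<le> (card I)\<^sup>2 * \<mu>\<^sup>2 + card I * v" .
  have var: "expectation (\<lambda>\<omega>. (?S \<omega> - expectation ?S)\<^sup>2) \<le> card I * v"
    using variance_eq[OF iS] second_S unfolding ES by (simp add: power_mult_distrib)
  have pos: "0 < card I * \<mu>" using I \<mu> by (simp add: card_gt_0_iff)
  have "prob {\<omega> \<in> space M. ?S \<omega> < 0} \<le> prob {\<omega> \<in> space M. card I * \<mu> \<le> \<bar>?S \<omega> - expectation ?S\<bar>}"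
    unfolding ES by (intro finite_measure_mono) auto
  also have "\<dots> \<le> expectation (\<lambda>\<omega>. (?S \<omega> - expectation ?S)\<^sup>2) / (card I * \<mu>)\<^sup>2"
    by (intro Chebyshev_inequality S iS pos)
  also have "\<dots> \<le> (card I * v) / (card I * \<mu>)\<^sup>2" using var by (rule divide_right_mono) simp
  also have "\<dots> = v / (card I * \<mu>\<^sup>2)" using I by (simp add: power2_eq_square)
  finally show ?thesis .
qed

section \<open>The current status model for one fixed grid\<close>

locale grid_sample = prob_space M for M :: "'a measure" +
  fixes n :: nat and F G :: "real \<Rightarrow> real" and a b \<delta> :: real and T X :: "nat \<Rightarrow> 'a \<Rightarrow> real"
  assumes sample: "current_status_sample M n F (design_distribution G a b \<delta>) T X"
    and n: "0 < n" and \<delta>: "0 < \<delta>" and ab: "a < b"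
    and F_range: "\<And>x. 0 \<le> F x" "\<And>x. F x \<le> 1"
    and G_mono: "mono G" and G_range: "\<And>x. 0 \<le> G x" "\<And>x. G x \<le> 1"
begin

abbreviation t :: "nat \<Rightarrow> real" where "t \<equiv> grid_point a \<delta>"
abbreviation K :: nat where "K \<equiv> grid_size a b \<delta>"
abbreviation p :: "nat \<Rightarrow> real" where "p \<equiv> design_weight G a b \<delta>"
abbreviation Y :: "nat \<Rightarrow> 'a \<Rightarrow> bool" where "Y j \<omega> \<equiv> T j \<omega> \<le> X j \<omega>"

lemma sample_indep:
  "indep_vars (\<lambda>_. borel) T {1..n}" "indep_vars (\<lambda>_. borel) X {1..n}"
  "indep_var (\<Pi>\<^sub>M j\<in>{1..n}. borel) (\<lambda>\<omega>. \<lambda>j\<in>{1..n}. T j \<omega>) (\<Pi>\<^sub>M j\<in>{1..n}. borel) (\<lambda>\<omega>. \<lambda>j\<in>{1..n}. X j \<omega>)"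
  "\<And>j. j \<in> {1..n} \<Longrightarrow> cdf (distr M borel (T j)) = F"
  "\<And>j. j \<in> {1..n} \<Longrightarrow> distr M borel (X j) = design_distribution G a b \<delta>"
  using sample by (auto simp: current_status_sample_def)

lemma measurable_sample:
  "j \<in> {1..n} \<Longrightarrow> T j \<in> borel_measurable M" "j \<in> {1..n} \<Longrightarrow> X j \<in> borel_measurable M"
  using sample_indep(1,2) by (auto simp: indep_vars_def2)

lemma p_nonneg: "0 \<le> p i"
  using G_range[of "t 1"] G_range[of "t (i - 1)"] monoD[OF G_mono, of "t (i - 1)" "t i"] \<delta>
  by (auto simp: design_weight_def grid_point_def)

lemma inj_t: "inj t" using \<delta> by (auto simp: inj_def grid_point_def)

lemma emeasure_design:
  assumes "A \<in> sets borel"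
  shows "emeasure (design_distribution G a b \<delta>) A = (\<Sum>i | i \<in> {1..K} \<and> t i \<in> A. ennreal (p i))"
proof -
  have "t -` A \<inter> {1..K} = {i. i \<in> {1..K} \<and> t i \<in> A}" by auto
  then show ?thesis
    using assms unfolding design_distribution_def
    by (subst emeasure_distr) (auto simp: space_point_measure simp del: One_nat_def
        intro!: emeasure_point_measure_finite)
qed

lemma prob_X:
  assumes j: "j \<in> {1..n}" and i: "i \<in> {1..K}"
  shows "prob {\<omega> \<in> space M. X j \<omega> = t i} = p i"
proof -
  have "{k. k \<in> {1..K} \<and> t k \<in> {t i}} = {i}" using i by (auto simp: inj_eq[OF inj_t])
  then have "emeasure (distr M borel (X j)) {t i} = ennreal (p i)"
    unfolding sample_indep(5)[OF j] by (subst emeasure_design) simp_all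
  moreover have "emeasure (distr M borel (X j)) {t i} = emeasure M {\<omega> \<in> space M. X j \<omega> = t i}"
    by (subst emeasure_distr[OF measurable_sample(2)[OF j]]) (auto intro!: arg_cong[where f = "emeasure M"])
  ultimately show ?thesis using p_nonneg by (simp add: measure_def)
qed

lemma AE_X_grid:
  assumes j: "j \<in> {1..n}" shows "AE \<omega> in M. X j \<omega> \<in> t ` {1..K}"
proof -
  note [measurable] = measurable_sample[OF j]
  have c: "- t ` {1..K} \<in> sets borel" by (intro borel_comp borel_closed finite_imp_closed) simp
  have "emeasure (distr M borel (X j)) (- t ` {1..K}) = 0"
    unfolding sample_indep(5)[OF j] using c by (subst emeasure_design) (auto intro!: sum.neutral)
  then have "emeasure M (X j -` (- t ` {1..K}) \<inter> space M) = 0"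
    using c by (simp only: emeasure_distr[OF measurable_sample(2)[OF j]])
  moreover have "X j -` (- t ` {1..K}) \<inter> space M \<in> sets M"
    by (rule measurable_sets[OF measurable_sample(2)[OF j] c])
  ultimately show ?thesis
    by (intro AE_I[of _ _ "X j -` (- t ` {1..K}) \<inter> space M"]) auto
qed

lemma indep_vars_sample: "indep_vars (\<lambda>_. borel \<Otimes>\<^sub>M borel) (\<lambda>j \<omega>. (T j \<omega>, X j \<omega>)) {1..n}"
  using n by (intro indep_vars_pair sample_indep) auto

lemma prob_XY:
  assumes j: "j \<in> {1..n}" and i: "i \<in> {1..K}"
  shows "prob {\<omega> \<in> space M. X j \<omega> = t i \<and> T j \<omega> \<le> t i} = p i * F (t i)"
    and "prob {\<omega> \<in> space M. X j \<omega> = t i \<and> \<not> T j \<omega> \<le> t i} = p i * (1 - F (t i))"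
proof -
  note [measurable] = measurable_sample[OF j]
  have T: "prob {\<omega> \<in> space M. T j \<omega> \<in> {..t i}} = F (t i)"
  proof -
    have "T j -` {..t i} \<inter> space M = {\<omega> \<in> space M. T j \<omega> \<in> {..t i}}" by auto
    moreover have "cdf (distr M borel (T j)) (t i) = F (t i)" using sample_indep(4)[OF j] by simp
    ultimately show ?thesis by (simp add: cdf_def measure_distr)
  qed
  have *: "prob {\<omega> \<in> space M. T j \<omega> \<in> A \<and> X j \<omega> \<in> {t i}} = prob {\<omega> \<in> space M. T j \<omega> \<in> A} * p i"
    if "A \<in> sets borel" for A
  proof -
    have "prob {\<omega> \<in> space M. T j \<omega> \<in> A \<and> X j \<omega> \<in> {t i}}
        = prob {\<omega> \<in> space M. T j \<omega> \<in> A} * prob {\<omega> \<in> space M. X j \<omega> \<in> {t i}}"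
      by (rule indep_vars_pair(2)[OF _ _ sample_indep(1-3)]) (use n j that in auto)
    then show ?thesis using prob_X[OF j i] by simp
  qed
  have e: "{\<omega> \<in> space M. X j \<omega> = t i \<and> T j \<omega> \<le> t i} = {\<omega> \<in> space M. T j \<omega> \<in> {..t i} \<and> X j \<omega> \<in> {t i}}"
    "{\<omega> \<in> space M. X j \<omega> = t i \<and> \<not> T j \<omega> \<le> t i} = {\<omega> \<in> space M. T j \<omega> \<in> {t i<..} \<and> X j \<omega> \<in> {t i}}" by auto
  show "prob {\<omega> \<in> space M. X j \<omega> = t i \<and> T j \<omega> \<le> t i} = p i * F (t i)"
    unfolding e using T by (subst *) auto
  have "prob {\<omega> \<in> space M. T j \<omega> \<in> {t i<..}} = 1 - prob {\<omega> \<in> space M. T j \<omega> \<in> {..t i}}"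
    by (subst prob_compl[symmetric]) (auto intro!: arg_cong[where f = prob])
  then show "prob {\<omega> \<in> space M. X j \<omega> = t i \<and> \<not> T j \<omega> \<le> t i} = p i * (1 - F (t i))"
    unfolding e using T by (subst *) auto
qed

text \<open>The pair takes finitely many values up to a null set. Vector values are allowed because
  the formula serves real moments in the tail bounds and complex exponentials in the characteristic
  functions.\<close>

lemma expectation_XY:
  fixes u :: "real \<Rightarrow> bool \<Rightarrow> 'c::{banach, second_countable_topology}"
  assumes j: "j \<in> {1..n}" and meas: "(\<lambda>\<omega>. u (X j \<omega>) (Y j \<omega>)) \<in> borel_measurable M"
  shows "expectation (\<lambda>\<omega>. u (X j \<omega>) (Y j \<omega>))
    = (\<Sum>i=1..K. p i *\<^sub>R (F (t i) *\<^sub>R u (t i) True + (1 - F (t i)) *\<^sub>R u (t i) False))"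
proof -
  note [measurable] = measurable_sample[OF j]
  let ?A = "\<lambda>i. {\<omega> \<in> space M. X j \<omega> = t i \<and> T j \<omega> \<le> t i}"
    and ?B = "\<lambda>i. {\<omega> \<in> space M. X j \<omega> = t i \<and> \<not> T j \<omega> \<le> t i}"
  let ?S = "\<lambda>\<omega>. \<Sum>i=1..K. indicat_real (?A i) \<omega> *\<^sub>R u (t i) True + indicat_real (?B i) \<omega> *\<^sub>R u (t i) False"
  have *: "u (X j \<omega>) (Y j \<omega>) = ?S \<omega>" if that: "\<omega> \<in> space M" "X j \<omega> \<in> t ` {1..K}" for \<omega>
  proof -
    from that(2) obtain k where k: "k \<in> {1..K}" "X j \<omega> = t k" by auto
    have "?S \<omega> = (\<Sum>i=1..K. if i = k then indicat_real (?A k) \<omega> *\<^sub>R u (t k) True + indicat_real (?B k) \<omega> *\<^sub>R u (t k) False else 0)"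
      by (intro sum.cong refl) (simp add: k(2) inj_eq[OF inj_t] indicator_def)
    also have "\<dots> = indicat_real (?A k) \<omega> *\<^sub>R u (t k) True + indicat_real (?B k) \<omega> *\<^sub>R u (t k) False"
      using k by simp
    also have "\<dots> = u (X j \<omega>) (Y j \<omega>)" using k that(1) by (cases "T j \<omega> \<le> t k") (simp_all add: indicator_def)
    finally show ?thesis by (rule sym)
  qed
  have ae: "AE \<omega> in M. u (X j \<omega>) (Y j \<omega>) = ?S \<omega>"
    using AE_space AE_X_grid[OF j] by eventually_elim (rule *)
  have "?S \<in> borel_measurable M" by measurable
  then have "expectation (\<lambda>\<omega>. u (X j \<omega>) (Y j \<omega>)) = expectation ?S"
    by (rule integral_cong_AE[OF meas _ ae])
  also have "\<dots> = (\<Sum>i=1..K. expectation (\<lambda>\<omega>. indicat_real (?A i) \<omega> *\<^sub>R u (t i) True + indicat_real (?B i) \<omega> *\<^sub>R u (t i) False))"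
    by (intro Bochner_Integration.integral_sum Bochner_Integration.integrable_add integrable_scaleR_left integrable_real_indicator)
      (auto simp: less_top[symmetric])
  also have "\<dots> = (\<Sum>i=1..K. prob (?A i) *\<^sub>R u (t i) True + prob (?B i) *\<^sub>R u (t i) False)"
  proof (intro sum.cong refl)
    fix i
    have "integrable M (indicat_real (?A i))" "integrable M (indicat_real (?B i))"
      by (auto intro!: integrable_real_indicator simp: less_top[symmetric])
    then show "expectation (\<lambda>\<omega>. indicat_real (?A i) \<omega> *\<^sub>R u (t i) True + indicat_real (?B i) \<omega> *\<^sub>R u (t i) False)
        = prob (?A i) *\<^sub>R u (t i) True + prob (?B i) *\<^sub>R u (t i) False"
      by (subst Bochner_Integration.integral_add) (simp_all add: integrable_scaleR_left)
  qed
  also have "\<dots> = (\<Sum>i=1..K. p i *\<^sub>R (F (t i) *\<^sub>R u (t i) True + (1 - F (t i)) *\<^sub>R u (t i) False))"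
    by (intro sum.cong refl) (simp only: prob_XY[OF j] scaleR_add_right scaleR_scaleR)
  finally show ?thesis .
qed

end

text \<open>Comparison with a telescoping series; the induction needs the sharper bound 2 -
  1/N.\<close>

lemma sum_inverse_squares_le: "(\<Sum>m=1..N. 1 / (real m)\<^sup>2) \<le> 2"
proof (cases N)
  case (Suc N')
  have "(\<Sum>m=1..Suc N'. 1 / (real m)\<^sup>2) \<le> 2 - 1 / (real N' + 1)"
  proof (induction N')
    case (Suc k)
    have "1 / (real k + 2)\<^sup>2 \<le> 1 / ((real k + 1) * (real k + 2))"
      by (intro divide_left_mono) (auto simp: power2_eq_square)
    also have "\<dots> = 1 / (real k + 1) - 1 / (real k + 2)" by (simp add: field_simps)
    finally show ?case using Suc by (simp add: add.commute)
  qed simp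
  also have "\<dots> \<le> 2" by simp
  finally show ?thesis using Suc by simp
qed simp

context grid_sample
begin

text \<open>The sign \<open>s\<close> treats both sides of a base point alike: for cells to its
  right with \<open>s = 1\<close>, or to its left with \<open>s = -1\<close>, this is
  \<open>n\<close> times the height of the cusum point at the far end above the line of slope
  \<theta> through the base point.\<close>

definition deviation :: "real \<Rightarrow> real \<Rightarrow> nat set \<Rightarrow> 'a \<Rightarrow> real" where
  "deviation s \<theta> J \<omega> = (\<Sum>j=1..n. if X j \<omega> \<in> t ` J then s * ((if Y j \<omega> then 1 else 0) - \<theta>) else 0)"

lemma deviation_neg_prob:
  assumes J: "J \<subseteq> {1..K}" and s: "s = 1 \<or> s = -1" and \<theta>: "\<bar>\<theta>\<bar> \<le> 1"
    and \<mu>: "0 < (\<Sum>i\<in>J. p i * (s * (F (t i) - \<theta>)))"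
  shows "prob {\<omega> \<in> space M. deviation s \<theta> J \<omega> < 0}
    \<le> 4 * (\<Sum>i\<in>J. p i) / (n * (\<Sum>i\<in>J. p i * (s * (F (t i) - \<theta>)))\<^sup>2)"
proof -
  have fJ: "finite J" using J finite_subset by blast
  define \<psi> where "\<psi> x y = (if x \<in> t ` J then s * ((if y then 1 else 0) - \<theta>) else 0)" for x y
  have [measurable]: "t ` J \<in> sets borel" using fJ by (intro borel_closed finite_imp_closed) simp
  have \<psi>_meas: "(\<lambda>(u, x). \<psi> x (u \<le> x)) \<in> borel_measurable (borel \<Otimes>\<^sub>M borel)"
    unfolding \<psi>_def case_prod_unfold by measurable
  have meas: "(\<lambda>\<omega>. \<psi> (X j \<omega>) (Y j \<omega>)) \<in> borel_measurable M" if j: "j \<in> {1..n}" for j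
    using measurable_compose[OF measurable_Pair[OF measurable_sample[OF j]] \<psi>_meas] by simp
  have inJ: "t i \<in> t ` J \<longleftrightarrow> i \<in> J" for i using inj_image_mem_iff[OF inj_t] .
  have sum: "(\<Sum>i=1..K. p i *\<^sub>R (F (t i) *\<^sub>R v (\<psi> (t i) True) + (1 - F (t i)) *\<^sub>R v (\<psi> (t i) False)))
      = (\<Sum>i\<in>J. p i * (F (t i) * v (s * (1 - \<theta>)) + (1 - F (t i)) * v (s * (- \<theta>))))"
    if "v 0 = 0" for v :: "real \<Rightarrow> real"
  proof -
    have "(\<Sum>i=1..K. p i *\<^sub>R (F (t i) *\<^sub>R v (\<psi> (t i) True) + (1 - F (t i)) *\<^sub>R v (\<psi> (t i) False)))
        = (\<Sum>i\<in>J. p i *\<^sub>R (F (t i) *\<^sub>R v (\<psi> (t i) True) + (1 - F (t i)) *\<^sub>R v (\<psi> (t i) False)))"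
      using J that by (intro sum.mono_neutral_right) (auto simp: \<psi>_def inJ)
    also have "\<dots> = (\<Sum>i\<in>J. p i * (F (t i) * v (s * (1 - \<theta>)) + (1 - F (t i)) * v (s * (- \<theta>))))"
      by (intro sum.cong refl) (simp add: \<psi>_def inJ)
    finally show ?thesis .
  qed
  \<comment> \<open>The factor 4 comes from \<bar>Y - \<theta>\<bar> \<le> 2 for an indicator Y and
    \<bar>\<theta>\<bar> \<le> 1.\<close>
  have ineq: "F (t i) * (s * (1 - \<theta>))\<^sup>2 + (1 - F (t i)) * (s * (- \<theta>))\<^sup>2 \<le> 4" for i
  proof -
    have "\<bar>1 - \<theta>\<bar> \<le> 2" "\<bar>\<theta>\<bar> \<le> 2" "s\<^sup>2 = 1" using \<theta> s by auto
    then have b: "(s * (1 - \<theta>))\<^sup>2 \<le> 4" "(s * (- \<theta>))\<^sup>2 \<le> 4"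
      using abs_le_square_iff[of "1 - \<theta>" 2] abs_le_square_iff[of \<theta> 2] by (auto simp: power_mult_distrib)
    have "F (t i) * (s * (1 - \<theta>))\<^sup>2 + (1 - F (t i)) * (s * (- \<theta>))\<^sup>2 \<le> F (t i) * 4 + (1 - F (t i)) * 4"
      using F_range[of "t i"] b by (intro add_mono mult_left_mono) auto
    then show ?thesis by simp
  qed
  have "prob {\<omega> \<in> space M. (\<Sum>j\<in>{1..n}. \<psi> (X j \<omega>) (Y j \<omega>)) < 0}
      \<le> 4 * (\<Sum>i\<in>J. p i) / (card {1..n} * (\<Sum>i\<in>J. p i * (s * (F (t i) - \<theta>)))\<^sup>2)"
  proof (rule indep_sum_neg_prob[OF _ _ _ _ _ _ \<mu>])
    show "indep_vars (\<lambda>_. borel) (\<lambda>j \<omega>. \<psi> (X j \<omega>) (Y j \<omega>)) {1..n}"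
      using indep_vars_compose2[OF indep_vars_sample \<psi>_meas] by simp
    show "\<bar>\<psi> (X j \<omega>) (Y j \<omega>)\<bar> \<le> 2" for j \<omega> using s \<theta> by (auto simp: \<psi>_def)
    fix j assume j: "j \<in> {1..n}"
    have "expectation (\<lambda>\<omega>. \<psi> (X j \<omega>) (Y j \<omega>))
        = (\<Sum>i\<in>J. p i * (F (t i) * (s * (1 - \<theta>)) + (1 - F (t i)) * (s * (- \<theta>))))"
      using expectation_XY[OF j meas[OF j]] sum[of "\<lambda>x. x"] by simp
    also have "\<dots> = (\<Sum>i\<in>J. p i * (s * (F (t i) - \<theta>)))"
      by (intro sum.cong refl) (simp add: algebra_simps)
    finally show "expectation (\<lambda>\<omega>. \<psi> (X j \<omega>) (Y j \<omega>)) = (\<Sum>i\<in>J. p i * (s * (F (t i) - \<theta>)))" .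
    have "(\<lambda>\<omega>. (\<psi> (X j \<omega>) (Y j \<omega>))\<^sup>2) \<in> borel_measurable M" using meas[OF j] by (rule borel_measurable_power)
    from expectation_XY[OF j this]
    have "expectation (\<lambda>\<omega>. (\<psi> (X j \<omega>) (Y j \<omega>))\<^sup>2)
        = (\<Sum>i\<in>J. p i * (F (t i) * (s * (1 - \<theta>))\<^sup>2 + (1 - F (t i)) * (s * (- \<theta>))\<^sup>2))"
      using sum[of "\<lambda>x. x\<^sup>2"] by simp
    also have "\<dots> \<le> (\<Sum>i\<in>J. p i * 4)" using ineq p_nonneg by (intro sum_mono mult_left_mono)
    also have "\<dots> = 4 * (\<Sum>i\<in>J. p i)" by (simp add: sum_distrib_left mult.commute)
    finally show "expectation (\<lambda>\<omega>. (\<psi> (X j \<omega>) (Y j \<omega>))\<^sup>2) \<le> 4 * (\<Sum>i\<in>J. p i)" .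
  qed (use n in auto)
  then show ?thesis by (simp add: deviation_def \<psi>_def)
qed

text \<open>The weights are probabilities of disjoint events for a single observation, which
  bypasses the telescoping sum and its boundary cases.\<close>

lemma sum_p_le_1:
  assumes "J \<subseteq> {1..K}" shows "(\<Sum>i\<in>J. p i) \<le> 1"
proof -
  have fJ: "finite J" using assms finite_subset by blast
  have 1: "1 \<in> {1..n}" using n by auto
  have m: "{\<omega> \<in> space M. X 1 \<omega> = t i} \<in> events" for i
    using measurable_sample(2)[OF 1] by measurable
  have "(\<Sum>i\<in>J. p i) = (\<Sum>i\<in>J. prob {\<omega> \<in> space M. X 1 \<omega> = t i})"
    using assms by (intro sum.cong refl prob_X[OF 1, symmetric]) auto
  also have "\<dots> = prob (\<Union>i\<in>J. {\<omega> \<in> space M. X 1 \<omega> = t i})"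
    using fJ by (intro finite_measure_finite_Union[symmetric]) (use m in \<open>auto simp: disjoint_family_on_def inj_eq[OF inj_t]\<close>)
  also have "\<dots> \<le> 1" by (rule prob_le_1)
  finally show ?thesis .
qed

text \<open>
  Summing Chebyshev bounds over all grid points is affordable: the drift is quadratic and the
  variance is linear in the distance, at least up to the distance \<open>d0\<close>; beyond, the drift does not
  decrease and there are only \<open>O(1/\<delta>)\<close> grid points.
\<close>

lemma deviation_tail:
  fixes c3 e B L g2 \<eta> D' :: real
  assumes c3: "n * \<delta> ^ 3 = c3" and \<delta>1: "\<delta> \<le> 1"
    and s: "s = 1 \<or> s = -1" and \<theta>: "\<bar>\<theta>\<bar> \<le> 1"
    and w: "inj_on w {1..D}" "w ` {1..D} \<subseteq> {1..K}"
    and near: "\<And>d. d \<in> {1..d0} \<Longrightarrow> \<delta>\<^sup>2 * (e * real d - B) \<le> p (w d) * (s * (F (t (w d)) - \<theta>))"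
      "\<And>d. d \<in> {1..d0} \<Longrightarrow> p (w d) \<le> g2 * \<delta>"
    and far: "\<And>d. d \<in> {d0<..D} \<Longrightarrow> 0 \<le> s * (F (t (w d)) - \<theta>)"
    and m0: "1 \<le> m0" "m0 \<le> d0" "d0 \<le> D" and e: "0 \<le> e" and L: "0 < L"
    and quad: "\<And>m. m0 \<le> m \<Longrightarrow> L * sqrt (real m ^ 3) \<le> e * (real m)\<^sup>2 / 2 - B * real m"
    and \<eta>: "0 < \<eta>" "\<eta> / \<delta> \<le> real d0" and D': "real D \<le> D' / \<delta>"
  shows "prob {\<omega> \<in> space M. \<exists>m\<in>{m0..D}. deviation s \<theta> (w ` {1..m}) \<omega> < 0} \<le> (8 * g2 + 4 * D' / \<eta> ^ 3) / (c3 * L\<^sup>2)"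
proof -
  define \<mu> where "\<mu> m = (\<Sum>d=1..m. p (w d) * (s * (F (t (w d)) - \<theta>)))" for m
  define Q where "Q m = (\<Sum>d=1..m. p (w d))" for m
  have inj: "inj_on w {1..m}" if "m \<le> D" for m using w(1) by (rule inj_on_subset) (use that in auto)
  have near_mean: "\<delta>\<^sup>2 * (L * sqrt (real m ^ 3)) \<le> \<mu> m" if m: "m0 \<le> m" "m \<le> d0" for m
  proof -
    have "(\<Sum>d=1..m. e * real d - B) = e * (real m * (real m + 1) / 2) - B * real m"
    proof (induction m)
      case (Suc m) then show ?case by (simp add: field_simps)
    qed simp
    also have "\<dots> \<ge> e * (real m)\<^sup>2 / 2 - B * real m"
      using e by (simp add: field_simps power2_eq_square)
    finally have "L * sqrt (real m ^ 3) \<le> (\<Sum>d=1..m. e * real d - B)" using quad[OF m(1)] by linarith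
    then have "\<delta>\<^sup>2 * (L * sqrt (real m ^ 3)) \<le> \<delta>\<^sup>2 * (\<Sum>d=1..m. e * real d - B)" by (rule mult_left_mono) simp
    also have "\<dots> \<le> \<mu> m" unfolding \<mu>_def sum_distrib_left using near(1) m by (intro sum_mono) auto
    finally show ?thesis .
  qed
  have far_mean: "\<delta>\<^sup>2 * (L * sqrt (real d0 ^ 3)) \<le> \<mu> m" if m: "d0 < m" "m \<le> D" for m
  proof -
    have "\<mu> d0 \<le> \<mu> m" unfolding \<mu>_def
      using m far p_nonneg by (intro sum_mono2) (auto intro!: mult_nonneg_nonneg[OF p_nonneg])
    then show ?thesis using near_mean[of d0] m0 by simp
  qed
  have n_pos: "0 < real n" using n by simp
  \<comment> \<open>One Chebyshev bound for both regimes: \<open>x\<close> is \<open>m\<close>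
    itself up to distance \<open>d0\<close> and stays at \<open>d0\<close> beyond, while
    \<open>q\<close> bounds the total weight of the cells.\<close>
  have pr: "prob {\<omega> \<in> space M. deviation s \<theta> (w ` {1..m}) \<omega> < 0} \<le> 4 * q / (n * (\<delta> ^ 4 * (L\<^sup>2 * x ^ 3)))"
    if m: "m \<le> D" and x: "0 < x" "\<delta>\<^sup>2 * (L * sqrt (x ^ 3)) \<le> \<mu> m" and q: "Q m \<le> q" for m x q
  proof -
    have "0 < \<delta>\<^sup>2 * (L * sqrt (x ^ 3))" using \<delta> L x by simp
    then have \<mu>pos: "0 < \<mu> m" using x by linarith
    have sums: "(\<Sum>i\<in>w ` {1..m}. p i * (s * (F (t i) - \<theta>))) = \<mu> m" "(\<Sum>i\<in>w ` {1..m}. p i) = Q m"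
      unfolding \<mu>_def Q_def using inj[OF m] by (simp_all add: sum.reindex)
    have "w ` {1..m} \<subseteq> {1..K}" using w(2) m by fastforce
    from deviation_neg_prob[OF this s \<theta>] \<mu>pos
    have "prob {\<omega> \<in> space M. deviation s \<theta> (w ` {1..m}) \<omega> < 0} \<le> 4 * Q m / (n * (\<mu> m)\<^sup>2)"
      unfolding sums by blast
    also have "\<dots> \<le> 4 * q / (n * (\<delta>\<^sup>2 * (L * sqrt (x ^ 3)))\<^sup>2)"
    proof (rule frac_le)
      have "0 \<le> Q m" unfolding Q_def using p_nonneg by (intro sum_nonneg)
      then show "0 \<le> 4 * q" using q by simp
      show "n * (\<delta>\<^sup>2 * (L * sqrt (x ^ 3)))\<^sup>2 \<le> n * (\<mu> m)\<^sup>2"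
        using x L \<delta> by (intro mult_left_mono power_mono) auto
      show "0 < n * (\<delta>\<^sup>2 * (L * sqrt (x ^ 3)))\<^sup>2"
        by (intro mult_pos_pos zero_less_power n_pos \<open>0 < \<delta>\<^sup>2 * (L * sqrt (x ^ 3))\<close>)
    qed (use q in auto)
    also have "(\<delta>\<^sup>2 * (L * sqrt (x ^ 3)))\<^sup>2 = \<delta> ^ 4 * (L\<^sup>2 * x ^ 3)"
      using x by (simp add: power_mult_distrib)
    finally show ?thesis .
  qed
  have c3pos: "0 < c3" using c3 \<delta> n_pos by (metis mult_pos_pos zero_less_power)
  \<comment> \<open>As n \<delta>^3 is constant, one factor \<delta> survives in the denominator; it
    cancels the \<delta> in the total weight of the near cells.\<close>
  have n4: "n * \<delta> ^ 4 = c3 * \<delta>" using c3 by (simp add: power_numeral_reduce mult.assoc mult.commute)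
  have near_prob: "prob {\<omega> \<in> space M. deviation s \<theta> (w ` {1..m}) \<omega> < 0} \<le> 4 * g2 / (c3 * L\<^sup>2) * (1 / (real m)\<^sup>2)"
    if m: "m0 \<le> m" "m \<le> d0" for m
  proof -
    have "Q m \<le> (\<Sum>d=1..m. g2 * \<delta>)" unfolding Q_def using near(2) m by (intro sum_mono) auto
    then have "Q m \<le> g2 * \<delta> * real m" by (simp add: mult.commute)
    then have "prob {\<omega> \<in> space M. deviation s \<theta> (w ` {1..m}) \<omega> < 0}
        \<le> 4 * (g2 * \<delta> * real m) / (n * (\<delta> ^ 4 * (L\<^sup>2 * real m ^ 3)))"
      using m m0 near_mean[OF m] by (intro pr) auto
    also have "n * (\<delta> ^ 4 * (L\<^sup>2 * real m ^ 3)) = c3 * \<delta> * (L\<^sup>2 * real m ^ 3)"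
      by (simp add: n4 flip: mult.assoc)
    also have "4 * (g2 * \<delta> * real m) / (c3 * \<delta> * (L\<^sup>2 * real m ^ 3)) = 4 * g2 / (c3 * L\<^sup>2) * (1 / (real m)\<^sup>2)"
      using \<delta> m m0 by (simp add: power2_eq_square power3_eq_cube)
    finally show ?thesis .
  qed
  \<comment> \<open>With \<open>d0\<close> of order 1/\<delta> each far term is of order \<delta>^2,
    so the O(1/\<delta>) many of them sum to O(\<delta>).\<close>
  have far_prob: "prob {\<omega> \<in> space M. deviation s \<theta> (w ` {1..m}) \<omega> < 0} \<le> 4 * \<delta>\<^sup>2 / (c3 * L\<^sup>2 * \<eta> ^ 3)"
    if m: "d0 < m" "m \<le> D" for m
  proof -
    have "w ` {1..m} \<subseteq> {1..K}" using w(2) m by fastforce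
    from sum_p_le_1[OF this] have "Q m \<le> 1"
      unfolding Q_def using inj[OF m(2)] by (simp add: sum.reindex)
    then have "prob {\<omega> \<in> space M. deviation s \<theta> (w ` {1..m}) \<omega> < 0} \<le> 4 * 1 / (n * (\<delta> ^ 4 * (L\<^sup>2 * real d0 ^ 3)))"
      using m m0 far_mean[OF m] by (intro pr) auto
    also have "\<dots> \<le> 4 * 1 / (n * (\<delta> ^ 4 * (L\<^sup>2 * (\<eta> / \<delta>) ^ 3)))"
      using \<eta> \<delta> L n_pos by (intro divide_left_mono mult_left_mono power_mono mult_pos_pos zero_less_power) (use m0 in auto)
    also have "n * (\<delta> ^ 4 * (L\<^sup>2 * (\<eta> / \<delta>) ^ 3)) = c3 * \<delta> * (L\<^sup>2 * (\<eta> / \<delta>) ^ 3)"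
      by (simp add: n4 flip: mult.assoc)
    also have "4 * 1 / (c3 * \<delta> * (L\<^sup>2 * (\<eta> / \<delta>) ^ 3)) = 4 * \<delta>\<^sup>2 / (c3 * L\<^sup>2 * \<eta> ^ 3)"
      using \<delta> \<eta> by (simp add: power2_eq_square power3_eq_cube field_simps)
    finally show ?thesis .
  qed
  have ev: "{\<omega> \<in> space M. deviation s \<theta> (w ` {1..m}) \<omega> < 0} \<in> events" for m
  proof -
    have [measurable]: "t ` w ` {1..m} \<in> sets borel" by (intro borel_closed finite_imp_closed) simp
    note [measurable] = measurable_sample
    show ?thesis unfolding deviation_def by measurable
  qed
  have "prob {\<omega> \<in> space M. \<exists>m\<in>{m0..D}. deviation s \<theta> (w ` {1..m}) \<omega> < 0}
      = prob (\<Union>m\<in>{m0..D}. {\<omega> \<in> space M. deviation s \<theta> (w ` {1..m}) \<omega> < 0})"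
    by (rule arg_cong[where f = prob]) auto
  also have "\<dots> \<le> (\<Sum>m\<in>{m0..D}. prob {\<omega> \<in> space M. deviation s \<theta> (w ` {1..m}) \<omega> < 0})"
    using ev by (intro finite_measure_subadditive_finite) auto
  also have "\<dots> = (\<Sum>m\<in>{m0..d0}. prob {\<omega> \<in> space M. deviation s \<theta> (w ` {1..m}) \<omega> < 0})
      + (\<Sum>m\<in>{d0<..D}. prob {\<omega> \<in> space M. deviation s \<theta> (w ` {1..m}) \<omega> < 0})"
    using m0 by (subst sum.union_disjoint[symmetric]) (auto intro!: sum.cong)
  also have "\<dots> \<le> (\<Sum>m\<in>{m0..d0}. 4 * g2 / (c3 * L\<^sup>2) * (1 / (real m)\<^sup>2)) + (\<Sum>m\<in>{d0<..D}. 4 * \<delta>\<^sup>2 / (c3 * L\<^sup>2 * \<eta> ^ 3))"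
    using near_prob far_prob by (intro add_mono sum_mono) auto
  also have "\<dots> \<le> 4 * g2 / (c3 * L\<^sup>2) * 2 + D' / \<delta> * (4 * \<delta>\<^sup>2 / (c3 * L\<^sup>2 * \<eta> ^ 3))"
  proof (rule add_mono)
    have "0 \<le> p (w 1)" by (rule p_nonneg)
    also have "\<dots> \<le> g2 * \<delta>" using near(2)[of 1] m0 by auto
    finally have g2: "0 \<le> g2" using \<delta> by (simp add: zero_le_mult_iff)
    have "(\<Sum>m\<in>{m0..d0}. 1 / (real m)\<^sup>2) \<le> (\<Sum>m=1..d0. 1 / (real m)\<^sup>2)"
      using m0 by (intro sum_mono2) auto
    also have "\<dots> \<le> 2" by (rule sum_inverse_squares_le)
    finally have "4 * g2 / (c3 * L\<^sup>2) * (\<Sum>m\<in>{m0..d0}. 1 / (real m)\<^sup>2) \<le> 4 * g2 / (c3 * L\<^sup>2) * 2"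
      using g2 c3pos by (intro mult_left_mono) auto
    then show "(\<Sum>m\<in>{m0..d0}. 4 * g2 / (c3 * L\<^sup>2) * (1 / (real m)\<^sup>2)) \<le> 4 * g2 / (c3 * L\<^sup>2) * 2"
      by (simp add: sum_distrib_left)
    have "real (D - d0) \<le> D' / \<delta>" using D' by linarith
    then show "(\<Sum>m\<in>{d0<..D}. 4 * \<delta>\<^sup>2 / (c3 * L\<^sup>2 * \<eta> ^ 3)) \<le> D' / \<delta> * (4 * \<delta>\<^sup>2 / (c3 * L\<^sup>2 * \<eta> ^ 3))"
      unfolding sum_constant card_greaterThanAtMost using c3pos \<eta> by (intro mult_right_mono) auto
  qed
  also have "D' / \<delta> * (4 * \<delta>\<^sup>2 / (c3 * L\<^sup>2 * \<eta> ^ 3)) = 4 * D' / \<eta> ^ 3 / (c3 * L\<^sup>2) * \<delta>"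
    using \<delta> by (simp add: power2_eq_square field_simps)
  also have "\<dots> \<le> 4 * D' / \<eta> ^ 3 / (c3 * L\<^sup>2) * 1"
  proof (intro mult_left_mono \<delta>1)
    have "0 \<le> D' / \<delta>" using D' by (rule order_trans[rotated]) simp
    then have "0 \<le> D'" using \<delta> by (simp add: zero_le_divide_iff)
    then show "0 \<le> 4 * D' / \<eta> ^ 3 / (c3 * L\<^sup>2)" using c3pos \<eta> by simp
  qed
  finally show ?thesis by (simp add: add_divide_distrib mult.commute)
qed

end

section \<open>Characteristic functions of cell sums\<close>

text \<open>Compares \<phi> n and exp(z/n), both in the unit disc because Re z \<le> 0. There n-th
  powers differ by at most n times the difference of the bases, so no complex logarithm is
  involved.\<close>

lemma power_tendsto_exp:
  fixes \<phi> :: "nat \<Rightarrow> complex"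
  assumes lim: "(\<lambda>n. of_nat n * (\<phi> n - 1)) \<longlonglongrightarrow> z" and \<phi>: "\<forall>\<^sub>F n in sequentially. norm (\<phi> n) \<le> 1" and z: "Re z \<le> 0"
  shows "(\<lambda>n. \<phi> n ^ n) \<longlonglongrightarrow> exp z"
proof (rule Lim_transform)
  have e: "exp z = exp (z / of_nat n) ^ n" if "0 < n" for n :: nat
    using that by (simp flip: exp_of_nat_mult)
  have "(\<lambda>n. of_nat n * (exp (z / of_nat n) - 1)) \<longlonglongrightarrow> z"
  proof -
    have "((\<lambda>x. exp (z * x)) has_field_derivative z) (at 0)"
      by (auto intro!: derivative_eq_intros)
    then have "((\<lambda>x. (exp (z * x) - 1) / x) \<longlongrightarrow> z) (at 0)" by (simp add: DERIV_def)
    moreover have "filterlim (\<lambda>n. 1 / of_nat n :: complex) (at 0) sequentially"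
      unfolding filterlim_at
    proof
      show "(\<lambda>n. 1 / of_nat n :: complex) \<longlonglongrightarrow> 0" by (rule lim_1_over_n)
      show "\<forall>\<^sub>F n in sequentially. 1 / of_nat n \<in> (UNIV :: complex set) \<and> (1 / of_nat n :: complex) \<noteq> 0"
        using eventually_gt_at_top[of 0] by eventually_elim simp
    qed
    ultimately have "(\<lambda>n. (exp (z * (1 / of_nat n)) - 1) / (1 / of_nat n)) \<longlonglongrightarrow> z"
      by (rule filterlim_compose)
    then show ?thesis by (simp add: mult.commute)
  qed
  from tendsto_norm[OF tendsto_diff[OF lim this]]
  have "(\<lambda>n. norm (of_nat n * (\<phi> n - 1) - of_nat n * (exp (z / of_nat n) - 1))) \<longlonglongrightarrow> 0" by simp
  moreover have "\<forall>\<^sub>F n in sequentially. norm (\<phi> n ^ n - exp z)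
      \<le> norm (of_nat n * (\<phi> n - 1) - of_nat n * (exp (z / of_nat n) - 1))"
    using \<phi> eventually_gt_at_top[of 0]
  proof eventually_elim
    case (elim n)
    have "norm (exp (z / of_nat n)) \<le> 1" using z by (simp add: divide_nonpos_nonneg)
    then have "norm (\<phi> n ^ n - exp (z / of_nat n) ^ n) \<le> n * norm (\<phi> n - exp (z / of_nat n))"
      using elim by (intro norm_power_diff)
    also have "\<dots> = norm (of_nat n * (\<phi> n - 1) - of_nat n * (exp (z / of_nat n) - 1))"
      by (simp add: norm_mult[symmetric] right_diff_distrib del: norm_mult) (simp add: norm_mult flip: right_diff_distrib)
    finally show ?case using e[OF elim(2)] by simp
  qed
  ultimately show "(\<lambda>n. \<phi> n ^ n - exp z) \<longlonglongrightarrow> 0"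
    by (rule Lim_null_comparison[rotated])
qed simp

text \<open>
  With \<open>x1\<close> and \<open>x2\<close> the two exponents, the first-order terms combine to exactly
  \<open>h\<^sup>2 (s D + r)\<close> because \<open>Fk = Fl + h D\<close>.
\<close>

lemma cell_exponent_limit:
  fixes h Fl D :: "nat \<Rightarrow> real"
  assumes h: "h \<longlonglongrightarrow> 0" "\<forall>\<^sub>F n in sequentially. 0 < h n"
    and Fl: "Fl \<longlonglongrightarrow> F0" and D: "D \<longlonglongrightarrow> d"
  shows "(\<lambda>n. ((Fl n + h n * D n) * (iexp (h n * s * (1 - Fl n) + (h n)\<^sup>2 * r) - 1)
      + (1 - (Fl n + h n * D n)) * (iexp (h n * s * (- Fl n) + (h n)\<^sup>2 * r) - 1)) / (h n)\<^sup>2)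
    \<longlonglongrightarrow> \<i> * complex_of_real (s * d + r) - complex_of_real (s\<^sup>2 * (F0 * (1 - F0)) / 2)"
proof -
  define A where "A n = s * (1 - Fl n) + h n * r" for n
  define B where "B n = s * (- Fl n) + h n * r" for n
  define Fk where "Fk n = Fl n + h n * D n" for n
  define er where "er x = iexp x - (1 + \<i> * x - x\<^sup>2 / 2)" for x :: real
  have er: "norm (er x) \<le> \<bar>x\<bar> ^ 3" for x
  proof -
    have "norm (iexp x - (\<Sum>k\<le>2. (\<i> * x) ^ k / fact k)) \<le> \<bar>x\<bar> ^ Suc 2 / fact (Suc 2)"
      by (rule iexp_approx1)
    also have "(\<Sum>k\<le>2. (\<i> * x) ^ k / fact k) = 1 + \<i> * x - x\<^sup>2 / 2"
      by (simp add: numeral_2_eq_2 power2_eq_square algebra_simps)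
    also have "\<bar>x\<bar> ^ Suc 2 / fact (Suc 2) \<le> \<bar>x\<bar> ^ 3" by (simp add: fact_numeral)
    finally show ?thesis by (simp add: er_def)
  qed
  have lims: "A \<longlonglongrightarrow> s * (1 - F0)" "B \<longlonglongrightarrow> s * (- F0)" "Fk \<longlonglongrightarrow> F0"
    unfolding A_def B_def Fk_def using h(1) Fl D by (auto intro!: tendsto_eq_intros)
  define E where "E n = (Fk n * er (h n * A n) + (1 - Fk n) * er (h n * B n)) / (h n)\<^sup>2" for n
  \<comment> \<open>Each Taylor remainder is of order h^3, one power more than the division by h^2
    consumes.\<close>
  have "E \<longlonglongrightarrow> 0"
  proof (rule Lim_null_comparison)
    show "(\<lambda>n. \<bar>Fk n\<bar> * (h n * \<bar>A n\<bar> ^ 3) + \<bar>1 - Fk n\<bar> * (h n * \<bar>B n\<bar> ^ 3)) \<longlonglongrightarrow> 0"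
      using h(1) lims by (auto intro!: tendsto_eq_intros)
    show "\<forall>\<^sub>F n in sequentially. norm (E n) \<le> \<bar>Fk n\<bar> * (h n * \<bar>A n\<bar> ^ 3) + \<bar>1 - Fk n\<bar> * (h n * \<bar>B n\<bar> ^ 3)"
      using h(2)
    proof eventually_elim
      case (elim n)
      have er': "norm (er (h n * x)) \<le> (h n)\<^sup>2 * (h n * \<bar>x\<bar> ^ 3)" for x
      proof -
        have "\<bar>h n * x\<bar> ^ 3 = (h n)\<^sup>2 * (h n * \<bar>x\<bar> ^ 3)"
          using elim by (simp add: abs_mult power_mult_distrib power3_eq_cube power2_eq_square)
        then show ?thesis using er[of "h n * x"] by simp
      qed
      have "norm (Fk n * er (h n * A n) + (1 - Fk n) * er (h n * B n))
          \<le> \<bar>Fk n\<bar> * ((h n)\<^sup>2 * (h n * \<bar>A n\<bar> ^ 3)) + \<bar>1 - Fk n\<bar> * ((h n)\<^sup>2 * (h n * \<bar>B n\<bar> ^ 3))"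
      proof (rule norm_triangle_mono)
        show "norm (Fk n * er (h n * A n)) \<le> \<bar>Fk n\<bar> * ((h n)\<^sup>2 * (h n * \<bar>A n\<bar> ^ 3))"
          unfolding norm_mult norm_of_real by (intro mult_left_mono er') simp
        show "norm ((1 - Fk n) * er (h n * B n)) \<le> \<bar>1 - Fk n\<bar> * ((h n)\<^sup>2 * (h n * \<bar>B n\<bar> ^ 3))"
          unfolding norm_mult norm_of_real by (intro mult_left_mono er') simp
      qed
      also have "\<dots> = (h n)\<^sup>2 * (\<bar>Fk n\<bar> * (h n * \<bar>A n\<bar> ^ 3) + \<bar>1 - Fk n\<bar> * (h n * \<bar>B n\<bar> ^ 3))"
        by (simp add: algebra_simps)
      finally show ?case using elim by (simp add: E_def norm_divide divide_le_eq mult.commute norm_power)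
    qed
  qed
  then have main: "(\<lambda>n. \<i> * (s * D n + r) - (Fk n * (A n)\<^sup>2 + (1 - Fk n) * (B n)\<^sup>2) / 2 + E n)
      \<longlonglongrightarrow> \<i> * (s * d + r) - (F0 * (s * (1 - F0))\<^sup>2 + (1 - F0) * (s * (- F0))\<^sup>2) / 2 + 0"
    using lims D by (intro tendsto_intros) auto
  \<comment> \<open>The two quadratic terms add up to the Bernoulli variance, F0 (1 - F0)^2 + (1 -
    F0) F0^2 = F0 (1 - F0).\<close>
  have val: "\<i> * (s * d + r) - (F0 * (s * (1 - F0))\<^sup>2 + (1 - F0) * (s * (- F0))\<^sup>2) / 2 + 0
      = \<i> * (s * d + r) - s\<^sup>2 * (F0 * (1 - F0)) / 2"
    by (simp add: power2_eq_square algebra_simps)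
  have "\<forall>\<^sub>F n in sequentially. \<i> * (s * D n + r) - (Fk n * (A n)\<^sup>2 + (1 - Fk n) * (B n)\<^sup>2) / 2 + E n
      = (Fk n * (iexp (h n * s * (1 - Fl n) + (h n)\<^sup>2 * r) - 1)
        + (1 - Fk n) * (iexp (h n * s * (- Fl n) + (h n)\<^sup>2 * r) - 1)) / (h n)\<^sup>2"
    using h(2)
  proof eventually_elim
    case (elim n)
    have x: "h n * s * (1 - Fl n) + (h n)\<^sup>2 * r = h n * A n" "h n * s * (- Fl n) + (h n)\<^sup>2 * r = h n * B n"
      by (simp_all add: A_def B_def power2_eq_square algebra_simps)
    have i: "iexp y - 1 = \<i> * y - y\<^sup>2 / 2 + er y" for y by (simp add: er_def)
    have first: "Fk n * A n + (1 - Fk n) * B n = h n * (s * D n + r)"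
      by (simp add: A_def B_def Fk_def algebra_simps)
    have "Fk n * (\<i> * (h n * A n) - (h n * A n)\<^sup>2 / 2 + er (h n * A n)) + (1 - Fk n) * (\<i> * (h n * B n) - (h n * B n)\<^sup>2 / 2 + er (h n * B n))
        = \<i> * h n * complex_of_real (Fk n * A n + (1 - Fk n) * B n)
          - (h n)\<^sup>2 * (Fk n * (A n)\<^sup>2 + (1 - Fk n) * (B n)\<^sup>2) / 2 + (h n)\<^sup>2 * E n"
      using elim by (simp add: E_def power_mult_distrib) (simp add: algebra_simps add_divide_distrib diff_divide_distrib)
    also have "\<dots> = (h n)\<^sup>2 * (\<i> * (s * D n + r) - (Fk n * (A n)\<^sup>2 + (1 - Fk n) * (B n)\<^sup>2) / 2 + E n)"
      unfolding first by (simp add: power2_eq_square algebra_simps)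
    finally show ?case unfolding x i using elim by simp
  qed
  from Lim_transform_eventually[OF main this] show ?thesis unfolding val Fk_def .
qed

context grid_sample
begin

definition cell_count :: "nat \<Rightarrow> 'a \<Rightarrow> real" where
  "cell_count i \<omega> = (\<Sum>j=1..n. if X j \<omega> = t i then 1 else 0)"

definition cell_dev :: "real \<Rightarrow> nat \<Rightarrow> 'a \<Rightarrow> real" where
  "cell_dev \<theta> i \<omega> = (\<Sum>j=1..n. if X j \<omega> = t i then (if Y j \<omega> then 1 else 0) - \<theta> else 0)"

lemma measurable_cell: "cell_count i \<in> borel_measurable M" "cell_dev \<theta> i \<in> borel_measurable M"
proof -
  note [measurable] = measurable_sample
  show "cell_count i \<in> borel_measurable M" unfolding cell_count_def[abs_def] by measurable
  show "cell_dev \<theta> i \<in> borel_measurable M" unfolding cell_dev_def[abs_def] by measurable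
qed

text \<open>The characteristic function of the contribution of a single observation. It is written
  as 1 plus terms weighted by the small cell probabilities, the form in which its n-th power has a
  limit.\<close>

definition cell_char :: "('k \<Rightarrow> nat) \<Rightarrow> real \<Rightarrow> ('k \<Rightarrow> real) \<Rightarrow> ('k \<Rightarrow> real) \<Rightarrow> 'k set \<Rightarrow> complex" where
  "cell_char m \<theta> u v A = 1 + (\<Sum>k\<in>A. p (m k) * (F (t (m k)) * (iexp (u k * (1 - \<theta>) + v k) - 1)
      + (1 - F (t (m k))) * (iexp (u k * (- \<theta>) + v k) - 1)))"

text \<open>Exchanging the sums over cells and observations turns a linear combination of cell sums
  into a sum of \<open>n\<close> independent terms with the same mean exponential. The norm bound
  holds because the base is the mean of a unimodular variable.\<close>

lemma char_cells:
  assumes A: "finite A" "inj_on m A" "m ` A \<subseteq> {1..K}"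
  shows "expectation (\<lambda>\<omega>. iexp (\<Sum>k\<in>A. u k * cell_dev \<theta> (m k) \<omega> + v k * cell_count (m k) \<omega>)) = cell_char m \<theta> u v A ^ n"
    and "norm (cell_char m \<theta> u v A) \<le> 1"
proof -
  define \<psi> where "\<psi> x y = (\<Sum>k\<in>A. if x = t (m k) then u k * ((if y then 1 else 0) - \<theta>) + v k else 0)" for x and y :: bool
  have \<psi>_meas: "(\<lambda>(u, x). iexp (\<psi> x (u \<le> x))) \<in> borel_measurable (borel \<Otimes>\<^sub>M borel)"
    unfolding \<psi>_def case_prod_unfold by measurable
  have meas[measurable]: "(\<lambda>\<omega>. iexp (\<psi> (X j \<omega>) (Y j \<omega>))) \<in> borel_measurable M" if j: "j \<in> {1..n}" for j
    using measurable_compose[OF measurable_Pair[OF measurable_sample[OF j]] \<psi>_meas] by simp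
  have int: "integrable M (\<lambda>\<omega>. iexp (\<psi> (X j \<omega>) (Y j \<omega>)))" if j: "j \<in> {1..n}" for j
    using meas[OF j] by (intro integrable_const_bound[of _ 1]) auto
  have at_m: "\<psi> (t (m k)) y = u k * ((if y then 1 else 0) - \<theta>) + v k" if k: "k \<in> A" for k y
  proof -
    have "\<psi> (t (m k)) y = (\<Sum>k'\<in>A. if k' = k then u k * ((if y then 1 else 0) - \<theta>) + v k else 0)"
      unfolding \<psi>_def using k inj_onD[OF A(2)] by (intro sum.cong refl) (auto simp: inj_eq[OF inj_t])
    then show ?thesis using A k by simp
  qed
  have out: "\<psi> (t i) y = 0" if "i \<notin> m ` A" for i y
    unfolding \<psi>_def using that by (intro sum.neutral) (auto simp: inj_eq[OF inj_t])
  have mean: "expectation (\<lambda>\<omega>. iexp (\<psi> (X j \<omega>) (Y j \<omega>))) = cell_char m \<theta> u v A" if j: "j \<in> {1..n}" for j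
  proof -
    have "expectation (\<lambda>\<omega>. iexp (\<psi> (X j \<omega>) (Y j \<omega>)) - 1)
        = (\<Sum>i=1..K. p i *\<^sub>R (F (t i) *\<^sub>R (iexp (\<psi> (t i) True) - 1) + (1 - F (t i)) *\<^sub>R (iexp (\<psi> (t i) False) - 1)))"
      by (intro expectation_XY[OF j, of "\<lambda>x y. iexp (\<psi> x y) - 1"] borel_measurable_diff meas[OF j] borel_measurable_const)
    also have "\<dots> = (\<Sum>i\<in>m ` A. p i *\<^sub>R (F (t i) *\<^sub>R (iexp (\<psi> (t i) True) - 1) + (1 - F (t i)) *\<^sub>R (iexp (\<psi> (t i) False) - 1)))"
      using A by (intro sum.mono_neutral_right) (auto simp: out)
    also have "\<dots> = cell_char m \<theta> u v A - 1"
      unfolding cell_char_def sum.reindex[OF A(2)]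
      by (simp add: at_m scaleR_conv_of_real algebra_simps)
    finally show ?thesis using int[OF j] by (simp add: prob_space)
  qed
  have swap: "(\<Sum>k\<in>A. u k * cell_dev \<theta> (m k) \<omega> + v k * cell_count (m k) \<omega>) = (\<Sum>j=1..n. \<psi> (X j \<omega>) (Y j \<omega>))" for \<omega>
    unfolding cell_dev_def cell_count_def \<psi>_def sum_distrib_left sum.distrib[symmetric]
    by (subst sum.swap) (auto intro!: sum.cong)
  have "expectation (\<lambda>\<omega>. iexp (\<Sum>k\<in>A. u k * cell_dev \<theta> (m k) \<omega> + v k * cell_count (m k) \<omega>))
      = expectation (\<lambda>\<omega>. \<Prod>j\<in>{1..n}. iexp (\<psi> (X j \<omega>) (Y j \<omega>)))"
    unfolding swap by (simp add: sum_distrib_left exp_sum)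
  also have "\<dots> = (\<Prod>j\<in>{1..n}. expectation (\<lambda>\<omega>. iexp (\<psi> (X j \<omega>) (Y j \<omega>))))"
    using indep_vars_compose2[OF indep_vars_sample \<psi>_meas] int
    by (intro indep_vars_lebesgue_integral) auto
  also have "\<dots> = cell_char m \<theta> u v A ^ n" using mean by simp
  finally show "expectation (\<lambda>\<omega>. iexp (\<Sum>k\<in>A. u k * cell_dev \<theta> (m k) \<omega> + v k * cell_count (m k) \<omega>)) = cell_char m \<theta> u v A ^ n" .
  have 1: "1 \<in> {1..n}" using n by simp
  have "norm (expectation (\<lambda>\<omega>. iexp (\<psi> (X 1 \<omega>) (Y 1 \<omega>)))) \<le> expectation (\<lambda>\<omega>. norm (iexp (\<psi> (X 1 \<omega>) (Y 1 \<omega>))))"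
    by (rule integral_norm_bound)
  then show "norm (cell_char m \<theta> u v A) \<le> 1" using mean[OF 1] by (simp add: prob_space)
qed

end

section \<open>Continuity theorem in several dimensions\<close>

text \<open>Linear combinations of the exponentials whose means are the characteristic functions,
  with arbitrary real frequencies. They form an algebra, which is what the Stone-Weierstrass theorem
  requires.\<close>

inductive trig_poly :: "'i set \<Rightarrow> (('i \<Rightarrow> real) \<Rightarrow> complex) \<Rightarrow> bool" for I where
  trig_poly_base: "trig_poly I (\<lambda>v. a * iexp (\<Sum>i\<in>I. t i * v i))"
| trig_poly_add: "trig_poly I p \<Longrightarrow> trig_poly I q \<Longrightarrow> trig_poly I (\<lambda>v. p v + q v)"

lemma trig_poly_mult:
  assumes "trig_poly I p" "trig_poly I q"
  shows "trig_poly I (\<lambda>v. p v * q v)"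
  using assms
proof (induction p rule: trig_poly.induct)
  case (trig_poly_base a t)
  from trig_poly_base show ?case
  proof (induction q rule: trig_poly.induct)
    case (trig_poly_base b s)
    have "(\<lambda>v. a * iexp (\<Sum>i\<in>I. t i * v i) * (b * iexp (\<Sum>i\<in>I. s i * v i)))
        = (\<lambda>v. (a * b) * iexp (\<Sum>i\<in>I. (t i + s i) * v i))"
      by (simp add: fun_eq_iff distrib_right sum.distrib exp_add distrib_left)
    then show ?case using trig_poly.trig_poly_base[of I "a * b" "\<lambda>i. t i + s i"] by simp
  next
    case (trig_poly_add p q)
    then show ?case using trig_poly.trig_poly_add by (simp add: distrib_left)
  qed
next
  case (trig_poly_add p q)
  then show ?case using trig_poly.trig_poly_add by (simp add: distrib_right)
qed

lemma trig_poly_const: "trig_poly I (\<lambda>_. a)"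
  using trig_poly_base[of I a "\<lambda>_. 0"] by simp

lemma trig_poly_sin:
  assumes "finite I" "i \<in> I"
  shows "trig_poly I (\<lambda>v. complex_of_real (sin (\<theta> * v i)))"
proof -
  have e: "(\<Sum>j\<in>I. (if j = i then s else 0) * v j) = s * v i" for s and v :: "'a \<Rightarrow> real"
    using assms by (simp add: if_distrib[of "\<lambda>x. x * _"] sum.delta cong: if_cong)
  have "trig_poly I (\<lambda>v. (- \<i> / 2) * iexp (\<Sum>j\<in>I. (if j = i then \<theta> else 0) * v j)
      + (\<i> / 2) * iexp (\<Sum>j\<in>I. (if j = i then - \<theta> else 0) * v j))"
    by (intro trig_poly_add trig_poly_base)
  moreover have "(- \<i> / 2) * iexp (\<theta> * v i) + (\<i> / 2) * iexp (- \<theta> * v i) = complex_of_real (sin (\<theta> * v i))" for v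
    by (simp add: sin_of_real[symmetric] sin_exp_eq divide_simps) (simp add: algebra_simps)
  ultimately show ?thesis unfolding e by simp
qed

lemma trig_poly_continuous:
  assumes "trig_poly I p" shows "continuous_on UNIV p"
  using assms by induction (auto intro!: continuous_intros continuous_on_product_coordinates)

lemma trig_poly_expectation:
  fixes Z :: "nat \<Rightarrow> 'i::countable \<Rightarrow> 'a \<Rightarrow> real" and Z' :: "'i \<Rightarrow> 'b \<Rightarrow> real"
  assumes M: "\<And>n. prob_space (M n)" "prob_space M'"
    and Z[measurable]: "\<And>n i. Z n i \<in> borel_measurable (M n)" "\<And>i. Z' i \<in> borel_measurable M'"
    and char: "\<And>t. (\<lambda>n. \<integral>\<omega>. iexp (\<Sum>i\<in>I. t i * Z n i \<omega>) \<partial>M n) \<longlonglongrightarrow> (\<integral>\<omega>. iexp (\<Sum>i\<in>I. t i * Z' i \<omega>) \<partial>M')"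
    and p: "trig_poly I p"
  shows "(\<forall>n. integrable (M n) (\<lambda>\<omega>. p (\<lambda>i. Z n i \<omega>))) \<and> integrable M' (\<lambda>\<omega>. p (\<lambda>i. Z' i \<omega>)) \<and>
    (\<lambda>n. \<integral>\<omega>. p (\<lambda>i. Z n i \<omega>) \<partial>M n) \<longlonglongrightarrow> (\<integral>\<omega>. p (\<lambda>i. Z' i \<omega>) \<partial>M')"
  using p
proof induction
  case (trig_poly_base a t)
  have int: "integrable N (\<lambda>\<omega>. a * iexp (\<Sum>i\<in>I. t i * Y i \<omega>))"
    if "prob_space N" "\<And>i. Y i \<in> borel_measurable N" for N :: "'x measure" and Y
  proof -
    interpret prob_space N by fact
    note that(2)[measurable]
    show ?thesis by (intro integrable_const_bound[of _ "norm a"]) (auto simp: norm_mult)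
  qed
  show ?case
    using int[OF M(1) Z(1)] int[OF M(2) Z(2)] char[of t] by (auto intro!: tendsto_intros)
next
  case (trig_poly_add p q)
  then show ?case by (auto intro!: tendsto_intros)
qed

text \<open>The one-dimensional continuity theorem gives weak convergence of each coordinate; a
  continuous cutoff then bounds the tails for all large \<open>n\<close> at the same level as in the
  limit.\<close>

lemma char_convergence_tight:
  fixes M :: "nat \<Rightarrow> 'a measure" and Y :: "nat \<Rightarrow> 'a \<Rightarrow> real" and Y' :: "'b \<Rightarrow> real"
  assumes M: "\<And>n. prob_space (M n)" "prob_space M'"
    and Y[measurable]: "\<And>n. Y n \<in> borel_measurable (M n)" "Y' \<in> borel_measurable M'"
    and char: "\<And>t. (\<lambda>n. \<integral>\<omega>. iexp (t * Y n \<omega>) \<partial>M n) \<longlonglongrightarrow> (\<integral>\<omega>. iexp (t * Y' \<omega>) \<partial>M')"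
    and e: "0 < e"
  obtains L where "0 < L" "\<forall>\<^sub>F n in sequentially. measure (M n) {\<omega> \<in> space (M n). L < \<bar>Y n \<omega>\<bar>} < e"
    "measure M' {\<omega> \<in> space M'. L < \<bar>Y' \<omega>\<bar>} < e"
proof -
  interpret M: prob_space "M n" for n by fact
  interpret M': prob_space M' by fact
  have rd: "real_distribution (distr (M n) borel (Y n))" "real_distribution (distr M' borel Y')" for n
    by (auto intro: M.real_distribution_distr M'.real_distribution_distr)
  have wc: "weak_conv_m (\<lambda>n. distr (M n) borel (Y n)) (distr M' borel Y')"
    by (rule levy_continuity[OF rd]) (use char in \<open>simp add: char_def integral_distr\<close>)
  \<comment> \<open>A ramp from 0 at \<bar>x\<bar> = l to 1 at \<bar>x\<bar> = l + 1, so it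
    dominates the indicator of \<bar>x\<bar> > l + 1.\<close>
  define \<phi> where "\<phi> l x = min 1 (max 0 (\<bar>x\<bar> - l))" for l x :: real
  have \<phi>_cont: "isCont (\<phi> l) x" for l x unfolding \<phi>_def by (intro continuous_intros)
  have [measurable]: "\<phi> l \<in> borel_measurable borel" for l unfolding \<phi>_def by measurable
  have \<phi>_bd: "\<bar>\<phi> l x\<bar> \<le> 1" for l x by (auto simp: \<phi>_def)
  have conv: "(\<lambda>n. \<integral>\<omega>. \<phi> l (Y n \<omega>) \<partial>M n) \<longlonglongrightarrow> (\<integral>\<omega>. \<phi> l (Y' \<omega>) \<partial>M')" for l
    using weak_conv_imp_integral_bdd_continuous_conv[OF rd wc, of "\<phi> l" 1] \<phi>_cont \<phi>_bd
    by (simp add: integral_distr)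
  have "(\<lambda>l::nat. \<integral>\<omega>. \<phi> (real l) (Y' \<omega>) \<partial>M') \<longlonglongrightarrow> (\<integral>\<omega>. 0 \<partial>M')"
  proof (rule integral_dominated_convergence[where w = "\<lambda>_. 1"])
    show "AE \<omega> in M'. (\<lambda>l. \<phi> (real l) (Y' \<omega>)) \<longlonglongrightarrow> 0"
    proof (intro AE_I2 tendsto_eventually)
      fix \<omega>
      show "\<forall>\<^sub>F l in sequentially. \<phi> (real l) (Y' \<omega>) = 0"
        using eventually_ge_at_top[of "nat \<lceil>\<bar>Y' \<omega>\<bar>\<rceil>"]
        by eventually_elim (auto simp: \<phi>_def nat_le_iff ceiling_le_iff)
    qed
  qed (use \<phi>_bd in auto)
  then have "\<forall>\<^sub>F l::nat in sequentially. (\<integral>\<omega>. \<phi> (real l) (Y' \<omega>) \<partial>M') < e"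
    using e by (auto dest: order_tendstoD(2))
  then obtain l :: nat where l: "(\<integral>\<omega>. \<phi> (real l) (Y' \<omega>) \<partial>M') < e"
    by (auto simp: eventually_sequentially)
  have bound: "measure N {\<omega> \<in> space N. real l + 1 < \<bar>X \<omega>\<bar>} \<le> (\<integral>\<omega>. \<phi> (real l) (X \<omega>) \<partial>N)"
    if "prob_space N" and X[measurable]: "X \<in> borel_measurable N" for N :: "'x measure" and X
  proof -
    interpret prob_space N by fact
    have "measure N {\<omega> \<in> space N. real l + 1 < \<bar>X \<omega>\<bar>} = (\<integral>\<omega>. indicator {\<omega> \<in> space N. real l + 1 < \<bar>X \<omega>\<bar>} \<omega> \<partial>N)"
      by simp
    also have "\<dots> \<le> (\<integral>\<omega>. \<phi> (real l) (X \<omega>) \<partial>N)"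
      using \<phi>_bd by (intro integral_mono integrable_const_bound[of _ 1])
        (auto simp: \<phi>_def split: split_indicator)
    finally show ?thesis .
  qed
  show thesis
  proof (rule that[of "real l + 1"])
    show "\<forall>\<^sub>F n in sequentially. measure (M n) {\<omega> \<in> space (M n). real l + 1 < \<bar>Y n \<omega>\<bar>} < e"
      using order_tendstoD(2)[OF conv l]
      by eventually_elim (use bound[OF M(1) Y(1)] in \<open>auto intro: order.strict_trans1\<close>)
    show "measure M' {\<omega> \<in> space M'. real l + 1 < \<bar>Y' \<omega>\<bar>} < e"
      using bound[OF M(2) Y(2)] l by simp
  qed simp
qed

text \<open>
  Polynomials in the functions \<open>sin (\<pi> v i / 2 L)\<close> approximate \<open>h\<close> uniformly on the cube of half
  width \<open>L\<close>, and they are bounded everywhere by their bound on the cube.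
\<close>

lemma sin_approximation:
  fixes h :: "('i::countable \<Rightarrow> real) \<Rightarrow> real"
  assumes I: "finite I" and L: "0 < L" and h: "continuous_on UNIV h" and B: "\<And>v. \<bar>h v\<bar> \<le> B" and e: "0 < e"
  obtains q where "trig_poly I (\<lambda>v. complex_of_real (q v))"
    "\<And>v. (\<And>i. i \<in> I \<Longrightarrow> \<bar>v i\<bar> \<le> L) \<Longrightarrow> (\<And>i. i \<notin> I \<Longrightarrow> v i = 0) \<Longrightarrow> \<bar>h v - q v\<bar> < e"
    "\<And>v. \<bar>q v\<bar> \<le> B + e"
proof -
  \<comment> \<open>Coordinates outside \<open>I\<close> are pinned to 0. The cube is then compact
    in the product topology, and its points are separated by the coordinates in
    \<open>I\<close>.\<close>
  define K where "K = PiE UNIV (\<lambda>i. if i \<in> I then {- L..L} else {0::real})"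
  have K: "v \<in> K \<longleftrightarrow> (\<forall>i. if i \<in> I then \<bar>v i\<bar> \<le> L else v i = 0)" for v
    by (auto simp: K_def PiE_def Pi_def abs_le_iff minus_le_iff split: if_splits)
  have "compactin (product_topology (\<lambda>i. euclidean) UNIV) K"
    unfolding K_def by (subst compactin_PiE) auto
  then have "compact K" by (simp add: euclidean_product_topology)
  \<comment> \<open>With this frequency the cube corresponds to the interval from -pi/2 to pi/2,
    where the sine is injective.\<close>
  define \<theta> where "\<theta> = pi / (2 * L)"
  \<comment> \<open>The second clause says that \<open>q\<close> sees \<open>v\<close> only through
    the sines. It survives sums and products and is what carries the bound from the cube to the
    whole space.\<close>
  define P where "P q \<longleftrightarrow> trig_poly I (\<lambda>v. complex_of_real (q v)) \<and>
    (\<forall>v w. (\<forall>i\<in>I. sin (\<theta> * v i) = sin (\<theta> * w i)) \<longrightarrow> q v = q w)" for q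
  have range: "\<theta> * x \<in> {- (pi / 2)..pi / 2}" if "\<bar>x\<bar> \<le> L" for x
  proof -
    have "0 < \<theta>" using L by (simp add: \<theta>_def)
    then have "\<bar>\<theta> * x\<bar> \<le> \<theta> * L" using that by (simp add: abs_mult)
    also have "\<theta> * L = pi / 2" using L by (simp add: \<theta>_def)
    finally show ?thesis by (auto simp: abs_le_iff)
  qed
  have "\<exists>q. P q \<and> (\<forall>v\<in>K. \<bar>h v - q v\<bar> < e)"
  proof (rule Stone_Weierstrass_HOL[OF \<open>compact K\<close>])
    show "continuous_on K f" if "P f" for f
    proof -
      have "continuous_on UNIV (\<lambda>v. Re (complex_of_real (f v)))"
        using that by (intro continuous_on_Re trig_poly_continuous[of I]) (auto simp: P_def)
      then show ?thesis by (auto intro: continuous_on_subset)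
    qed
    show "P (\<lambda>x. f x + g x)" if "P f \<and> P g" for f g
      using that trig_poly_add unfolding P_def by fastforce
    show "P (\<lambda>x. f x * g x)" if "P f \<and> P g" for f g
      using that trig_poly_mult unfolding P_def by fastforce
    show "P (\<lambda>_. c)" for c using trig_poly_const by (simp add: P_def)
    show "\<exists>f. P f \<and> f v \<noteq> f w" if vw: "v \<in> K \<and> w \<in> K \<and> v \<noteq> w" for v w
    proof -
      obtain i where i: "v i \<noteq> w i" using vw by (auto simp: fun_eq_iff)
      have "i \<notin> I \<longrightarrow> v i = 0" "i \<notin> I \<longrightarrow> w i = 0" using vw unfolding K by metis+
      with i have iI: "i \<in> I" by auto
      have "P (\<lambda>v. sin (\<theta> * v i))" using trig_poly_sin[OF I iI] iI by (auto simp: P_def)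
      moreover have "sin (\<theta> * v i) \<noteq> sin (\<theta> * w i)"
      proof
        assume "sin (\<theta> * v i) = sin (\<theta> * w i)"
        moreover have "\<bar>v i\<bar> \<le> L" "\<bar>w i\<bar> \<le> L" using vw iI K by metis+
        ultimately have "\<theta> * v i = \<theta> * w i"
          using range[of "v i"] range[of "w i"] unfolding atLeastAtMost_iff by (metis sin_inj_pi)
        then show False using i L by (simp add: \<theta>_def)
      qed
      ultimately show ?thesis by blast
    qed
    show "continuous_on K h" using h by (rule continuous_on_subset) simp
  qed fact
  then obtain q where q: "P q" "\<And>v. v \<in> K \<Longrightarrow> \<bar>h v - q v\<bar> < e" by blast
  show thesis
  proof (rule that[of q])
    show "trig_poly I (\<lambda>v. complex_of_real (q v))" using q by (simp add: P_def)
    show "\<bar>h v - q v\<bar> < e" if "\<And>i. i \<in> I \<Longrightarrow> \<bar>v i\<bar> \<le> L" "\<And>i. i \<notin> I \<Longrightarrow> v i = 0" for v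
      using that by (intro q) (auto simp: K)
    show "\<bar>q v\<bar> \<le> B + e" for v
    proof -
      \<comment> \<open>The argument is folded into the cube without changing the sines of its
        coordinates in \<open>I\<close>, hence without changing \<open>q\<close>.\<close>
      define w where "w i = (if i \<in> I then arcsin (sin (\<theta> * v i)) / \<theta> else 0)" for i
      have \<theta>: "0 < \<theta>" using L by (simp add: \<theta>_def)
      have "\<bar>arcsin (sin y)\<bar> / \<theta> \<le> L" for y
      proof -
        have "\<bar>arcsin (sin y)\<bar> \<le> pi / 2" using arcsin_bounded[of "sin y"] by (auto simp: abs_le_iff)
        also have "pi / 2 = \<theta> * L" using L by (simp add: \<theta>_def)
        finally show ?thesis using \<theta> by (simp add: field_simps)
      qed
      then have "w \<in> K" using \<theta> by (auto simp: K w_def)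
      moreover have "q v = q w"
        using q(1) \<theta> unfolding P_def by (auto simp: w_def)
      ultimately show ?thesis using q(2)[of w] B[of w] by simp
    qed
  qed
qed

text \<open>A trigonometric polynomial replaces \<open>h\<close> on a cube outside of which all laws
  have small mass. There the two differ by at most 2 B + 1, thanks to the global bound on the
  polynomial.\<close>

theorem multivariate_levy_continuity:
  fixes Z :: "nat \<Rightarrow> 'i::countable \<Rightarrow> 'a \<Rightarrow> real" and Z' :: "'i \<Rightarrow> 'b \<Rightarrow> real"
  assumes I: "finite I"
    and M: "\<And>n. prob_space (M n)" "prob_space M'"
    and Z: "\<And>n i. Z n i \<in> borel_measurable (M n)" "\<And>i. Z' i \<in> borel_measurable M'"
    and outside: "\<And>n i \<omega>. i \<notin> I \<Longrightarrow> Z n i \<omega> = 0" "\<And>i \<omega>. i \<notin> I \<Longrightarrow> Z' i \<omega> = 0"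
    and char: "\<And>t. (\<lambda>n. \<integral>\<omega>. iexp (\<Sum>i\<in>I. t i * Z n i \<omega>) \<partial>M n) \<longlonglongrightarrow> (\<integral>\<omega>. iexp (\<Sum>i\<in>I. t i * Z' i \<omega>) \<partial>M')"
    and h: "continuous_on UNIV h" and B: "\<And>v. \<bar>h v\<bar> \<le> (B::real)"
  shows "(\<lambda>n. \<integral>\<omega>. h (\<lambda>i. Z n i \<omega>) \<partial>M n) \<longlonglongrightarrow> (\<integral>\<omega>. h (\<lambda>i. Z' i \<omega>) \<partial>M')"
proof (rule tendstoI)
  note Z[measurable]
  have B0: "0 \<le> B" using B abs_ge_zero order_trans by blast
  fix r :: real assume r: "0 < r"
  \<comment> \<open>The total error is 2 (e + (2 B + 1) e) + e = e (5 + 4 B): one approximation for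
    each of the two laws, plus the convergence for the polynomial.\<close>
  define e where "e = min 1 (r / (2 * (5 + 4 * B)))"
  have e: "0 < e" "e \<le> 1" "e * (5 + 4 * B) < r"
  proof -
    show "0 < e" "e \<le> 1" using r B0 by (auto simp: e_def)
    have "e * (5 + 4 * B) \<le> r / (2 * (5 + 4 * B)) * (5 + 4 * B)"
      using B0 by (intro mult_right_mono) (auto simp: e_def)
    also have "\<dots> = r / 2" using B0 by (simp add: divide_simps)
    finally show "e * (5 + 4 * B) < r" using r by simp
  qed
  have "\<exists>L>0. (\<forall>\<^sub>F n in sequentially. measure (M n) {\<omega> \<in> space (M n). L < \<bar>Z n i \<omega>\<bar>} < e / (card I + 1))
      \<and> measure M' {\<omega> \<in> space M'. L < \<bar>Z' i \<omega>\<bar>} < e / (card I + 1)" if i: "i \<in> I" for i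
  proof -
    have s: "(\<Sum>j\<in>I. (if j = i then s else 0) * v j) = s * v i" for s and v :: "'i \<Rightarrow> real"
      using I i by (simp add: if_distrib[of "\<lambda>x. x * _"] sum.delta cong: if_cong)
    have "(\<lambda>n. \<integral>\<omega>. iexp (t * Z n i \<omega>) \<partial>M n) \<longlonglongrightarrow> (\<integral>\<omega>. iexp (t * Z' i \<omega>) \<partial>M')" for t
      using char[of "\<lambda>j. if j = i then t else 0"] unfolding s .
    note tight = char_convergence_tight[OF M Z this]
    have "0 < e / (card I + 1)" using e(1) by simp
    from tight[OF this] show ?thesis by blast
  qed
  then have "\<forall>i\<in>I. \<exists>L. 0 < L \<and> (\<forall>\<^sub>F n in sequentially. measure (M n) {\<omega> \<in> space (M n). L < \<bar>Z n i \<omega>\<bar>} < e / (card I + 1))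
      \<and> measure M' {\<omega> \<in> space M'. L < \<bar>Z' i \<omega>\<bar>} < e / (card I + 1)" by blast
  from bchoice[OF this] obtain l where l: "\<And>i. i \<in> I \<Longrightarrow> 0 < l i"
    "\<And>i. i \<in> I \<Longrightarrow> \<forall>\<^sub>F n in sequentially. measure (M n) {\<omega> \<in> space (M n). l i < \<bar>Z n i \<omega>\<bar>} < e / (card I + 1)"
    "\<And>i. i \<in> I \<Longrightarrow> measure M' {\<omega> \<in> space M'. l i < \<bar>Z' i \<omega>\<bar>} < e / (card I + 1)"
    by blast
  \<comment> \<open>A single half width above all coordinate levels; the summand 1 keeps it positive
    when \<open>I\<close> is empty.\<close>
  define L where "L = 1 + (\<Sum>i\<in>I. l i)"
  have L: "0 < L" unfolding L_def using l(1) by (intro add_pos_nonneg sum_nonneg) (auto simp: less_imp_le)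
  have lL: "l i \<le> L" if "i \<in> I" for i
  proof -
    have "l i \<le> (\<Sum>i\<in>I. l i)" using that l(1) I by (intro member_le_sum) (auto simp: less_imp_le)
    then show ?thesis by (simp add: L_def)
  qed
  obtain q where q: "trig_poly I (\<lambda>v. complex_of_real (q v))"
    "\<And>v. (\<And>i. i \<in> I \<Longrightarrow> \<bar>v i\<bar> \<le> L) \<Longrightarrow> (\<And>i. i \<notin> I \<Longrightarrow> v i = 0) \<Longrightarrow> \<bar>h v - q v\<bar> < e"
    "\<And>v. \<bar>q v\<bar> \<le> B + e"
    using sin_approximation[OF I L h B e(1)] by metis
  have [measurable]: "h \<in> borel_measurable borel" by (rule borel_measurable_continuous_onI[OF h])
  have "continuous_on UNIV (\<lambda>v. Re (complex_of_real (q v)))"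
    using q(1) by (intro continuous_on_Re trig_poly_continuous)
  then have [measurable]: "q \<in> borel_measurable borel" by (intro borel_measurable_continuous_onI) simp
  have q_conv: "(\<lambda>n. \<integral>\<omega>. q (\<lambda>i. Z n i \<omega>) \<partial>M n) \<longlonglongrightarrow> (\<integral>\<omega>. q (\<lambda>i. Z' i \<omega>) \<partial>M')"
    using trig_poly_expectation[OF M Z char q(1)] by (simp add: tendsto_of_real_iff)
  have diff: "\<bar>(\<integral>\<omega>. h (\<lambda>i. Y i \<omega>) \<partial>N) - (\<integral>\<omega>. q (\<lambda>i. Y i \<omega>) \<partial>N)\<bar> \<le> e + (2 * B + 1) * e"
    if N: "prob_space N" and Y[measurable]: "\<And>i. Y i \<in> borel_measurable N"
      and out: "\<And>i \<omega>. i \<notin> I \<Longrightarrow> Y i \<omega> = 0"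
      and small: "\<And>i. i \<in> I \<Longrightarrow> measure N {\<omega> \<in> space N. l i < \<bar>Y i \<omega>\<bar>} < e / (card I + 1)"
    for N :: "'x measure" and Y :: "'i \<Rightarrow> 'x \<Rightarrow> real"
  proof -
    interpret prob_space N by fact
    have [measurable]: "(\<lambda>\<omega>. \<lambda>i. Y i \<omega>) \<in> borel_measurable N"
      by (intro measurable_coordinatewise_then_product Y)
    have hq: "integrable N (\<lambda>\<omega>. h (\<lambda>i. Y i \<omega>))" "integrable N (\<lambda>\<omega>. q (\<lambda>i. Y i \<omega>))"
      using B q(3) by (auto intro!: integrable_const_bound[of _ "B + e"] AE_I2 order_trans[OF B] less_imp_le[OF e(1)])
    define A where "A = (\<Union>i\<in>I. {\<omega> \<in> space N. l i < \<bar>Y i \<omega>\<bar>})"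
    have A[measurable]: "A \<in> sets N" unfolding A_def using I by measurable
    have "measure N A \<le> (\<Sum>i\<in>I. measure N {\<omega> \<in> space N. l i < \<bar>Y i \<omega>\<bar>})"
      unfolding A_def using I by (intro finite_measure_subadditive_finite) auto
    also have "\<dots> \<le> (\<Sum>i\<in>I. e / (card I + 1))" using small by (intro sum_mono) (auto simp: less_imp_le)
    also have "\<dots> \<le> e" using e(1) by (simp add: field_simps)
    finally have A_small: "measure N A \<le> e" .
    have ind: "integrable N (indicator A :: 'x \<Rightarrow> real)"
      by (rule integrable_real_indicator) (auto simp: less_top[symmetric])
    have "\<bar>(\<integral>\<omega>. h (\<lambda>i. Y i \<omega>) \<partial>N) - (\<integral>\<omega>. q (\<lambda>i. Y i \<omega>) \<partial>N)\<bar>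
        = \<bar>\<integral>\<omega>. h (\<lambda>i. Y i \<omega>) - q (\<lambda>i. Y i \<omega>) \<partial>N\<bar>" using hq by simp
    also have "\<dots> \<le> (\<integral>\<omega>. e + (2 * B + 1) * indicator A \<omega> \<partial>N)"
    proof (rule integral_abs_bound[THEN order_trans], rule integral_mono)
      show "integrable N (\<lambda>\<omega>. e + (2 * B + 1) * indicator A \<omega>)"
        using ind by (intro Bochner_Integration.integrable_add integrable_const integrable_mult_right)
      show "integrable N (\<lambda>\<omega>. \<bar>h (\<lambda>i. Y i \<omega>) - q (\<lambda>i. Y i \<omega>)\<bar>)" using hq by simp
      fix \<omega> assume \<omega>: "\<omega> \<in> space N"
      show "\<bar>h (\<lambda>i. Y i \<omega>) - q (\<lambda>i. Y i \<omega>)\<bar> \<le> e + (2 * B + 1) * indicator A \<omega>"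
      proof (cases "\<omega> \<in> A")
        case True
        then show ?thesis using B[of "\<lambda>i. Y i \<omega>"] q(3)[of "\<lambda>i. Y i \<omega>"] e by simp
      next
        case False
        then have "\<bar>Y i \<omega>\<bar> \<le> L" if "i \<in> I" for i
          using \<omega> that lL[OF that] by (force simp: A_def not_less)
        then show ?thesis using q(2)[of "\<lambda>i. Y i \<omega>"] out False by (simp add: less_imp_le)
      qed
    qed
    also have "\<dots> = e + (2 * B + 1) * measure N A"
      using ind by (subst Bochner_Integration.integral_add) (auto simp: prob_space)
    also have "\<dots> \<le> e + (2 * B + 1) * e" using A_small B0 by (intro add_left_mono mult_left_mono) auto
    finally show ?thesis .
  qed
  have "\<forall>\<^sub>F n in sequentially. \<forall>i\<in>I. measure (M n) {\<omega> \<in> space (M n). l i < \<bar>Z n i \<omega>\<bar>} < e / (card I + 1)"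
    using l(2) I by (intro eventually_ball_finite) auto
  moreover have "\<forall>\<^sub>F n in sequentially. dist (\<integral>\<omega>. q (\<lambda>i. Z n i \<omega>) \<partial>M n) (\<integral>\<omega>. q (\<lambda>i. Z' i \<omega>) \<partial>M') < e"
    by (rule tendstoD[OF q_conv e(1)])
  ultimately show "\<forall>\<^sub>F n in sequentially. dist (\<integral>\<omega>. h (\<lambda>i. Z n i \<omega>) \<partial>M n) (\<integral>\<omega>. h (\<lambda>i. Z' i \<omega>) \<partial>M') < r"
  proof eventually_elim
    case (elim n)
    have key: "\<bar>x - y'\<bar> < 2 * s + e" if "\<bar>x - y\<bar> \<le> s" "\<bar>y' - x'\<bar> \<le> s" "\<bar>y - x'\<bar> < e" for x y x' y' s :: real
      using that by linarith
    have "\<bar>(\<integral>\<omega>. h (\<lambda>i. Z n i \<omega>) \<partial>M n) - (\<integral>\<omega>. h (\<lambda>i. Z' i \<omega>) \<partial>M')\<bar> < 2 * (e + (2 * B + 1) * e) + e"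
      by (rule key[OF diff[OF M(1) Z(1) outside(1)] diff[OF M(2) Z(2) outside(2) l(3)]])
        (use elim in \<open>auto simp: dist_real_def\<close>)
    also have "2 * (e + (2 * B + 1) * e) + e = e * (5 + 4 * B)" by (simp add: algebra_simps)
    finally show ?case using e(3) by (simp add: dist_real_def)
  qed
qed

section \<open>Brownian motion with drift\<close>

text \<open>Superlinear growth lets any line through a lattice point pass below all far points.
  Together with a global lower bound for \<open>p\<close>, the two lines can be put through the
  neighbours \<open>i\<close> and \<open>i - 1\<close> themselves.\<close>

lemma limit_slope_coercive:
  fixes p :: "int \<Rightarrow> real"
  assumes c: "0 < c" and growth: "\<And>B. \<exists>R0::nat. \<forall>k. int R0 \<le> \<bar>k\<bar> \<longrightarrow> B * real_of_int \<bar>k\<bar> \<le> p k"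
  shows "\<forall>\<^sub>F R in sequentially. gcm_left_slope (range (\<lambda>k::int. (c * of_int k, p k))) (c * of_int i)
    = maxmin_slope (int R) (\<lambda>k. c * of_int k) p i"
proof -
  obtain R0 :: nat where R0: "\<And>k. int R0 \<le> \<bar>k\<bar> \<Longrightarrow> 0 \<le> p k" using growth[of 0] by auto
  define C where "C = (\<Sum>k\<in>{- int R0..int R0}. \<bar>p k\<bar>)"
  have C: "- C \<le> p k" for k
  proof (cases "k \<in> {- int R0..int R0}")
    case True
    then have "\<bar>p k\<bar> \<le> C" unfolding C_def by (intro member_le_sum) auto
    then show ?thesis by linarith
  next
    case False
    then have "int R0 \<le> \<bar>k\<bar>" by auto
    moreover have "0 \<le> C" by (auto simp: C_def intro: sum_nonneg)
    ultimately show ?thesis using R0[of k] by simp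
  qed
  \<comment> \<open>Steep enough for the line through point \<open>i\<close> to fall to the global
    lower bound \<open>-C\<close> within one cell to the left; \<open>s1\<close> does the same to
    the right of \<open>i - 1\<close>.\<close>
  define s2 where "s2 = max 0 ((p i + C) / c)"
  define s1 where "s1 = - max 0 ((p (i - 1) + C) / c)"
  have s2: "0 \<le> s2" "p i + C \<le> s2 * c" and s1: "s1 \<le> 0" "p (i - 1) + C \<le> - s1 * c"
    using c by (auto simp: s2_def s1_def max_def field_simps)
  \<comment> \<open>For \<bar>k\<bar> \<ge> 1 either line is at most
    \<open>B * \<bar>k\<bar>\<close> at abscissa \<open>c * k\<close>.\<close>
  define B where "B = s2 * c + \<bar>p i\<bar> + s2 * c * \<bar>real_of_int i\<bar> + (- s1) * c + \<bar>p (i - 1)\<bar> + (- s1) * c * \<bar>real_of_int (i - 1)\<bar>"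
  obtain R1 :: nat where R1: "\<And>k. int R1 \<le> \<bar>k\<bar> \<Longrightarrow> B * real_of_int \<bar>k\<bar> \<le> p k" using growth[of B] by auto
  have tail: "p hi + s * (c * of_int k - c * of_int hi) \<le> p k"
    if k: "int R1 \<le> \<bar>k\<bar>" "k \<noteq> 0" and hi: "\<bar>s\<bar> * c + \<bar>p hi\<bar> + \<bar>s\<bar> * c * \<bar>real_of_int hi\<bar> \<le> B" for k s hi
  proof -
    have k1: "1 \<le> real_of_int \<bar>k\<bar>" using k(2) by linarith
    have "s * (c * of_int k) \<le> \<bar>s\<bar> * c * real_of_int \<bar>k\<bar>"
      using c abs_ge_self[of "s * (c * of_int k)"] by (simp add: abs_mult mult.assoc)
    moreover have "- (s * (c * of_int hi)) \<le> \<bar>s\<bar> * c * \<bar>real_of_int hi\<bar>"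
      using c abs_ge_minus_self[of "s * (c * of_int hi)"] by (simp add: abs_mult mult.assoc)
    ultimately have "p hi + s * (c * of_int k - c * of_int hi) \<le> \<bar>p hi\<bar> + \<bar>s\<bar> * c * real_of_int \<bar>k\<bar> + \<bar>s\<bar> * c * \<bar>real_of_int hi\<bar>"
      by (simp add: right_diff_distrib)
    also have "\<dots> \<le> \<bar>s\<bar> * c * real_of_int \<bar>k\<bar> + \<bar>p hi\<bar> * real_of_int \<bar>k\<bar> + \<bar>s\<bar> * c * \<bar>real_of_int hi\<bar> * real_of_int \<bar>k\<bar>"
      using mult_left_mono[OF k1, of "\<bar>p hi\<bar>"] mult_left_mono[OF k1, of "\<bar>s\<bar> * c * \<bar>real_of_int hi\<bar>"] c by simp
    also have "\<dots> = (\<bar>s\<bar> * c + \<bar>p hi\<bar> + \<bar>s\<bar> * c * \<bar>real_of_int hi\<bar>) * real_of_int \<bar>k\<bar>" by (simp add: algebra_simps)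
    also have "\<dots> \<le> B * real_of_int \<bar>k\<bar>" using hi k1 by (intro mult_right_mono) auto
    also have "\<dots> \<le> p k" using R1 k by simp
    finally show ?thesis .
  qed
  have B: "\<bar>s2\<bar> * c + \<bar>p i\<bar> + \<bar>s2\<bar> * c * \<bar>real_of_int i\<bar> \<le> B" "\<bar>s1\<bar> * c + \<bar>p (i - 1)\<bar> + \<bar>s1\<bar> * c * \<bar>real_of_int (i - 1)\<bar> \<le> B"
  proof -
    have "0 \<le> s2 * c" "0 \<le> s2 * c * \<bar>real_of_int i\<bar>" "0 \<le> (- s1) * c" "0 \<le> (- s1) * c * \<bar>real_of_int (i - 1)\<bar>"
      using s1(1) s2(1) c by (auto intro!: mult_nonneg_nonneg mult_nonpos_nonneg)
    then show "\<bar>s2\<bar> * c + \<bar>p i\<bar> + \<bar>s2\<bar> * c * \<bar>real_of_int i\<bar> \<le> B" "\<bar>s1\<bar> * c + \<bar>p (i - 1)\<bar> + \<bar>s1\<bar> * c * \<bar>real_of_int (i - 1)\<bar> \<le> B"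
      unfolding B_def abs_of_nonneg[OF s2(1)] abs_of_nonpos[OF s1(1)] by linarith+
  qed
  show ?thesis
    using eventually_ge_at_top[of "R1 + nat \<bar>i\<bar> + 1"]
  proof eventually_elim
    case (elim R)
    show ?case
    proof (rule gcm_left_slope_window[where lo = "i - 1" and hi = i and sl = s1 and sr = s2])
      show "strict_mono_on {- int R..int R} (\<lambda>k. c * of_int k)"
        using c by (auto simp: strict_mono_on_def)
      show "- int R \<le> i - 1" "i \<le> int R" using elim by linarith+
      show "(\<exists>k\<in>{- int R..int R}. u = c * of_int k \<and> v = p k) \<or>
          c * of_int i \<le> u \<and> p i + s2 * (u - c * of_int i) \<le> v \<or>
          u \<le> c * of_int (i - 1) \<and> p (i - 1) + s1 * (u - c * of_int (i - 1)) \<le> v"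
        if "(u, v) \<in> range (\<lambda>k::int. (c * of_int k, p k))" for u v
      proof -
        from that obtain k :: int where k: "u = c * of_int k" "v = p k" by auto
        consider "k \<in> {- int R..int R}" | "int R < k" | "k < - int R" by fastforce
        then show ?thesis
        proof cases
          case 1 then show ?thesis using k by blast
        next
          case 2
          then have "int R1 \<le> \<bar>k\<bar>" "k \<noteq> 0" "i \<le> k" using elim by linarith+
          then show ?thesis using tail[OF _ _ B(1)] k c by simp
        next
          case 3
          then have "int R1 \<le> \<bar>k\<bar>" "k \<noteq> 0" "k \<le> i - 1" using elim by linarith+
          then show ?thesis using tail[OF _ _ B(2)] k c by (auto simp del: of_int_diff)
        qed
      qed
      show "p i + s2 * (c * of_int k - c * of_int i) \<le> p k" if "k \<in> {- int R..<i}" for k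
      proof -
        have "real_of_int k \<le> of_int i - 1" using that by auto
        then have "s2 * c * (of_int k - of_int i) \<le> s2 * c * (- 1)" using s2 c by (intro mult_left_mono) auto
        then show ?thesis using s2(2) C[of k] by (simp add: algebra_simps)
      qed
      show "p (i - 1) + s1 * (c * of_int k - c * of_int (i - 1)) \<le> p k" if "k \<in> {i - 1<..int R}" for k
      proof -
        have "1 \<le> real_of_int k - of_int (i - 1)" using that by auto
        then have "s1 * c * (of_int k - of_int (i - 1)) \<le> s1 * c * 1"
          using s1 c by (intro mult_left_mono_neg) (auto simp: mult_nonpos_nonneg)
        then show ?thesis using s1(2) C[of k] by (simp add: algebra_simps)
      qed
    qed auto
  qed
qed

section \<open>Gaussian increments and growth of the Brownian path\<close>

lemma (in prob_space) normal_tail: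
  assumes \<sigma>: "0 < \<sigma>" and D: "distributed M lborel X (normal_density 0 \<sigma>)" and r: "0 < r"
  shows "prob {\<omega> \<in> space M. r \<le> \<bar>X \<omega>\<bar>} \<le> \<sigma>\<^sup>2 / r\<^sup>2"
proof -
  have X[measurable]: "X \<in> borel_measurable M" using distributed_measurable[OF D] by simp
  have "integrable lborel (\<lambda>x. normal_density 0 \<sigma> x * (x - 0) ^ 2)" using \<sigma> by (rule integrable_normal_moment)
  then have int: "integrable M (\<lambda>\<omega>. (X \<omega>)\<^sup>2)" using distributed_integrable[OF D, of "\<lambda>x. x\<^sup>2"] by simp
  have E: "expectation X = 0" using \<sigma> D by (rule normal_distributed_expectation)
  show ?thesis
    using Chebyshev_inequality[OF X int r] normal_distributed_variance[OF \<sigma> D] unfolding E by simp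
qed

lemma (in prob_space) normal_char:
  assumes \<sigma>: "0 < \<sigma>" and D: "distributed M lborel X (normal_density 0 \<sigma>)"
  shows "expectation (\<lambda>\<omega>. iexp (a * X \<omega>)) = exp (- complex_of_real (a\<^sup>2 * \<sigma>\<^sup>2 / 2))"
proof -
  have D': "distributed M lborel (\<lambda>\<omega>. (X \<omega> - 0) / \<sigma>) std_normal_density"
    using D by (subst (asm) normal_standard_normal_convert[OF \<sigma>])
  have m: "(\<lambda>\<omega>. (X \<omega> - 0) / \<sigma>) \<in> measurable M lborel" by (rule distributed_measurable[OF D'])
  have "expectation (\<lambda>\<omega>. iexp (a * X \<omega>)) = expectation (\<lambda>\<omega>. iexp ((a * \<sigma>) * ((X \<omega> - 0) / \<sigma>)))"
    using \<sigma> by simp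
  also have "\<dots> = char (distr M lborel (\<lambda>\<omega>. (X \<omega> - 0) / \<sigma>)) (a * \<sigma>)"
    unfolding char_def by (subst integral_distr[OF m]) auto
  also have "\<dots> = exp (- complex_of_real (a\<^sup>2 * \<sigma>\<^sup>2 / 2))"
    unfolding distributed_distr_eq_density[OF D'] char_std_normal_distribution
    by (simp add: exp_of_real[symmetric] power_mult_distrib)
  finally show ?thesis .
qed

locale brownian =
  fixes \<Omega> :: "'b measure" and W :: "real \<Rightarrow> 'b \<Rightarrow> real"
  assumes W: "two_sided_brownian_motion \<Omega> W"
begin

lemma W_props:
  "prob_space \<Omega>" "\<And>t. W t \<in> borel_measurable \<Omega>" "AE \<omega> in \<Omega>. W 0 \<omega> = 0"
  "\<And>s t. s < t \<Longrightarrow> distributed \<Omega> lborel (\<lambda>\<omega>. W t \<omega> - W s \<omega>) (normal_density 0 (sqrt (t - s)))"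
  "\<And>\<tau> k. strict_mono_on {..k::nat} \<tau> \<Longrightarrow>
        prob_space.indep_vars \<Omega> (\<lambda>_. borel) (\<lambda>i \<omega>. W (\<tau> (Suc i)) \<omega> - W (\<tau> i) \<omega>) {..<k}"
  using W unfolding two_sided_brownian_motion_def by auto

sublocale prob_space \<Omega> by (rule W_props)

text \<open>Chebyshev bounds the probability of exceeding e n^2 by variance c n over e^2 n^4, which
  is summable, so Borel-Cantelli applies. Such a crude bound is enough against a quadratic
  drift.\<close>

lemma AE_quadratic_bound:
  assumes c: "0 < c" and e: "0 < e"
  shows "AE \<omega> in \<Omega>. \<exists>R0::nat. \<forall>k::int. int R0 \<le> \<bar>k\<bar> \<longrightarrow> \<bar>W (c * of_int k) \<omega>\<bar> \<le> e * (of_int k)\<^sup>2"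
proof -
  note [measurable] = W_props(2)
  have tail: "prob {\<omega> \<in> space \<Omega>. e * (real n)\<^sup>2 \<le> \<bar>W t \<omega> - W s \<omega>\<bar>} \<le> c / e\<^sup>2 * inverse (real n ^ 2)"
    if "t - s = c * real n" "0 < n" for t s and n :: nat
  proof -
    have "s < t" using that c by (metis diff_gt_0_iff_gt mult_pos_pos of_nat_0_less_iff)
    then have "prob {\<omega> \<in> space \<Omega>. e * (real n)\<^sup>2 \<le> \<bar>W t \<omega> - W s \<omega>\<bar>} \<le> (sqrt (t - s))\<^sup>2 / (e * (real n)\<^sup>2)\<^sup>2"
      using e that by (intro normal_tail W_props) auto
    also have "\<dots> = c * real n / (e * (real n)\<^sup>2)\<^sup>2" using \<open>s < t\<close> that by simp
    also have "\<dots> = c / e\<^sup>2 * inverse (real n ^ 3)"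
      using that e by (simp add: field_simps power_numeral_reduce)
    also have "\<dots> \<le> c / e\<^sup>2 * inverse (real n ^ 2)"
      using that c e by (intro mult_left_mono le_imp_inverse_le power_increasing) auto
    finally show ?thesis .
  qed
  have summ: "summable (\<lambda>n. c / e\<^sup>2 * inverse (real n ^ 2))"
    by (intro summable_mult inverse_power_summable) simp
  have ae: "AE \<omega> in \<Omega>. \<forall>\<^sub>F n in sequentially. \<omega> \<in> space \<Omega> - {\<omega> \<in> space \<Omega>. e * (real n)\<^sup>2 \<le> \<bar>W (t n) \<omega> - W (s n) \<omega>\<bar>}"
    if "\<And>n. t n - s n = c * real n" for t s
  proof (rule borel_cantelli_AE1)
    show "{\<omega> \<in> space \<Omega>. e * (real n)\<^sup>2 \<le> \<bar>W (t n) \<omega> - W (s n) \<omega>\<bar>} \<in> events" for n by measurable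
    show "emeasure \<Omega> {\<omega> \<in> space \<Omega>. e * (real n)\<^sup>2 \<le> \<bar>W (t n) \<omega> - W (s n) \<omega>\<bar>} < \<infinity>" for n
      by (simp add: less_top[symmetric])
    show "summable (\<lambda>n. prob {\<omega> \<in> space \<Omega>. e * (real n)\<^sup>2 \<le> \<bar>W (t n) \<omega> - W (s n) \<omega>\<bar>})"
    proof (rule summable_comparison_test_ev[OF _ summ])
      show "\<forall>\<^sub>F n in sequentially. norm (prob {\<omega> \<in> space \<Omega>. e * (real n)\<^sup>2 \<le> \<bar>W (t n) \<omega> - W (s n) \<omega>\<bar>})
          \<le> c / e\<^sup>2 * inverse (real n ^ 2)"
        using eventually_gt_at_top[of 0] by eventually_elim (use tail that in simp)
    qed
  qed
  have "AE \<omega> in \<Omega>. \<forall>\<^sub>F n in sequentially. \<omega> \<in> space \<Omega> - {\<omega> \<in> space \<Omega>. e * (real n)\<^sup>2 \<le> \<bar>W (c * real n) \<omega> - W 0 \<omega>\<bar>}"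
    by (rule ae) simp
  moreover have "AE \<omega> in \<Omega>. \<forall>\<^sub>F n in sequentially. \<omega> \<in> space \<Omega> - {\<omega> \<in> space \<Omega>. e * (real n)\<^sup>2 \<le> \<bar>W 0 \<omega> - W (- (c * real n)) \<omega>\<bar>}"
    by (rule ae) simp
  ultimately show ?thesis using W_props(3)
  proof eventually_elim
    case (elim \<omega>)
    from eventually_conj[OF elim(1,2)] obtain R0 where R0: "\<And>n. R0 \<le> n \<Longrightarrow>
      \<bar>W (c * real n) \<omega>\<bar> \<le> e * (real n)\<^sup>2 \<and> \<bar>W (- (c * real n)) \<omega>\<bar> \<le> e * (real n)\<^sup>2"
      unfolding eventually_sequentially using elim(3) by fastforce
    show ?case
    proof (intro exI[of _ R0] allI impI)
      fix k :: int assume k: "int R0 \<le> \<bar>k\<bar>"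
      then have "R0 \<le> nat \<bar>k\<bar>" by simp
      from R0[OF this] show "\<bar>W (c * of_int k) \<omega>\<bar> \<le> e * (of_int k)\<^sup>2"
        by (cases "0 \<le> k") auto
    qed
  qed
qed

definition path :: "real \<Rightarrow> real \<Rightarrow> real \<Rightarrow> 'b \<Rightarrow> int \<Rightarrow> real" where
  "path c \<kappa>1 \<kappa>2 \<omega> k = \<kappa>1 * W (c * of_int k) \<omega> + \<kappa>2 * c\<^sup>2 * of_int k * (1 + of_int k)"

lemma AE_limit_slope_window:
  assumes c: "0 < c" and \<kappa>2: "0 < \<kappa>2"
  shows "AE \<omega> in \<Omega>. \<forall>i. \<forall>\<^sub>F R in sequentially. limit_slope c \<kappa>1 \<kappa>2 (\<lambda>t. W t \<omega>) i
    = maxmin_slope (int R) (\<lambda>k. c * of_int k) (path c \<kappa>1 \<kappa>2 \<omega>) i"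
proof -
  define D where "D = \<kappa>2 * c\<^sup>2"
  have D: "0 < D" using c \<kappa>2 by (simp add: D_def)
  \<comment> \<open>Chosen so that the Brownian term uses up at most half of the quadratic
    drift.\<close>
  define e where "e = D / (2 * (\<bar>\<kappa>1\<bar> + 1))"
  have e: "0 < e" "\<bar>\<kappa>1\<bar> * e \<le> D / 2" using D by (auto simp: e_def field_simps)
  show ?thesis
    using AE_quadratic_bound[OF c e(1)]
  proof eventually_elim
    case (elim \<omega>)
    then obtain R0 :: nat where R0: "\<And>k. int R0 \<le> \<bar>k\<bar> \<Longrightarrow> \<bar>W (c * of_int k) \<omega>\<bar> \<le> e * (of_int k)\<^sup>2" by blast
    have growth: "\<exists>R0::nat. \<forall>k. int R0 \<le> \<bar>k\<bar> \<longrightarrow> B * real_of_int \<bar>k\<bar> \<le> path c \<kappa>1 \<kappa>2 \<omega> k" for B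
    \<comment> \<open>From this index on, the remaining half D k^2 / 2 exceeds (\<bar>B\<bar> + D)
      \<bar>k\<bar>, where D \<bar>k\<bar> pays for the linear part of the drift k (1 + k).\<close>
    proof (intro exI[of _ "R0 + nat \<lceil>2 * (\<bar>B\<bar> / D + 1)\<rceil>"] allI impI)
      fix k :: int assume k: "int (R0 + nat \<lceil>2 * (\<bar>B\<bar> / D + 1)\<rceil>) \<le> \<bar>k\<bar>"
      then have "int R0 \<le> \<bar>k\<bar>" by linarith
      from R0[OF this] have "\<bar>\<kappa>1 * W (c * of_int k) \<omega>\<bar> \<le> \<bar>\<kappa>1\<bar> * (e * (of_int k)\<^sup>2)"
        unfolding abs_mult by (rule mult_left_mono) simp
      also have "\<dots> \<le> D / 2 * (of_int k)\<^sup>2" using mult_right_mono[OF e(2), of "(of_int k)\<^sup>2"] by (simp add: mult.assoc)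
      finally have w: "- (D / 2 * (of_int k)\<^sup>2) \<le> \<kappa>1 * W (c * of_int k) \<omega>" by linarith
      have "2 * (\<bar>B\<bar> / D + 1) \<le> real_of_int \<bar>k\<bar>" using k by linarith
      then have "D / 2 * (2 * (\<bar>B\<bar> / D + 1)) \<le> D / 2 * real_of_int \<bar>k\<bar>" using D by (intro mult_left_mono) auto
      then have "\<bar>B\<bar> + D \<le> D / 2 * real_of_int \<bar>k\<bar>" using D by (simp add: distrib_left)
      then have "(\<bar>B\<bar> + D) * real_of_int \<bar>k\<bar> \<le> D / 2 * real_of_int \<bar>k\<bar> * real_of_int \<bar>k\<bar>" by (rule mult_right_mono) simp
      also have "\<dots> = D / 2 * (of_int k)\<^sup>2" by (simp add: power2_eq_square)
      finally have "(\<bar>B\<bar> + D) * real_of_int \<bar>k\<bar> \<le> D / 2 * (of_int k)\<^sup>2" .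
      moreover have "B * real_of_int \<bar>k\<bar> \<le> \<bar>B\<bar> * real_of_int \<bar>k\<bar>" by (intro mult_right_mono) auto
      moreover have "D * of_int k * (1 + of_int k) \<ge> D * (of_int k)\<^sup>2 - D * real_of_int \<bar>k\<bar>"
      proof -
        have "D * - real_of_int \<bar>k\<bar> \<le> D * of_int k" using D by (intro mult_left_mono) auto
        then show ?thesis by (simp add: power2_eq_square algebra_simps)
      qed
      ultimately show "B * real_of_int \<bar>k\<bar> \<le> path c \<kappa>1 \<kappa>2 \<omega> k"
        using w unfolding path_def D_def[symmetric] by (simp add: distrib_right)
    qed
    show ?case
      using limit_slope_coercive[OF c growth] unfolding limit_slope_def limit_point_def path_def by blast
  qed
qed

text \<open>Independence of increments is given along increasing sequences of times indexed by
  naturals, hence the shift of the lattice by \<open>R\<close>.\<close>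

lemma increments_char:
  assumes c: "0 < c"
  shows "expectation (\<lambda>\<omega>. iexp (\<Sum>k\<in>{- int R + 1..int R}. a k * (W (c * of_int k) \<omega> - W (c * of_int (k - 1)) \<omega>)))
    = exp (- complex_of_real (\<Sum>k\<in>{- int R + 1..int R}. (a k)\<^sup>2 * c / 2))"
proof -
  note [measurable] = W_props(2)
  define \<tau> where "\<tau> i = c * of_int (int i - int R)" for i
  define k where "k i = int i - int R + 1" for i
  have bij: "bij_betw k {..<2 * R} {- int R + 1..int R}"
    by (rule bij_betwI[of _ _ _ "\<lambda>k. nat (k + int R - 1)"]) (auto simp: k_def)
  have \<tau>: "\<tau> (Suc i) = c * of_int (k i)" "\<tau> i = c * of_int (k i - 1)" for i
    by (simp_all add: \<tau>_def k_def algebra_simps)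
  have mono: "strict_mono_on {..2 * R} \<tau>" using c by (auto simp: strict_mono_on_def \<tau>_def)
  let ?D = "\<lambda>i \<omega>. W (\<tau> (Suc i)) \<omega> - W (\<tau> i) \<omega>"
  have indep: "indep_vars (\<lambda>_. borel) (\<lambda>i \<omega>. iexp (a (k i) * ?D i \<omega>)) {..<2 * R}"
    by (rule indep_vars_compose2[OF W_props(5)[OF mono], where Y = "\<lambda>i x. iexp (a (k i) * x)"]) measurable
  have one: "expectation (\<lambda>\<omega>. iexp (a (k i) * ?D i \<omega>)) = exp (- complex_of_real ((a (k i))\<^sup>2 * c / 2))" for i
  proof -
    have d: "\<tau> (Suc i) - \<tau> i = c" by (simp add: \<tau>_def algebra_simps)
    then have "distributed \<Omega> lborel (?D i) (normal_density 0 (sqrt c))"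
      using W_props(4)[of "\<tau> i" "\<tau> (Suc i)"] c by simp
    from normal_char[OF _ this, of "a (k i)"] show ?thesis using c by simp
  qed
  have D: "?D i \<omega> = W (c * of_int (k i)) \<omega> - W (c * of_int (k i - 1)) \<omega>" for i \<omega>
    unfolding \<tau>(1)[of i] \<tau>(2)[of i] ..
  have "(\<Sum>k\<in>{- int R + 1..int R}. a k * (W (c * of_int k) \<omega> - W (c * of_int (k - 1)) \<omega>))
      = (\<Sum>i<2 * R. a (k i) * ?D i \<omega>)" for \<omega>
    unfolding D by (rule sum.reindex_bij_betw[OF bij, symmetric])
  then have "expectation (\<lambda>\<omega>. iexp (\<Sum>k\<in>{- int R + 1..int R}. a k * (W (c * of_int k) \<omega> - W (c * of_int (k - 1)) \<omega>)))
      = expectation (\<lambda>\<omega>. \<Prod>i<2 * R. iexp (a (k i) * ?D i \<omega>))"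
    by (simp only: of_real_sum sum_distrib_left exp_sum finite_lessThan)
  also have "\<dots> = (\<Prod>i<2 * R. expectation (\<lambda>\<omega>. iexp (a (k i) * ?D i \<omega>)))"
    by (intro indep_vars_lebesgue_integral indep integrable_const_bound[of _ 1]) auto
  also have "\<dots> = exp (- complex_of_real (\<Sum>i<2 * R. (a (k i))\<^sup>2 * c / 2))"
    unfolding one by (simp add: exp_sum sum_negf[symmetric])
  also have "(\<Sum>i<2 * R. (a (k i))\<^sup>2 * c / 2) = (\<Sum>k\<in>{- int R + 1..int R}. (a k)\<^sup>2 * c / 2)"
    by (rule sum.reindex_bij_betw[OF bij])
  finally show ?thesis .
qed

end

section \<open>The estimator as a function of cell sums\<close>

lemma sum_telescope_int:
  fixes f :: "int \<Rightarrow> 'a::ab_group_add"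
  assumes "j \<le> m" shows "(\<Sum>k\<in>{j<..m}. f k - f (k - 1)) = f m - f j"
  using assms
proof (induction m rule: int_ge_induct)
  case (step m)
  then have "{j<..m + 1} = insert (m + 1) {j<..m}" by auto
  then show ?case using step by simp
qed simp

context grid_sample
begin

definition Gn :: "'a \<Rightarrow> nat \<Rightarrow> real" where "Gn \<omega> i = emp_G n (\<lambda>j. X j \<omega>) (t i)"
definition Vn :: "'a \<Rightarrow> nat \<Rightarrow> real" where
  "Vn \<omega> i = emp_V n (\<lambda>j. X j \<omega>) (\<lambda>j. status (T j \<omega>) (X j \<omega>)) (t i)"

definition on_grid :: "'a \<Rightarrow> bool" where "on_grid \<omega> \<longleftrightarrow> (\<forall>j\<in>{1..n}. X j \<omega> \<in> t ` {1..K})"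

lemma Gn_sum: "n * Gn \<omega> i = (\<Sum>j=1..n. if X j \<omega> \<le> t i then 1 else 0)"
  and Vn_sum: "n * Vn \<omega> i = (\<Sum>j=1..n. if X j \<omega> \<le> t i then (if Y j \<omega> then 1 else 0) else 0)"
proof -
  have "(\<Sum>j=1..n. if X j \<omega> \<le> t i then z j else 0) = (\<Sum>j\<in>{j \<in> {1..n}. X j \<omega> \<le> t i}. z j)" for z :: "nat \<Rightarrow> real"
    by (rule sum.inter_filter[symmetric]) simp
  then show "n * Gn \<omega> i = (\<Sum>j=1..n. if X j \<omega> \<le> t i then 1 else 0)"
    "n * Vn \<omega> i = (\<Sum>j=1..n. if X j \<omega> \<le> t i then (if Y j \<omega> then 1 else 0) else 0)"
    using n by (simp_all add: Gn_def Vn_def emp_G_def emp_V_def status_def)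
qed

lemma cell_increments:
  assumes \<omega>: "on_grid \<omega>" and i: "1 \<le> i"
  shows "cell_count i \<omega> = n * (Gn \<omega> i - Gn \<omega> (i - 1))"
    and "cell_dev \<theta> i \<omega> = n * ((Vn \<omega> i - \<theta> * Gn \<omega> i) - (Vn \<omega> (i - 1) - \<theta> * Gn \<omega> (i - 1)))"
proof -
  have split: "(if X j \<omega> = t i then z else 0) = (if X j \<omega> \<le> t i then z else 0) - (if X j \<omega> \<le> t (i - 1) then z else 0)"
    if "j \<in> {1..n}" for j and z :: real
  proof -
    obtain k where k: "X j \<omega> = t k" using \<omega> \<open>j \<in> {1..n}\<close> unfolding on_grid_def by blast
    have "k \<le> i \<longleftrightarrow> k \<le> i - 1 \<or> k = i" "\<not> (k \<le> i - 1 \<and> k = i)" using i by auto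
    then show ?thesis unfolding k grid_point_le_iff[OF \<delta>] inj_eq[OF inj_t] by auto
  qed
  show c: "cell_count i \<omega> = n * (Gn \<omega> i - Gn \<omega> (i - 1))"
    unfolding right_diff_distrib Gn_sum cell_count_def sum_subtractf[symmetric]
    by (intro sum.cong refl split)
  have "cell_dev \<theta> i \<omega> = n * Vn \<omega> i - n * Vn \<omega> (i - 1) - \<theta> * cell_count i \<omega>"
    unfolding Vn_sum cell_count_def cell_dev_def sum_distrib_left sum_subtractf[symmetric]
  proof (intro sum.cong refl)
    fix j assume j: "j \<in> {1..n}"
    show "(if X j \<omega> = t i then (if Y j \<omega> then 1 else 0) - \<theta> else 0)
        = (if X j \<omega> \<le> t i then (if Y j \<omega> then 1 else 0) else 0)
          - (if X j \<omega> \<le> t (i - 1) then (if Y j \<omega> then 1 else 0) else 0) - \<theta> * (if X j \<omega> = t i then 1 else 0)"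
      unfolding split[OF j, symmetric] by (cases "X j \<omega> = t i") simp_all
  qed
  then show "cell_dev \<theta> i \<omega> = n * ((Vn \<omega> i - \<theta> * Gn \<omega> i) - (Vn \<omega> (i - 1) - \<theta> * Gn \<omega> (i - 1)))"
    unfolding c by (simp add: algebra_simps)
qed

lemma deviation_cells:
  assumes "finite J" shows "deviation s \<theta> J \<omega> = s * (\<Sum>i\<in>J. cell_dev \<theta> i \<omega>)"
proof -
  have "(\<Sum>i\<in>J. if X j \<omega> = t i then z else 0) = (if X j \<omega> \<in> t ` J then z else 0)" for j and z :: real
  proof (cases "X j \<omega> \<in> t ` J")
    case True
    then obtain k where "k \<in> J" "X j \<omega> = t k" by auto
    then show ?thesis using assms by (simp add: inj_eq[OF inj_t] inj_image_mem_iff[OF inj_t])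
  qed (auto intro!: sum.neutral)
  then have "(\<Sum>i\<in>J. cell_dev \<theta> i \<omega>) = (\<Sum>j=1..n. if X j \<omega> \<in> t ` J then (if Y j \<omega> then 1 else 0) - \<theta> else 0)"
    unfolding cell_dev_def by (subst sum.swap) (rule sum.cong[OF refl])
  then show ?thesis
    unfolding deviation_def by (simp only: sum_distrib_left) (intro sum.cong, auto)
qed

lemma deviation_interval:
  assumes \<omega>: "on_grid \<omega>" and "i \<le> m"
  shows "deviation s \<theta> {i<..m} \<omega> = s * n * ((Vn \<omega> m - Vn \<omega> i) - \<theta> * (Gn \<omega> m - Gn \<omega> i))"
proof -
  have "(\<Sum>k\<in>{i<..m}. cell_dev \<theta> k \<omega>) = n * ((Vn \<omega> m - \<theta> * Gn \<omega> m) - (Vn \<omega> i - \<theta> * Gn \<omega> i))"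
    using \<open>i \<le> m\<close>
  proof (induction m rule: dec_induct)
    case (step m)
    then have "{i<..Suc m} = insert (Suc m) {i<..m}" by auto
    then show ?case using step cell_increments(2)[OF \<omega>, of "Suc m" \<theta>] by (simp add: algebra_simps)
  qed simp
  then show ?thesis unfolding deviation_cells[OF finite_greaterThanAtMost]
    by (simp only:) (simp add: algebra_simps)
qed

lemma Gn_mono:
  assumes "i \<le> m" shows "Gn \<omega> i \<le> Gn \<omega> m"
proof -
  have "t i \<le> t m" using assms by (simp add: grid_point_le_iff[OF \<delta>])
  then have "{j \<in> {1..n}. X j \<omega> \<le> t i} \<subseteq> {j \<in> {1..n}. X j \<omega> \<le> t m}" by fastforce
  then have "card {j \<in> {1..n}. X j \<omega> \<le> t i} \<le> card {j \<in> {1..n}. X j \<omega> \<le> t m}" by (rule card_mono[rotated]) simp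
  then show ?thesis unfolding Gn_def emp_G_def by (intro divide_right_mono) auto
qed

text \<open>The empirical functions only jump at grid points. Index 0 stands for the times before
  the first grid point and contributes the origin of the cusum diagram.\<close>

lemma cusum_points:
  assumes \<omega>: "on_grid \<omega>"
  shows "(\<lambda>s. (emp_G n (\<lambda>j. X j \<omega>) s, emp_V n (\<lambda>j. X j \<omega>) (\<lambda>j. status (T j \<omega>) (X j \<omega>)) s)) ` {a..b}
    = (\<lambda>i. (Gn \<omega> i, Vn \<omega> i)) ` {0..K}" (is "?e ` _ = ?g ` _")
proof (intro equalityI image_subsetI)
  fix s assume s: "s \<in> {a..b}"
  define i where "i = nat \<lfloor>(s - a) / \<delta>\<rfloor>"
  have r: "real i \<le> (s - a) / \<delta>" "(s - a) / \<delta> < real (Suc i)"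
    using s \<delta> unfolding i_def by (simp, subst of_nat_Suc, simp, linarith)
  then have i: "t i \<le> s" "s < t (Suc i)" using \<delta> by (auto simp: grid_point_def field_simps)
  have "i \<le> K" using s \<delta> by (auto simp: i_def grid_size_def intro!: nat_mono floor_mono divide_right_mono)
  moreover have "?e s = ?g i"
  proof -
    have "{j \<in> {1..n}. X j \<omega> \<le> s} = {j \<in> {1..n}. X j \<omega> \<le> t i}"
      by (rule observed_upto[OF \<delta> n less_imp_le[OF ab] _ _ i, where y = "\<lambda>_. 0"])
        (use \<omega> in \<open>auto simp: on_grid_def simp del: One_nat_def\<close>)
    then show ?thesis by (simp only: emp_G_def emp_V_def Gn_def Vn_def)
  qed
  ultimately show "?e s \<in> ?g ` {0..K}" by auto
next
  fix i assume "i \<in> {0..K}"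
  moreover have "real K \<le> (b - a) / \<delta>" using \<delta> ab by (simp add: grid_size_def)
  ultimately have "real i \<le> (b - a) / \<delta>" by auto
  then have "t i \<in> {a..b}" using \<delta> by (auto simp: grid_point_def field_simps)
  then show "?g i \<in> ?e ` {a..b}" unfolding Gn_def Vn_def by blast
qed

text \<open>With \<open>h\<close> = n^(-1/3), the count of a cell is of order h^(-2) and its centred
  sum of order h^(-1); the quotient of the scaled quantities is a slope difference times 1/h. Zeros
  outside the window provide the finite support that the continuity theorem expects.\<close>

definition local_cells :: "real \<Rightarrow> nat \<Rightarrow> int \<Rightarrow> 'a \<Rightarrow> int \<times> bool \<Rightarrow> real" where
  "local_cells h l R \<omega> i = (if fst i \<in> {-R<..R}
     then (if snd i then h * cell_dev (F (t l)) (nat (int l + fst i)) \<omega>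
       else h\<^sup>2 * cell_count (nat (int l + fst i)) \<omega>) else 0)"

text \<open>The \<open>hi\<close> line starts at offset N and the \<open>lo\<close> line at -N-1,
  strictly left of every offset considered. Each is required from distance 1 on across the offsets
  of interest, but on its outer side only from the edge of the window.\<close>

lemma npmle_local_cells:
  assumes \<omega>: "on_grid \<omega>" and N: "0 \<le> N" "N < R" and l: "R < int l" "int l + R \<le> int K"
    and i: "\<bar>i\<bar> \<le> N" and h: "0 < h" and q: "0 < q"
    and counts: "\<And>k. k \<in> {-R<..R} \<Longrightarrow> q \<le> local_cells h l R \<omega> (k, False)"
    and right_hi: "\<And>m. m \<in> {nat (R - N)..K - nat (int l + N)} \<Longrightarrow>
      0 \<le> deviation 1 \<theta>hi {nat (int l + N)<..nat (int l + N) + m} \<omega>"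
    and left_hi: "\<And>m. m \<in> {1..nat (int l + N)} \<Longrightarrow>
      0 \<le> deviation (-1) \<theta>hi {nat (int l + N) - m<..nat (int l + N)} \<omega>"
    and right_lo: "\<And>m. m \<in> {1..K - nat (int l - N - 1)} \<Longrightarrow>
      0 \<le> deviation 1 \<theta>lo {nat (int l - N - 1)<..nat (int l - N - 1) + m} \<omega>"
    and left_lo: "\<And>m. m \<in> {nat (R - N - 1)..nat (int l - N - 1)} \<Longrightarrow>
      0 \<le> deviation (-1) \<theta>lo {nat (int l - N - 1) - m<..nat (int l - N - 1)} \<omega>"
  shows "(npmle a b n (\<lambda>j. X j \<omega>) (\<lambda>j. status (T j \<omega>) (X j \<omega>)) (t (nat (int l + i))) - F (t l)) / h
    = window_slope q R (local_cells h l R \<omega>) i"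
proof -
  define x where "x k = Gn \<omega> (nat (int l + k))" for k :: int
  define y where "y k = Vn \<omega> (nat (int l + k))" for k :: int
  define \<theta> where "\<theta> = F (t l)"
  have n0: "0 < real n" using n by simp
  have nat_pred: "nat (int l + k) - 1 = nat (int l + (k - 1))" "1 \<le> nat (int l + k)" if "k \<in> {-R<..R}" for k
    using that l by auto
  have cell: "local_cells h l R \<omega> (k, False) = h\<^sup>2 * n * (x k - x (k - 1))"
    "local_cells h l R \<omega> (k, True) = h * n * ((y k - \<theta> * x k) - (y (k - 1) - \<theta> * x (k - 1)))"
    if k: "k \<in> {-R<..R}" for k
    using k unfolding local_cells_def x_def y_def \<theta>_def
    by (simp_all add: cell_increments[OF \<omega> nat_pred(2)[OF k], unfolded nat_pred(1)[OF k]])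
  have inc: "x (k - 1) < x k" if k: "k \<in> {-R<..R}" for k
  proof -
    have "0 < h\<^sup>2 * n * (x k - x (k - 1))" using counts[OF k] q unfolding cell(1)[OF k] by simp
    moreover have "0 < h\<^sup>2 * n" using h n0 by simp
    ultimately show ?thesis by (simp add: zero_less_mult_iff)
  qed
  have xm: "x j < x m" if "-R \<le> j" "j < m" "m \<le> R" for j m
    using \<open>j < m\<close> \<open>m \<le> R\<close>
  proof (induction m rule: int_gr_induct)
    case base then show ?case using inc[of "j + 1"] \<open>-R \<le> j\<close> by auto
  next
    case (step m) then show ?case using inc[of "m + 1"] \<open>-R \<le> j\<close> by auto
  qed
  define S where "S = (\<lambda>i. (Gn \<omega> i, Vn \<omega> i)) ` {0..K}"
  have slope: "gcm_left_slope S (x i) = maxmin_slope R x y i"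
  proof (rule gcm_left_slope_window[where lo = "- N - 1" and hi = N and sl = \<theta>lo and sr = \<theta>hi])
    show "strict_mono_on {- R..R} x" using xm by (auto simp: strict_mono_on_def)
    show "- R \<le> - N - 1" "- N - 1 < i" "i \<le> N" "N \<le> R" using N i by auto
    show "(x k, y k) \<in> S" if "k \<in> {- R..R}" for k
      unfolding S_def x_def y_def using that l by (intro imageI) auto
    have dev1: "0 \<le> (y m - y j) - \<theta> * (x m - x j)"
      if "0 \<le> deviation 1 \<theta> {nat (int l + j)<..nat (int l + m)} \<omega>" "j \<le> m" for j m \<theta>
      using that n0 unfolding x_def y_def by (subst (asm) deviation_interval[OF \<omega>]) (auto simp: zero_le_mult_iff)
    have dev2: "(y m - y j) - \<theta> * (x m - x j) \<le> 0"
      if "0 \<le> deviation (-1) \<theta> {nat (int l + j)<..nat (int l + m)} \<omega>" "j \<le> m" for j m \<theta>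
      using that n0 unfolding x_def y_def by (subst (asm) deviation_interval[OF \<omega>]) (auto simp: mult_le_0_iff)
    have right2: "y N + \<theta>hi * (x k - x N) \<le> y k" if "R \<le> k" "int l + k \<le> int K" for k
    proof -
      have "nat (k - N) \<in> {nat (R - N)..K - nat (int l + N)}" "nat (int l + N) + nat (k - N) = nat (int l + k)"
        using that N l by auto
      then show ?thesis using dev1[of \<theta>hi N k] right_hi[of "nat (k - N)"] that N by simp
    qed
    have left2: "y N + \<theta>hi * (x k - x N) \<le> y k" if "k < N" "0 \<le> int l + k" for k
    proof -
      have "nat (N - k) \<in> {1..nat (int l + N)}" "nat (int l + N) - nat (N - k) = nat (int l + k)"
        using that N l by auto
      then show ?thesis using dev2[of \<theta>hi k N] left_hi[of "nat (N - k)"] that by (simp add: algebra_simps)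
    qed
    have e: "int l - N - 1 = int l + (- N - 1)" by simp
    have right1: "y (- N - 1) + \<theta>lo * (x k - x (- N - 1)) \<le> y k" if "- N - 1 < k" "int l + k \<le> int K" for k
    proof -
      have "nat (k + N + 1) \<in> {1..K - nat (int l - N - 1)}" "nat (int l - N - 1) + nat (k + N + 1) = nat (int l + k)"
        using that N l by auto
      then show ?thesis using dev1[of \<theta>lo "- N - 1" k] right_lo[of "nat (k + N + 1)"] that unfolding e by simp
    qed
    have left1: "y (- N - 1) + \<theta>lo * (x k - x (- N - 1)) \<le> y k" if "k \<le> - R" "0 \<le> int l + k" for k
    proof -
      have "nat (- N - 1 - k) \<in> {nat (R - N - 1)..nat (int l - N - 1)}" "nat (int l - N - 1) - nat (- N - 1 - k) = nat (int l + k)"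
        using that N l by auto
      then show ?thesis using dev2[of \<theta>lo k "- N - 1"] left_lo[of "nat (- N - 1 - k)"] that N unfolding e
        by (simp add: algebra_simps)
    qed
    show "y N + \<theta>hi * (x k - x N) \<le> y k" if "k \<in> {- R..<N}" for k using left2[of k] that l by auto
    show "y (- N - 1) + \<theta>lo * (x k - x (- N - 1)) \<le> y k" if "k \<in> {- N - 1<..R}" for k using right1[of k] that l by auto
    fix u v assume "(u, v) \<in> S"
    then obtain i' where i': "i' \<le> K" "u = Gn \<omega> i'" "v = Vn \<omega> i'" by (auto simp: S_def)
    define k where "k = int i' - int l"
    have uv: "u = x k" "v = y k" using i' by (auto simp: x_def y_def k_def)
    consider "k \<in> {- R..R}" | "R < k" | "k < - R" by fastforce
    then show "(\<exists>k\<in>{- R..R}. u = x k \<and> v = y k) \<or> x N \<le> u \<and> y N + \<theta>hi * (u - x N) \<le> v \<or>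
        u \<le> x (- N - 1) \<and> y (- N - 1) + \<theta>lo * (u - x (- N - 1)) \<le> v"
    proof cases
      case 1 then show ?thesis using uv by blast
    next
      case 2
      then have "x N \<le> x k" unfolding x_def using N by (intro Gn_mono) auto
      moreover have "y N + \<theta>hi * (x k - x N) \<le> y k" using right2[of k] 2 i'(1) by (simp add: k_def)
      ultimately show ?thesis using uv by simp
    next
      case 3
      then have "x k \<le> x (- N - 1)" unfolding x_def using N by (intro Gn_mono) auto
      moreover have "y (- N - 1) + \<theta>lo * (x k - x (- N - 1)) \<le> y k" using left1[of k] 3 by (simp add: k_def)
      ultimately show ?thesis using uv by simp
    qed
  qed
  have iR: "- R < i" "i \<le> R" using i N by auto
  \<comment> \<open>The factor 1/h is what remains of h n over h^2 n. By \<open>counts\<close> the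
    truncation at \<open>q\<close> is inactive.\<close>
  have "window_slope q R (local_cells h l R \<omega>) i = 1 / h * (maxmin_slope R x y i - \<theta>)"
  proof (rule window_slope_eq_maxmin[OF iR])
    fix j m assume jm: "j \<in> {- R..i - 1}" "m \<in> {i..R}"
    then have sub: "k \<in> {-R<..R}" if "k \<in> {j<..m}" for k using that by auto
    have le: "j \<le> m" using jm by auto
    have "(\<Sum>k\<in>{j<..m}. max q (local_cells h l R \<omega> (k, False))) = (\<Sum>k\<in>{j<..m}. h\<^sup>2 * n * x k - h\<^sup>2 * n * x (k - 1))"
      using counts sub by (intro sum.cong refl) (simp add: max_def cell(1) antisym right_diff_distrib)
    also have "\<dots> = h\<^sup>2 * n * (x m - x j)"
      using sum_telescope_int[OF le, of "\<lambda>k. h\<^sup>2 * n * x k"] by (simp add: right_diff_distrib)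
    finally have den: "(\<Sum>k\<in>{j<..m}. max q (local_cells h l R \<omega> (k, False))) = h\<^sup>2 * n * (x m - x j)" .
    have "(\<Sum>k\<in>{j<..m}. local_cells h l R \<omega> (k, True))
        = (\<Sum>k\<in>{j<..m}. h * n * (y k - \<theta> * x k) - h * n * (y (k - 1) - \<theta> * x (k - 1)))"
      using sub by (intro sum.cong refl) (simp add: cell(2) right_diff_distrib)
    also have "\<dots> = h * n * ((y m - y j) - \<theta> * (x m - x j))"
      using sum_telescope_int[OF le, of "\<lambda>k. h * n * (y k - \<theta> * x k)"] by (simp add: algebra_simps)
    finally have num: "(\<Sum>k\<in>{j<..m}. local_cells h l R \<omega> (k, True)) = h * n * ((y m - y j) - \<theta> * (x m - x j))" .
    have "x m - x j \<noteq> 0" using xm[of j m] jm by auto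
    then show "(\<Sum>k\<in>{j<..m}. local_cells h l R \<omega> (k, True)) / (\<Sum>k\<in>{j<..m}. max q (local_cells h l R \<omega> (k, False)))
        = 1 / h * ((y m - y j) / (x m - x j) - \<theta>)"
      unfolding num den using h n0 by (simp add: field_simps power2_eq_square)
  qed (use h in simp)
  moreover have "npmle a b n (\<lambda>j. X j \<omega>) (\<lambda>j. status (T j \<omega>) (X j \<omega>)) (t (nat (int l + i))) = maxmin_slope R x y i"
  proof -
    \<comment> \<open>Strict increase inside the window makes the empirical distribution function
      positive at \<open>i\<close>, so the convention of value 0 does not apply.\<close>
    have "0 \<le> x (- R)" by (simp add: x_def Gn_def emp_G_def)
    then have "0 < x i" using xm[of "- R" i] iR by simp
    then show ?thesis
      using slope unfolding npmle_def cusum_points[OF \<omega>] S_def[symmetric] by (simp add: x_def Gn_def)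
  qed
  ultimately show ?thesis by (simp add: \<theta>_def)
qed

end

section \<open>Cube-root asymptotics\<close>

lemma cdf_with_density_bounds:
  assumes "cdf_with_density F f"
  shows "mono F" "\<And>x. 0 \<le> F x" "\<And>x. F x \<le> 1"
proof -
  let ?\<mu> = "density lborel f"
  have F: "F = cdf ?\<mu>" and "prob_space ?\<mu>" using assms by (auto simp: cdf_with_density_def)
  then interpret prob_space ?\<mu> by simp
  show "mono F" unfolding F cdf_def by (intro monoI finite_measure_mono) auto
  show "0 \<le> F x" "F x \<le> 1" for x unfolding F cdf_def by auto
qed

text \<open>The mean value inequality for F minus its linear part. Strict differentiability is the
  right notion because both grid points of a difference move with n, and neither need equal
  \<open>x0\<close>.\<close>

lemma C1_near_strict_derivative:
  assumes "C1_near F f x0" "0 < e"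
  obtains r where "0 < r"
    "\<And>x y. \<bar>x - x0\<bar> < r \<Longrightarrow> \<bar>y - x0\<bar> < r \<Longrightarrow> \<bar>F y - F x - f x0 * (y - x)\<bar> \<le> e * \<bar>y - x\<bar>"
proof -
  obtain U where U: "open U" "x0 \<in> U" "continuous_on U f" "\<And>u. u \<in> U \<Longrightarrow> (F has_real_derivative f u) (at u)"
    using assms by (auto simp: C1_near_def)
  have "isCont f x0" using U continuous_on_eq_continuous_at by blast
  then obtain r1 where r1: "0 < r1" "\<And>u. \<bar>u - x0\<bar> < r1 \<Longrightarrow> \<bar>f u - f x0\<bar> < e"
    using assms(2) unfolding continuous_at_eps_delta by (auto simp: dist_real_def)
  obtain r2 where r2: "0 < r2" "ball x0 r2 \<subseteq> U" using U open_contains_ball by blast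
  define r where "r = min r1 r2"
  show thesis
  proof (rule that[of r])
    show "0 < r" using r1 r2 by (simp add: r_def)
    fix x y assume xy: "\<bar>x - x0\<bar> < r" "\<bar>y - x0\<bar> < r"
    have "norm ((F y - f x0 * y) - (F x - f x0 * x)) \<le> e * norm (y - x)"
    proof (rule field_differentiable_bound[of "ball x0 r" _ "\<lambda>u. f u - f x0"])
      fix u assume u: "u \<in> ball x0 r"
      then have "u \<in> U" "\<bar>u - x0\<bar> < r1" using r2 by (auto simp: r_def dist_real_def abs_minus_commute)
      then show "norm (f u - f x0) \<le> e" using r1(2)[of u] by simp
      have "((\<lambda>u. F u - f x0 * u) has_real_derivative f u - f x0) (at u)"
        using U(4)[OF \<open>u \<in> U\<close>] by (auto intro!: derivative_eq_intros)
      then show "((\<lambda>u. F u - f x0 * u) has_field_derivative f u - f x0) (at u within ball x0 r)"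
        by (rule has_field_derivative_at_within)
    qed (use xy in \<open>auto simp: dist_real_def abs_minus_commute\<close>)
    then show "\<bar>F y - F x - f x0 * (y - x)\<bar> \<le> e * \<bar>y - x\<bar>" by (simp add: algebra_simps)
  qed
qed

text \<open>With y = sqrt m this is m (e y - L)^2 / (2 e) \<ge> 0. A sufficiently large linear gain
  \<open>b\<close> makes the bound hold at every distance, including the first cells.\<close>

lemma quadratic_dominates_steep:
  fixes e L b m :: real
  assumes "0 < e" "L\<^sup>2 / (2 * e) \<le> b" "0 \<le> m"
  shows "L * sqrt (m ^ 3) \<le> e * m\<^sup>2 / 2 + b * m"
proof -
  define y where "y = sqrt m"
  have m: "m = y\<^sup>2" "0 \<le> y" using assms by (auto simp: y_def)
  have "0 \<le> (e * y - L)\<^sup>2 / (2 * e)" using assms by simp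
  also have "\<dots> = e * y\<^sup>2 / 2 - L * y + L\<^sup>2 / (2 * e)"
    using assms by (simp add: power2_eq_square field_simps)
  also have "\<dots> \<le> e * y\<^sup>2 / 2 - L * y + b" using assms by simp
  finally have "L * y * y\<^sup>2 \<le> (e * y\<^sup>2 / 2 + b) * y\<^sup>2" by (intro mult_right_mono) auto
  moreover have "sqrt (m ^ 3) = y * y\<^sup>2"
    unfolding m by (rule real_sqrt_unique) (use m in \<open>auto simp: power_numeral_reduce\<close>)
  ultimately show ?thesis by (simp add: m algebra_simps power2_eq_square)
qed

lemma quadratic_dominates_flat:
  fixes e L B :: real
  assumes "0 < e"
  obtains m0 :: nat where "1 \<le> m0" "\<And>m. m0 \<le> m \<Longrightarrow> L * sqrt (real m ^ 3) \<le> e * (real m)\<^sup>2 / 2 - B * real m"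
proof -
  \<comment> \<open>Half of the quadratic term beats the power 3/2 at the price of
    \<open>b * m\<close>; the other half absorbs this and \<open>B * m\<close> as soon as m \<ge> 4
    (b + \<bar>B\<bar>) / e.\<close>
  define b where "b = L\<^sup>2 / e"
  define m0 where "m0 = Suc (nat \<lceil>4 * (b + \<bar>B\<bar>) / e\<rceil>)"
  show thesis
  proof (rule that[of m0])
    fix m :: nat assume m: "m0 \<le> m"
    have "L * sqrt (real m ^ 3) \<le> (e / 2) * (real m)\<^sup>2 / 2 + b * real m"
      using assms by (intro quadratic_dominates_steep) (auto simp: b_def)
    moreover have "4 * (b + \<bar>B\<bar>) / e \<le> real m" using m by (simp add: m0_def) linarith
    then have "(b + \<bar>B\<bar>) \<le> e / 4 * real m" using assms by (simp add: field_simps)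
    then have "(b + \<bar>B\<bar>) * real m \<le> e / 4 * real m * real m" by (rule mult_right_mono) simp
    then have "b * real m + \<bar>B\<bar> * real m \<le> e / 4 * (real m)\<^sup>2" by (simp add: power2_eq_square algebra_simps)
    moreover have "B * real m \<le> \<bar>B\<bar> * real m" by (intro mult_right_mono) auto
    ultimately show "L * sqrt (real m ^ 3) \<le> e * (real m)\<^sup>2 / 2 - B * real m" by simp
  qed (simp add: m0_def)
qed

section \<open>The grid near the point of interest as n grows\<close>

locale grid_limit =
  fixes F G f g :: "real \<Rightarrow> real" and a b x0 c :: real
    and M :: "nat \<Rightarrow> 'a measure" and T X :: "nat \<Rightarrow> nat \<Rightarrow> 'a \<Rightarrow> real"
  assumes F: "cdf_with_density F f" and G: "cdf_with_density G g" and c: "0 < c"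
    and sample: "\<And>n. 2 \<le> grid_size a b (grid_step c (1/3) n) \<Longrightarrow>
      current_status_sample (M n) n F (design_distribution G a b (grid_step c (1/3) n)) (T n) (X n)"
    and x0: "x0 \<in> {a<..<b}"
    and smooth: "C1_near F f x0" "C1_near G g x0"
    and positive: "0 < f x0" "0 < g x0"
begin

definition h :: "nat \<Rightarrow> real" where "h n = real n powr (- (1/3))"
abbreviation \<delta> :: "nat \<Rightarrow> real" where "\<delta> n \<equiv> grid_step c (1/3) n"
abbreviation K :: "nat \<Rightarrow> nat" where "K n \<equiv> grid_size a b (\<delta> n)"
abbreviation t :: "nat \<Rightarrow> nat \<Rightarrow> real" where "t n \<equiv> grid_point a (\<delta> n)"
definition l :: "nat \<Rightarrow> nat" where "l n = nat \<lfloor>(x0 - a) / \<delta> n\<rfloor>"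

lemma \<delta>_eq: "\<delta> n = c * h n" by (simp add: grid_step_def h_def)

lemma h_pos: "0 < n \<Longrightarrow> 0 < h n" by (simp add: h_def)

lemma h_cubed: "0 < n \<Longrightarrow> real n * h n ^ 3 = 1"
  by (simp add: h_def powr_power powr_minus field_simps)

lemma inverse_h: "0 < n \<Longrightarrow> 1 / h n = real n powr (1/3)"
  by (simp add: h_def powr_minus field_simps)

lemma h_lim: "h \<longlonglongrightarrow> 0"
  unfolding h_def by real_asymp

lemma \<delta>_lim: "\<delta> \<longlonglongrightarrow> 0"
  unfolding \<delta>_eq using h_lim by (auto intro: tendsto_eq_intros)

lemma \<delta>_pos: "0 < n \<Longrightarrow> 0 < \<delta> n" using h_pos c by (simp add: \<delta>_eq)

lemma eventually_\<delta>:
  assumes "0 < e" shows "\<forall>\<^sub>F n in sequentially. 0 < n \<and> 0 < \<delta> n \<and> \<delta> n < e"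
  using order_tendstoD(2)[OF \<delta>_lim assms] eventually_gt_at_top[of 0]
  by eventually_elim (auto intro: \<delta>_pos)

lemma near_grid_point:
  assumes "0 < \<delta> n"
  shows "t n (l n) \<le> x0" "x0 < t n (l n) + \<delta> n"
proof -
  have "0 \<le> (x0 - a) / \<delta> n" using x0 assms by simp
  then have "real (l n) \<le> (x0 - a) / \<delta> n" "(x0 - a) / \<delta> n < real (l n) + 1"
    unfolding l_def by linarith+
  then show "t n (l n) \<le> x0" "x0 < t n (l n) + \<delta> n"
    using assms by (auto simp: grid_point_def field_simps)
qed

lemma grid_point_shift: "0 \<le> int (l n) + k \<Longrightarrow> t n (nat (int (l n) + k)) = t n (l n) + of_int k * \<delta> n"
  by (simp add: grid_point_def algebra_simps)

lemma eventually_window: "\<forall>\<^sub>F n in sequentially. R < int (l n) \<and> int (l n) + R < int (K n)"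
proof -
  define e where "e = min (x0 - a) (b - x0) / (\<bar>of_int R\<bar> + 2)"
  have e: "0 < e" using x0 by (simp add: e_def add_pos_pos)
  show ?thesis
    using eventually_\<delta>[OF e]
  proof eventually_elim
    case (elim n)
    have "(\<bar>real_of_int R\<bar> + 2) * \<delta> n \<le> (\<bar>real_of_int R\<bar> + 2) * e" using elim by (intro mult_left_mono) auto
    also have "\<dots> = min (x0 - a) (b - x0)" by (simp add: e_def)
    finally have d: "(\<bar>real_of_int R\<bar> + 2) * \<delta> n \<le> x0 - a" "(\<bar>real_of_int R\<bar> + 2) * \<delta> n \<le> b - x0" by auto
    then have q: "\<bar>real_of_int R\<bar> + 2 \<le> (x0 - a) / \<delta> n" "\<bar>real_of_int R\<bar> + 2 \<le> (b - x0) / \<delta> n"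
      using elim by (auto simp: field_simps)
    have "(b - a) / \<delta> n = (x0 - a) / \<delta> n + (b - x0) / \<delta> n" using elim by (simp add: field_simps)
    then have "real (l n) + R < real (K n)"
      using q unfolding l_def grid_size_def by linarith
    moreover have "real_of_int R < real (l n)" using q unfolding l_def by linarith
    ultimately show ?case by linarith
  qed
qed

lemma eventually_last_grid_point: "\<forall>\<^sub>F n in sequentially. last_grid_point a b (\<delta> n) x0 = t n (l n)"
  using eventually_window[of 1] eventually_\<delta>[OF zero_less_one]
proof eventually_elim
  case (elim n)
  show ?case unfolding last_grid_point_def
  proof (rule Max_eqI)
    show "t n (l n) \<in> {s \<in> t n ` {1..K n}. s \<le> x0}"
      using elim near_grid_point(1)[of n] by auto
    fix y assume "y \<in> {s \<in> t n ` {1..K n}. s \<le> x0}"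
    then obtain i where i: "y = t n i" "t n i \<le> x0" by auto
    have "t n i < t n (Suc (l n))" using i near_grid_point(2)[of n] elim by (simp add: grid_point_def algebra_simps)
    then show "y \<le> t n (l n)" using elim i(1) by (simp add: grid_point_less_iff grid_point_le_iff)
  qed simp
qed

text \<open>For smaller grids the design weights need not form a probability vector, so a sample is
  only given for \<open>2 \<le> K n\<close>. Later statements hence hold for large
  \<open>n\<close>.\<close>

lemma grid_sampleI:
  assumes "0 < n" "2 \<le> K n"
  shows "grid_sample (M n) n F G a b (\<delta> n) (T n) (X n)"
proof -
  interpret prob_space "M n" using sample[OF assms(2)] by (simp add: current_status_sample_def)
  show ?thesis
    using assms sample[OF assms(2)] \<delta>_pos x0 cdf_with_density_bounds[OF F] cdf_with_density_bounds[OF G]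
    by unfold_locales auto
qed

lemma eventually_grid_sample: "\<forall>\<^sub>F n in sequentially. grid_sample (M n) n F G a b (\<delta> n) (T n) (X n)"
  using eventually_window[of 2] eventually_gt_at_top[of 0]
  by eventually_elim (rule grid_sampleI, auto)

lemma near_grid_limit: "(\<lambda>n. t n (l n) + of_int k * \<delta> n) \<longlonglongrightarrow> x0"
proof -
  have "(\<lambda>n. t n (l n)) \<longlonglongrightarrow> x0"
  proof (rule tendsto_sandwich)
    show "(\<lambda>n. x0 - \<delta> n) \<longlonglongrightarrow> x0" using \<delta>_lim by (auto intro: tendsto_eq_intros)
    show "\<forall>\<^sub>F n in sequentially. x0 - \<delta> n \<le> t n (l n)" "\<forall>\<^sub>F n in sequentially. t n (l n) \<le> x0"
      using eventually_\<delta>[OF zero_less_one] by (eventually_elim, use near_grid_point in fastforce)+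
  qed simp
  then show ?thesis using \<delta>_lim by (auto intro!: tendsto_eq_intros)
qed

text \<open>Serves both smooth functions: for G it gives the limiting cell weights, for F the drift
  of a cell relative to the base point.\<close>

lemma difference_quotient_limit:
  assumes "C1_near H u x0"
  shows "(\<lambda>n. (H (t n (l n) + of_int k * \<delta> n) - H (t n (l n) + of_int j * \<delta> n)) / h n) \<longlonglongrightarrow> u x0 * c * (of_int k - of_int j)"
proof (rule tendstoI)
  fix e :: real assume e: "0 < e"
  define e' where "e' = e / (2 * (c * \<bar>of_int k - of_int j\<bar> + 1))"
  have den: "0 < c * \<bar>real_of_int k - of_int j\<bar> + 1" using c by (simp add: add_nonneg_pos)
  have e': "0 < e'" "e' * (c * \<bar>of_int k - of_int j\<bar>) < e"
  proof -
    show "0 < e'" using e den by (simp add: e'_def)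
    then have "e' * (c * \<bar>of_int k - of_int j\<bar>) \<le> e' * (c * \<bar>of_int k - of_int j\<bar> + 1)" by (intro mult_left_mono) auto
    also have "\<dots> = e / 2" using den by (simp add: e'_def field_simps)
    finally show "e' * (c * \<bar>of_int k - of_int j\<bar>) < e" using e by simp
  qed
  obtain r where r: "0 < r"
    "\<And>x y. \<bar>x - x0\<bar> < r \<Longrightarrow> \<bar>y - x0\<bar> < r \<Longrightarrow> \<bar>H y - H x - u x0 * (y - x)\<bar> \<le> e' * \<bar>y - x\<bar>"
    using C1_near_strict_derivative[OF assms e'(1)] by blast
  have near: "\<forall>\<^sub>F n in sequentially. \<bar>t n (l n) + of_int k * \<delta> n - x0\<bar> < r" for k
    using tendstoD[OF near_grid_limit r(1)] by (simp add: dist_real_def)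
  show "\<forall>\<^sub>F n in sequentially. dist ((H (t n (l n) + of_int k * \<delta> n) - H (t n (l n) + of_int j * \<delta> n)) / h n) (u x0 * c * (of_int k - of_int j)) < e"
    using near[of k] near[of j] eventually_gt_at_top[of 0]
  proof eventually_elim
    case (elim n)
    have hp: "0 < h n" using h_pos elim by simp
    let ?D = "H (t n (l n) + of_int k * \<delta> n) - H (t n (l n) + of_int j * \<delta> n)"
    have d: "(t n (l n) + of_int k * \<delta> n) - (t n (l n) + of_int j * \<delta> n) = c * (of_int k - of_int j) * h n"
      by (simp add: \<delta>_eq algebra_simps)
    have bound: "\<bar>?D - u x0 * (c * (of_int k - of_int j) * h n)\<bar> \<le> e' * (c * \<bar>of_int k - of_int j\<bar> * h n)"
      using r(2)[OF elim(2,1)] hp c unfolding d by (simp add: abs_mult)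
    have eq: "?D / h n - u x0 * c * (of_int k - of_int j) = (?D - u x0 * (c * (of_int k - of_int j) * h n)) / h n"
      using hp by (simp add: field_simps)
    have "\<bar>?D / h n - u x0 * c * (of_int k - of_int j)\<bar> \<le> e' * (c * \<bar>of_int k - of_int j\<bar> * h n) / h n"
      unfolding eq abs_divide abs_of_pos[OF hp] using bound hp by (intro divide_right_mono) auto
    also have "\<dots> = e' * (c * \<bar>of_int k - of_int j\<bar>)" using hp by simp
    finally show ?case using e' by (simp add: dist_real_def)
  qed
qed

lemma weight_eq:
  assumes "1 < int (l n) + k" "int (l n) + k < int (K n)"
  shows "design_weight G a b (\<delta> n) (nat (int (l n) + k))
    = G (t n (l n) + of_int k * \<delta> n) - G (t n (l n) + of_int (k - 1) * \<delta> n)"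
proof -
  have "nat (int (l n) + k) - 1 = nat (int (l n) + (k - 1))" using assms by simp
  moreover have "nat (int (l n) + k) \<noteq> 1" "nat (int (l n) + k) \<noteq> K n" using assms by auto
  ultimately show ?thesis
    using assms grid_point_shift[of n k] grid_point_shift[of n "k - 1"] by (simp add: design_weight_def)
qed

lemma weight_limit: "(\<lambda>n. design_weight G a b (\<delta> n) (nat (int (l n) + k)) / h n) \<longlonglongrightarrow> g x0 * c"
proof -
  have "(\<lambda>n. (G (t n (l n) + of_int k * \<delta> n) - G (t n (l n) + of_int (k - 1) * \<delta> n)) / h n) \<longlonglongrightarrow> g x0 * c"
    using difference_quotient_limit[OF smooth(2), of k "k - 1"] by simp
  moreover have "\<forall>\<^sub>F n in sequentially. (G (t n (l n) + of_int k * \<delta> n) - G (t n (l n) + of_int (k - 1) * \<delta> n)) / h n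
      = design_weight G a b (\<delta> n) (nat (int (l n) + k)) / h n"
    using eventually_window[of "\<bar>k\<bar> + 1"] by eventually_elim (subst weight_eq, auto)
  ultimately show ?thesis by (rule Lim_transform_eventually)
qed

section \<open>Tail bounds for all large n\<close>

definition dev :: "nat \<Rightarrow> real \<Rightarrow> real \<Rightarrow> nat set \<Rightarrow> 'a \<Rightarrow> real" where
  "dev n = grid_sample.deviation n a (\<delta> n) (T n) (X n)"

definition theta :: "real \<Rightarrow> nat \<Rightarrow> real" where "theta \<beta> n = F (t n (l n)) + \<beta> * h n"

text \<open>Cell \<open>i\<close> joins the cusum points \<open>i - 1\<close> and \<open>i\<close>,
  so both sets consist of the \<open>m\<close> cells adjacent to point \<open>u\<close>; on the
  left, \<open>u\<close> itself is the nearest one.\<close>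

definition cells :: "nat \<Rightarrow> real \<Rightarrow> int \<Rightarrow> nat \<Rightarrow> nat set" where
  "cells n s u0 m = (let u = nat (int (l n) + u0) in if s = 1 then {u<..u + m} else {u - m<..u})"

definition max_distance :: "nat \<Rightarrow> real \<Rightarrow> int \<Rightarrow> nat" where
  "max_distance n s u0 = (let u = nat (int (l n) + u0) in if s = 1 then K n - u else u)"

text \<open>Coefficient of the linear term lost to the offset \<open>u0\<close> and to the tilt
  \<beta> of the line. It is negative, hence a gain, when \<open>s * \<beta>\<close> is very
  negative. The two entries of the maximum are the extreme weights, g/2 and 3g/2 per unit of
  \<delta>.\<close>

definition drift_loss :: "real \<Rightarrow> int \<Rightarrow> real \<Rightarrow> real" where
  "drift_loss s u0 \<beta> = (let A = 3 / 2 * f x0 * (\<bar>real_of_int u0\<bar> + 1) + s * \<beta> / c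
     in max (g x0 / 2 * A) (3 / 2 * g x0 * A))"

text \<open>A positive derivative lets F grow beyond \<open>x0\<close>. This leaves room for the
  upper line, whose slope must not exceed 1.\<close>

lemma F_x0_less_1: "F x0 < 1"
proof -
  obtain r where r: "0 < r"
    "\<And>x y. \<bar>x - x0\<bar> < r \<Longrightarrow> \<bar>y - x0\<bar> < r \<Longrightarrow> \<bar>F y - F x - f x0 * (y - x)\<bar> \<le> f x0 / 2 * \<bar>y - x\<bar>"
    using C1_near_strict_derivative[OF smooth(1), of "f x0 / 2"] positive by auto
  have "\<bar>F (x0 + r / 2) - F x0 - f x0 * (r / 2)\<bar> \<le> f x0 / 2 * (r / 2)"
    using r(2)[of x0 "x0 + r / 2"] r(1) by simp
  then have "f x0 / 2 * (r / 2) \<le> F (x0 + r / 2) - F x0" by linarith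
  moreover have "0 < f x0 / 2 * (r / 2)" using positive r by simp
  ultimately show ?thesis using cdf_with_density_bounds(3)[OF F, of "x0 + r / 2"] by linarith
qed

lemma eventually_theta: "\<forall>\<^sub>F n in sequentially. \<bar>theta \<beta> n\<bar> \<le> 1"
proof -
  have "(\<lambda>n. \<bar>\<beta>\<bar> * h n) \<longlonglongrightarrow> 0" using h_lim by (auto intro: tendsto_eq_intros)
  then have "\<forall>\<^sub>F n in sequentially. \<bar>\<beta>\<bar> * h n < 1 - F x0" using F_x0_less_1 by (intro order_tendstoD(2)) auto
  then show ?thesis
    using eventually_\<delta>[OF zero_less_one]
  proof eventually_elim
    case (elim n)
    have "F (t n (l n)) \<le> F x0" using monoD[OF cdf_with_density_bounds(1)[OF F]] near_grid_point elim by auto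
    moreover have "\<bar>\<beta> * h n\<bar> < 1 - F x0" using elim h_pos[of n] by (simp add: abs_mult)
    ultimately show ?case
      using cdf_with_density_bounds(2)[OF F] unfolding theta_def by (smt (verit))
  qed
qed

text \<open>The constant comes before offset, tilt and \<open>L\<close>: raising \<open>L\<close>
  makes the probability small, with tilt and starting distance adapted to it afterwards.\<close>

lemma deviation_tail_limit:
  "\<exists>C\<ge>0. \<forall>s u0 \<beta> L m0. (s = 1 \<or> s = -1) \<longrightarrow> 0 < L \<longrightarrow> 1 \<le> m0 \<longrightarrow>
    (\<forall>m\<ge>m0. L * sqrt (real m ^ 3) \<le> (g x0 * f x0 / 4) * (real m)\<^sup>2 / 2 - drift_loss s u0 \<beta> * real m) \<longrightarrow>
    (\<forall>\<^sub>F n in sequentially. measure (M n) {\<omega> \<in> space (M n).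
       \<exists>m\<in>{m0..max_distance n s u0}. dev n s (theta \<beta> n) (cells n s u0 m) \<omega> < 0} \<le> C / L\<^sup>2)"
proof -
  obtain rF where rF: "0 < rF"
    "\<And>x y. \<bar>x - x0\<bar> < rF \<Longrightarrow> \<bar>y - x0\<bar> < rF \<Longrightarrow> \<bar>F y - F x - f x0 * (y - x)\<bar> \<le> f x0 / 2 * \<bar>y - x\<bar>"
    using C1_near_strict_derivative[OF smooth(1), of "f x0 / 2"] positive by auto
  obtain rG where rG: "0 < rG"
    "\<And>x y. \<bar>x - x0\<bar> < rG \<Longrightarrow> \<bar>y - x0\<bar> < rG \<Longrightarrow> \<bar>G y - G x - g x0 * (y - x)\<bar> \<le> g x0 / 2 * \<bar>y - x\<bar>"
    using C1_near_strict_derivative[OF smooth(2), of "g x0 / 2"] positive by auto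
  \<comment> \<open>On this radius F and G are linear up to a relative error of one half, and the
    boundary cells with their pooled weights are kept away.\<close>
  define r where "r = min (min rF rG) (min (x0 - a) (b - x0) / 2)"
  have r: "0 < r" "r \<le> rF" "r \<le> rG" "r \<le> (x0 - a) / 2" "r \<le> (b - x0) / 2"
    using rF(1) rG(1) x0 unfolding r_def by (auto simp: min_def)
  define C where "C = (8 * (3 / 2 * g x0) + 4 * (b - a) / (r / 4) ^ 3) / c ^ 3"
  have "0 \<le> C" using positive x0 r c by (auto simp: C_def intro!: divide_nonneg_nonneg add_nonneg_nonneg)
  moreover have "\<forall>\<^sub>F n in sequentially. measure (M n) {\<omega> \<in> space (M n).
       \<exists>m\<in>{m0..max_distance n s u0}. dev n s (theta \<beta> n) (cells n s u0 m) \<omega> < 0} \<le> C / L\<^sup>2"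
    if s: "s = 1 \<or> s = -1" and L: "0 < L" and m0: "1 \<le> m0"
      and quad: "\<And>m. m0 \<le> m \<Longrightarrow> L * sqrt (real m ^ 3) \<le> (g x0 * f x0 / 4) * (real m)\<^sup>2 / 2 - drift_loss s u0 \<beta> * real m"
    for s u0 \<beta> L m0
  proof -
    define A where "A = 3 / 2 * f x0 * (\<bar>real_of_int u0\<bar> + 1) + s * \<beta> / c"
    \<comment> \<open>Bounds for the spacing. In order, they yield \<delta> \<le> 1, room for the
      offset, a floor in \<open>d0\<close> that costs at most half of its argument, m0 \<le> d0, and
      a nonnegative drift at \<open>d0\<close>.\<close>
    define E where "E = {1, r / (2 * (\<bar>real_of_int u0\<bar> + 3)), r / 4, r / (4 * real m0), r * f x0 / (8 * (\<bar>A\<bar> + 1))}"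
    define e where "e = Min E"
    have E: "finite E" "E \<noteq> {}" "\<forall>x\<in>E. 0 < x"
      using r positive m0 by (auto simp: E_def add_nonneg_pos)
    have le: "e \<le> x" if "x \<in> E" for x unfolding e_def using E that by (intro Min_le) auto
    have e: "0 < e" "e \<le> 1" "e \<le> r / (2 * (\<bar>real_of_int u0\<bar> + 3))" "e \<le> r / 4" "e \<le> r / (4 * real m0)"
      "e \<le> r * f x0 / (8 * (\<bar>A\<bar> + 1))"
      subgoal unfolding e_def using E by (subst Min_gr_iff) auto
      by (rule le, unfold E_def, blast)+
    show ?thesis
      using eventually_\<delta>[OF e(1)] eventually_grid_sample eventually_theta[of \<beta>] eventually_window[of "\<bar>u0\<bar> + 2"]
    proof eventually_elim
      case (elim n)
      then interpret S: grid_sample "M n" n F G a b "\<delta> n" "T n" "X n" by simp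
      have \<delta>0: "0 < \<delta> n" "\<delta> n < e" using elim by auto
      \<comment> \<open>The first \<open>d0\<close> cells span at most r/2; the other half of the
        radius is left for the offset.\<close>
      define d0 where "d0 = nat \<lfloor>r / (2 * \<delta> n)\<rfloor>"
      have q4: "1 \<le> r / (4 * \<delta> n)" using \<delta>0 e(4) by (simp add: field_simps)
      have r2: "r / (2 * \<delta> n) = r / (4 * \<delta> n) + r / (4 * \<delta> n)" by simp
      have d0: "r / (4 * \<delta> n) \<le> real d0" "real d0 \<le> r / (2 * \<delta> n)"
        using q4 r2 unfolding d0_def by linarith+
      have d0\<delta>: "real d0 * \<delta> n \<le> r / 2" using d0(2) \<delta>0 by (simp add: field_simps)
      have m0d0: "m0 \<le> d0"
      proof -
        have "4 * real m0 * \<delta> n \<le> 4 * real m0 * e" using \<delta>0 by (intro mult_left_mono) auto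
        also have "\<dots> \<le> r" using e(5) m0 by (simp add: field_simps)
        finally have "real m0 \<le> r / (4 * \<delta> n)" using \<delta>0 by (simp add: field_simps)
        then show ?thesis using d0(1) by linarith
      qed
      \<comment> \<open>This makes the lower bound for the drift nonnegative at \<open>d0\<close>,
        the starting point for all larger distances.\<close>
      have Ad0: "A \<le> f x0 / 2 * real d0"
      proof -
        have "8 * (\<bar>A\<bar> + 1) * \<delta> n \<le> 8 * (\<bar>A\<bar> + 1) * e" using \<delta>0 by (intro mult_left_mono) auto
        also have "\<dots> \<le> r * f x0"
        proof -
          have "e * (8 * (\<bar>A\<bar> + 1)) \<le> r * f x0" using e(6) by (subst (asm) pos_le_divide_eq) auto
          then show ?thesis by (simp add: algebra_simps)
        qed
        finally have "\<bar>A\<bar> + 1 \<le> f x0 / 2 * (r / (4 * \<delta> n))" using \<delta>0 by (simp add: field_simps)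
        also have "\<dots> \<le> f x0 / 2 * real d0" using d0(1) positive by (intro mult_left_mono) auto
        finally show ?thesis by linarith
      qed
      define y where "y k = t n (l n) + of_int k * \<delta> n" for k
      have near: "\<bar>y k - x0\<bar> < r" if k: "\<bar>real_of_int k\<bar> \<le> real d0 + \<bar>real_of_int u0\<bar> + 2" for k
      proof -
        have "\<bar>real_of_int k * \<delta> n\<bar> \<le> (real d0 + \<bar>real_of_int u0\<bar> + 2) * \<delta> n"
          using k \<delta>0 by (simp add: abs_mult)
        also have "\<dots> = real d0 * \<delta> n + (\<bar>real_of_int u0\<bar> + 3) * \<delta> n - \<delta> n" by (simp add: algebra_simps)
        finally have 1: "\<bar>real_of_int k * \<delta> n\<bar> \<le> real d0 * \<delta> n + (\<bar>real_of_int u0\<bar> + 3) * \<delta> n - \<delta> n" .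
        have "(\<bar>real_of_int u0\<bar> + 3) * \<delta> n < (\<bar>real_of_int u0\<bar> + 3) * e" using \<delta>0 by (intro mult_strict_left_mono) auto
        also have "\<dots> \<le> r / 2"
        proof -
          have "e * (2 * (\<bar>real_of_int u0\<bar> + 3)) \<le> r" using e(3) by (subst (asm) pos_le_divide_eq) auto
          then show ?thesis by (simp add: algebra_simps)
        qed
        finally show ?thesis using 1 d0\<delta> near_grid_point[of n] \<delta>0 unfolding y_def by (auto simp: abs_le_iff abs_less_iff)
      qed
      have inside: "1 < int (l n) + k" "int (l n) + k < int (K n)" if k: "\<bar>real_of_int k\<bar> \<le> real d0 + \<bar>real_of_int u0\<bar> + 2" for k
      proof -
        have yk: "y k = a + (real (l n) + of_int k) * \<delta> n" by (simp add: y_def grid_point_def algebra_simps)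
        have "a + r \<le> y k" "y k \<le> b - r" using near[OF k] r by (auto simp: abs_less_iff field_simps)
        then have "r \<le> (real (l n) + of_int k) * \<delta> n" "(real (l n) + of_int k) * \<delta> n \<le> (b - a) - r"
          unfolding yk by auto
        then have *: "r / \<delta> n \<le> real (l n) + of_int k" "real (l n) + of_int k \<le> (b - a) / \<delta> n - r / \<delta> n"
          unfolding diff_divide_distrib[symmetric] using \<delta>0 by (simp_all only: pos_divide_le_eq pos_le_divide_eq)
        have "4 \<le> r / \<delta> n" using q4 by (simp add: field_simps)
        then show "1 < int (l n) + k" "int (l n) + k < int (K n)"
          using * unfolding grid_size_def by linarith+
      qed
      define u where "u = nat (int (l n) + u0)"
      have "0 \<le> int (l n) + u0" "int (l n) + u0 \<le> int (K n)" using elim(4) by linarith+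
      then have u: "int u = int (l n) + u0" "u \<le> K n" by (simp_all add: u_def)
      \<comment> \<open>Cells are numbered outwards from the base point, so that the left side
        starts at \<open>u\<close> and is \<open>u + 1 - d\<close>; \<open>kk\<close> is the same
        index relative to \<open>l n\<close>.\<close>
      define kk where "kk d = (if s = 1 then u0 + int d else u0 + 1 - int d)" for d
      define w where "w d = (if s = 1 then u + d else u + 1 - d)" for d
      define D where "D = max_distance n s u0"
      have D: "D = (if s = 1 then K n - u else u)" by (simp add: D_def max_distance_def u_def)
      have kk: "\<bar>real_of_int (kk d)\<bar> \<le> real d0 + \<bar>real_of_int u0\<bar> + 1" if "d \<in> {1..d0}" for d
        using that by (auto simp: kk_def)
      have wk: "w d = nat (int (l n) + kk d)" if "d \<in> {1..d0}" for d
        using that u by (auto simp: w_def kk_def nat_diff_distrib)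
      have ty: "t n (w d) = y (kk d)" if d: "d \<in> {1..d0}" for d
        unfolding wk[OF d] y_def using inside[of "kk d"] kk[OF d] by (subst grid_point_shift) auto
      have pG: "design_weight G a b (\<delta> n) (w d) = G (y (kk d)) - G (y (kk d - 1))" if d: "d \<in> {1..d0}" for d
        unfolding wk[OF d] y_def using inside[of "kk d"] kk[OF d] by (subst weight_eq) auto
      have p_bounds: "g x0 / 2 * \<delta> n \<le> design_weight G a b (\<delta> n) (w d)" "design_weight G a b (\<delta> n) (w d) \<le> 3 / 2 * g x0 * \<delta> n"
        if d: "d \<in> {1..d0}" for d
      proof -
        have "\<bar>y (kk d) - x0\<bar> < r" "\<bar>y (kk d - 1) - x0\<bar> < r" using kk[OF d] by (intro near, linarith)+
        then have bound: "\<bar>G (y (kk d)) - G (y (kk d - 1)) - g x0 * (y (kk d) - y (kk d - 1))\<bar> \<le> g x0 / 2 * \<bar>y (kk d) - y (kk d - 1)\<bar>"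
          using r by (intro rG(2)) auto
        have yd: "y (kk d) - y (kk d - 1) = \<delta> n" by (simp add: y_def algebra_simps)
        show "g x0 / 2 * \<delta> n \<le> design_weight G a b (\<delta> n) (w d)" "design_weight G a b (\<delta> n) (w d) \<le> 3 / 2 * g x0 * \<delta> n"
          unfolding pG[OF d] using bound[unfolded yd abs_of_pos[OF \<delta>0(1)]] by linarith+
      qed
      have drift: "\<delta> n * (f x0 / 2 * real d - A) \<le> s * (F (t n (w d)) - theta \<beta> n)" if d: "d \<in> {1..d0}" for d
      proof -
        define z where "z = s * of_int (kk d)"
        have z: "real d - (\<bar>real_of_int u0\<bar> + 1) \<le> z" using s by (auto simp: z_def kk_def)
        have "\<bar>F (y (kk d)) - F (y 0) - f x0 * (y (kk d) - y 0)\<bar> \<le> f x0 / 2 * \<bar>y (kk d) - y 0\<bar>"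
          using near[of "kk d"] near[of 0] kk[OF d] r by (intro rF(2)) auto
        moreover have "y (kk d) - y 0 = of_int (kk d) * \<delta> n" by (simp add: y_def)
        moreover have "\<bar>of_int (kk d) * \<delta> n\<bar> = \<bar>z\<bar> * \<delta> n" using s \<delta>0 by (auto simp: z_def abs_mult)
        ultimately have "\<bar>F (y (kk d)) - F (y 0) - f x0 * (of_int (kk d) * \<delta> n)\<bar> \<le> f x0 / 2 * (\<bar>z\<bar> * \<delta> n)" by simp
        then have *: "F (y (kk d)) - F (y 0) - f x0 * (of_int (kk d) * \<delta> n) \<le> f x0 / 2 * (\<bar>z\<bar> * \<delta> n)"
          "- (F (y (kk d)) - F (y 0) - f x0 * (of_int (kk d) * \<delta> n)) \<le> f x0 / 2 * (\<bar>z\<bar> * \<delta> n)"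
          by linarith+
        have fz: "f x0 * (z * \<delta> n) = s * (f x0 * (of_int (kk d) * \<delta> n))" by (simp add: z_def)
        have "f x0 * (z * \<delta> n) - f x0 / 2 * (\<bar>z\<bar> * \<delta> n) \<le> s * (F (y (kk d)) - F (y 0))"
          using s
        proof
          assume "s = 1"
          then show ?thesis using *(2) unfolding fz by simp
        next
          assume "s = - 1"
          then show ?thesis using *(1) unfolding fz by simp
        qed
        moreover have "\<delta> n * (f x0 / 2 * real d - 3 / 2 * f x0 * (\<bar>real_of_int u0\<bar> + 1)) \<le> f x0 * (z * \<delta> n) - f x0 / 2 * (\<bar>z\<bar> * \<delta> n)"
        proof -
          \<comment> \<open>An offset can put the first cells on the wrong side of the base point. A
            relative error of one half costs z f/2 if z \<ge> 0 but turns f into 3f/2 if z < 0,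
            which is the origin of the factor 3/2 in \<open>drift_loss\<close>.\<close>
          have "f x0 / 2 * real d - 3 / 2 * f x0 * U \<le> f x0 * z - f x0 / 2 * \<bar>z\<bar>"
            if U: "real d - U \<le> z" "0 \<le> U" for U
          proof (cases "0 \<le> z")
            case True
            have "f x0 / 2 * (real d - U) \<le> f x0 / 2 * z" using U positive by (intro mult_left_mono) auto
            moreover have "0 \<le> f x0 * U" using U positive by simp
            ultimately show ?thesis unfolding abs_of_nonneg[OF True] right_diff_distrib by linarith
          next
            case False
            then have z0: "z \<le> 0" by simp
            have "3 / 2 * f x0 * (real d - U) \<le> 3 / 2 * f x0 * z" using U positive by (intro mult_left_mono) auto
            moreover have "0 \<le> f x0 * real d" using positive by simp
            ultimately show ?thesis unfolding abs_of_nonpos[OF z0] right_diff_distrib by linarith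
          qed
          from this[OF z] have "f x0 / 2 * real d - 3 / 2 * f x0 * (\<bar>real_of_int u0\<bar> + 1) \<le> f x0 * z - f x0 / 2 * \<bar>z\<bar>"
            by simp
          then have "\<delta> n * (f x0 / 2 * real d - 3 / 2 * f x0 * (\<bar>real_of_int u0\<bar> + 1)) \<le> \<delta> n * (f x0 * z - f x0 / 2 * \<bar>z\<bar>)"
            using \<delta>0 by (intro mult_left_mono) auto
          then show ?thesis by (simp add: algebra_simps)
        qed
        moreover have "s * (F (t n (w d)) - theta \<beta> n) = s * (F (y (kk d)) - F (y 0)) - \<delta> n * (s * \<beta> / c)"
          unfolding ty[OF d] theta_def using c by (simp add: y_def \<delta>_eq algebra_simps)
        ultimately show ?thesis unfolding A_def by (simp add: algebra_simps)
      qed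
      have inj: "inj_on w {1..D}" using s by (auto simp: inj_on_def w_def D split: if_splits)
      have range: "w ` {1..D} \<subseteq> {1..K n}"
      proof -
        show ?thesis using u(2) by (auto simp: w_def D split: if_splits)
      qed
      have d0D: "d0 \<le> D"
      proof (cases "s = 1")
        case True
        have "int (l n) + (u0 + int d0) < int (K n)" by (rule inside(2)) linarith
        then show ?thesis using True u by (simp add: D)
      next
        case False
        have "1 < int (l n) + (u0 - int d0)" by (rule inside(1)) linarith
        then show ?thesis using False u by (simp add: D)
      qed
      have d0pos: "d0 \<in> {1..d0}" using m0 m0d0 by simp
      have "measure (M n) {\<omega> \<in> space (M n). \<exists>m\<in>{m0..D}. S.deviation s (theta \<beta> n) (w ` {1..m}) \<omega> < 0}
          \<le> (8 * (3 / 2 * g x0) + 4 * (b - a) / (r / 4) ^ 3) / (c ^ 3 * L\<^sup>2)"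
      proof (rule S.deviation_tail[OF _ _ s _ inj range _ _ _ m0 m0d0 d0D _ L quad])
        show "real n * \<delta> n ^ 3 = c ^ 3" using h_cubed[of n] elim by (simp add: \<delta>_eq power_mult_distrib)
        show "\<delta> n \<le> 1" using \<delta>0 e by simp
        show "\<bar>theta \<beta> n\<bar> \<le> 1" using elim by simp
        show "0 \<le> g x0 * f x0 / 4" using positive by simp
        show "0 < r / 4" "r / 4 / \<delta> n \<le> real d0" using r d0(1) by simp_all
        show "real D \<le> (b - a) / \<delta> n"
        proof -
          have "real (K n) \<le> (b - a) / \<delta> n" using \<delta>0 x0 by (simp add: grid_size_def)
          moreover have "D \<le> K n" using u(2) by (auto simp: D)
          ultimately show ?thesis by linarith
        qed
        fix d assume d: "d \<in> {1..d0}"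
        let ?p = "design_weight G a b (\<delta> n) (w d)"
        show "?p \<le> 3 / 2 * g x0 * \<delta> n" by (rule p_bounds(2)[OF d])
        have p0: "0 \<le> ?p" by (rule S.p_nonneg)
        have "?p * (\<delta> n * (f x0 / 2 * real d - A)) \<le> ?p * (s * (F (t n (w d)) - theta \<beta> n))"
          by (rule mult_left_mono[OF drift[OF d] p0])
        moreover have "g x0 / 2 * \<delta> n * (\<delta> n * (f x0 / 2 * real d)) \<le> ?p * (\<delta> n * (f x0 / 2 * real d))"
          using p_bounds(1)[OF d] \<delta>0 positive by (intro mult_right_mono) auto
        \<comment> \<open>The sign of \<open>A\<close> decides whether the upper or the lower weight
          bound is the unfavourable one.\<close>
        moreover have "?p * (\<delta> n * A) \<le> (\<delta> n)\<^sup>2 * drift_loss s u0 \<beta>"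
        proof -
          have "?p * A \<le> \<delta> n * drift_loss s u0 \<beta>"
          proof (cases "0 \<le> A")
            case True
            have "?p * A \<le> 3 / 2 * g x0 * \<delta> n * A" using p_bounds(2)[OF d] True by (rule mult_right_mono)
            also have "\<dots> = \<delta> n * (3 / 2 * g x0 * A)" by simp
            also have "\<dots> \<le> \<delta> n * drift_loss s u0 \<beta>"
              unfolding drift_loss_def Let_def A_def[symmetric] using \<delta>0 by (intro mult_left_mono) auto
            finally show ?thesis .
          next
            case False
            then have "?p * A \<le> g x0 / 2 * \<delta> n * A" using p_bounds(1)[OF d] by (intro mult_right_mono_neg) auto
            also have "\<dots> = \<delta> n * (g x0 / 2 * A)" by simp
            also have "\<dots> \<le> \<delta> n * drift_loss s u0 \<beta>"
              unfolding drift_loss_def Let_def A_def[symmetric] using \<delta>0 by (intro mult_left_mono) auto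
            finally show ?thesis .
          qed
          from mult_left_mono[OF this, of "\<delta> n"] show ?thesis using \<delta>0 by (simp add: power2_eq_square algebra_simps)
        qed
        ultimately show "(\<delta> n)\<^sup>2 * (g x0 * f x0 / 4 * real d - drift_loss s u0 \<beta>) \<le> ?p * (s * (F (t n (w d)) - theta \<beta> n))"
          by (simp add: power2_eq_square algebra_simps)
      next
        fix d assume d: "d \<in> {d0<..D}"
        have "0 \<le> \<delta> n * (f x0 / 2 * real d0 - A)" using Ad0 \<delta>0 by simp
        also have "\<dots> \<le> s * (F (t n (w d0)) - theta \<beta> n)" by (rule drift[OF d0pos])
        also have "\<dots> \<le> s * (F (t n (w d)) - theta \<beta> n)"
          using s
        proof
          assume s1: "s = 1"
          have "t n (w d0) \<le> t n (w d)" using d \<delta>0 s1 by (simp add: w_def grid_point_le_iff)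
          from monoD[OF cdf_with_density_bounds(1)[OF F] this] show ?thesis using s1 by simp
        next
          assume s1: "s = - 1"
          have "u + 1 - d \<le> u + 1 - d0" using d by (intro diff_le_mono2) auto
          then have "t n (w d) \<le> t n (w d0)" using \<delta>0 s1 by (simp add: w_def grid_point_le_iff)
          from monoD[OF cdf_with_density_bounds(1)[OF F] this] show ?thesis using s1 by simp
        qed
        finally show "0 \<le> s * (F (t n (w d)) - theta \<beta> n)" .
      qed
      moreover have cells: "cells n s u0 m = w ` {1..m}" if "m \<in> {m0..D}" for m
      proof (cases "s = 1")
        case True
        have "x \<in> w ` {1..m}" if "x \<in> {u<..u + m}" for x
          using that True by (intro image_eqI[of _ _ "x - u"]) (auto simp: w_def)
        then show ?thesis using True by (auto simp: cells_def Let_def u_def[symmetric] w_def)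
      next
        case False
        have "m \<le> u" using that False by (simp add: D)
        then have "x \<in> w ` {1..m}" if "x \<in> {u - m<..u}" for x
          using that False by (intro image_eqI[of _ _ "u + 1 - x"]) (auto simp: w_def)
        then show ?thesis using False \<open>m \<le> u\<close> by (auto simp: cells_def Let_def u_def[symmetric] w_def)
      qed
      moreover have "{\<omega> \<in> space (M n). \<exists>m\<in>{m0..D}. S.deviation s (theta \<beta> n) (cells n s u0 m) \<omega> < 0}
          = {\<omega> \<in> space (M n). \<exists>m\<in>{m0..D}. S.deviation s (theta \<beta> n) (w ` {1..m}) \<omega> < 0}"
        using cells by (intro Collect_cong conj_cong bex_cong refl) (simp only:)
      ultimately show ?case
        unfolding dev_def D_def[symmetric] C_def divide_divide_eq_left by (simp only:)
    qed
  qed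
  ultimately show ?thesis by blast
qed

end

section \<open>Limit law of the local cell sums\<close>

lemma (in grid_sample) measurable_local_cells: "(\<lambda>\<omega>. local_cells h l R \<omega> i) \<in> borel_measurable M"
proof -
  note [measurable] = measurable_cell
  show ?thesis unfolding local_cells_def by (cases "fst i \<in> {-R<..R}"; cases "snd i") simp_all
qed

context grid_limit
begin

definition Z :: "nat \<Rightarrow> nat \<Rightarrow> 'a \<Rightarrow> int \<times> bool \<Rightarrow> real" where
  "Z R n = grid_sample.local_cells n F a (\<delta> n) (T n) (X n) (h n) (l n) (int R)"

text \<open>The log-characteristic function of independent normal variables with mean g f c^2 k and
  variance g c F (1 - F), together with counts that are degenerate at g c.\<close>

definition limit_exponent :: "nat \<Rightarrow> (int \<times> bool \<Rightarrow> real) \<Rightarrow> complex" where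
  "limit_exponent R u = (\<Sum>k\<in>{- int R<..int R}. complex_of_real (g x0 * c) *
     (\<i> * complex_of_real (u (k, True) * (f x0 * c * of_int k) + u (k, False))
       - complex_of_real ((u (k, True))\<^sup>2 * (F x0 * (1 - F x0)) / 2)))"

lemma F_limit: "(\<lambda>n. F (t n (l n))) \<longlonglongrightarrow> F x0"
proof -
  have "isCont F x0" using smooth(1) DERIV_isCont by (fastforce simp: C1_near_def)
  then show ?thesis using near_grid_limit[of 0] by (auto intro: isCont_tendsto_compose)
qed

text \<open>Since n = h^(-3), a cell of weight p contributes (p/h) times its exponent divided by
  h^2, and both factors converge.\<close>

lemma Z_char:
  "(\<lambda>n. \<integral>\<omega>. iexp (\<Sum>i\<in>{- int R<..int R} \<times> UNIV. u i * Z R n \<omega> i) \<partial>M n) \<longlonglongrightarrow> exp (limit_exponent R u)"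
proof -
  let ?A = "{- int R<..int R}"
  define m where "m n k = nat (int (l n) + k)" for n k
  define \<phi> where "\<phi> n = grid_sample.cell_char F G a b (\<delta> n) (m n) (F (t n (l n))) (\<lambda>k. h n * u (k, True))
    (\<lambda>k. (h n)\<^sup>2 * u (k, False)) ?A" for n
  have split: "(\<Sum>i\<in>?A \<times> UNIV. w i) = (\<Sum>k\<in>?A. w (k, True) + w (k, False))" for w :: "int \<times> bool \<Rightarrow> real"
    by (simp add: sum.cartesian_product' UNIV_bool add.commute)
  have char: "\<forall>\<^sub>F n in sequentially. (\<integral>\<omega>. iexp (\<Sum>i\<in>?A \<times> UNIV. u i * Z R n \<omega> i) \<partial>M n) = \<phi> n ^ n \<and> norm (\<phi> n) \<le> 1"
    using eventually_grid_sample eventually_window[of "int R + 1"]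
  proof eventually_elim
    case (elim n)
    then interpret S: grid_sample "M n" n F G a b "\<delta> n" "T n" "X n" by simp
    have A: "finite ?A" "inj_on (m n) ?A" "m n ` ?A \<subseteq> {1..K n}"
      using elim(2) by (auto simp: inj_on_def m_def)
    have eq: "(\<Sum>i\<in>?A \<times> UNIV. u i * Z R n \<omega> i)
        = (\<Sum>k\<in>?A. (h n * u (k, True)) * S.cell_dev (F (t n (l n))) (m n k) \<omega> + ((h n)\<^sup>2 * u (k, False)) * S.cell_count (m n k) \<omega>)" for \<omega>
      unfolding split by (intro sum.cong refl) (simp add: Z_def S.local_cells_def m_def mult.commute mult.left_commute)
    show ?case unfolding \<phi>_def eq by (intro conjI S.char_cells[OF A])
  qed
  have "(\<lambda>n. of_nat n * (\<phi> n - 1)) \<longlonglongrightarrow> limit_exponent R u"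
  proof -
    let ?D = "\<lambda>n k. (F (t n (l n) + of_int k * \<delta> n) - F (t n (l n))) / h n"
    let ?B = "\<lambda>n k. ((F (t n (l n)) + h n * ?D n k) * (iexp (h n * u (k, True) * (1 - F (t n (l n))) + (h n)\<^sup>2 * u (k, False)) - 1)
      + (1 - (F (t n (l n)) + h n * ?D n k)) * (iexp (h n * u (k, True) * (- F (t n (l n))) + (h n)\<^sup>2 * u (k, False)) - 1)) / (h n)\<^sup>2"
    have "(\<lambda>n. \<Sum>k\<in>?A. complex_of_real (design_weight G a b (\<delta> n) (m n k) / h n) * ?B n k) \<longlonglongrightarrow> limit_exponent R u"
      unfolding limit_exponent_def
    proof (intro tendsto_sum tendsto_mult tendsto_of_real)
      fix k
      show "(\<lambda>n. design_weight G a b (\<delta> n) (m n k) / h n) \<longlonglongrightarrow> g x0 * c" unfolding m_def by (rule weight_limit)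
      have "(\<lambda>n. ?D n k) \<longlonglongrightarrow> f x0 * c * of_int k"
        using difference_quotient_limit[OF smooth(1), of k 0] by simp
      moreover have "\<forall>\<^sub>F n in sequentially. 0 < h n" using eventually_gt_at_top[of 0] by eventually_elim (rule h_pos)
      ultimately show "(\<lambda>n. ?B n k) \<longlonglongrightarrow> \<i> * complex_of_real (u (k, True) * (f x0 * c * of_int k) + u (k, False))
          - complex_of_real ((u (k, True))\<^sup>2 * (F x0 * (1 - F x0)) / 2)"
        using cell_exponent_limit[OF h_lim _ F_limit] by blast
    qed
    moreover have "\<forall>\<^sub>F n in sequentially. (\<Sum>k\<in>?A. complex_of_real (design_weight G a b (\<delta> n) (m n k) / h n) * ?B n k) = of_nat n * (\<phi> n - 1)"
      using eventually_grid_sample eventually_window[of "int R + 1"] eventually_gt_at_top[of 0]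
    proof eventually_elim
      case (elim n)
      then interpret S: grid_sample "M n" n F G a b "\<delta> n" "T n" "X n" by simp
      have hp: "0 < h n" using h_pos elim by simp
      have nh: "complex_of_nat n = 1 / complex_of_real (h n) ^ 3"
      proof -
        have "real n = 1 / h n ^ 3" using h_cubed[of n] elim hp by (simp add: field_simps)
        then have "complex_of_real (real n) = complex_of_real (1 / h n ^ 3)" by simp
        then show ?thesis by simp
      qed
      have Fk: "F (t n (m n k)) = F (t n (l n)) + h n * ?D n k" if "k \<in> ?A" for k
        using that elim(2) hp grid_point_shift[of n k] unfolding m_def by auto
      have "\<phi> n - 1 = (\<Sum>k\<in>?A. design_weight G a b (\<delta> n) (m n k) * ((h n)\<^sup>2 * ?B n k))"
        unfolding \<phi>_def S.cell_char_def add_diff_cancel_left'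
      proof (intro sum.cong refl)
        fix k assume k: "k \<in> ?A"
        have "(h n)\<^sup>2 * ?B n k = F (t n (m n k)) * (iexp (h n * u (k, True) * (1 - F (t n (l n))) + (h n)\<^sup>2 * u (k, False)) - 1)
          + (1 - F (t n (m n k))) * (iexp (h n * u (k, True) * (- F (t n (l n))) + (h n)\<^sup>2 * u (k, False)) - 1)"
          unfolding Fk[OF k, symmetric] using hp by simp
        then show "design_weight G a b (\<delta> n) (m n k) * (F (t n (m n k)) * (iexp (h n * u (k, True) * (1 - F (t n (l n))) + (h n)\<^sup>2 * u (k, False)) - 1)
          + (1 - F (t n (m n k))) * (iexp (h n * u (k, True) * (- F (t n (l n))) + (h n)\<^sup>2 * u (k, False)) - 1))
          = design_weight G a b (\<delta> n) (m n k) * ((h n)\<^sup>2 * ?B n k)" by (simp only:)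
      qed
      moreover have "of_nat n * (\<Sum>k\<in>?A. complex_of_real (p k) * ((h n)\<^sup>2 * B k)) = (\<Sum>k\<in>?A. complex_of_real (p k / h n) * B k)"
        for p and B :: "int \<Rightarrow> complex"
        unfolding nh sum_distrib_left using hp
        by (intro sum.cong refl) (simp add: power_numeral_reduce)
      ultimately show ?case by (simp only:)
    qed
    ultimately show ?thesis by (rule Lim_transform_eventually)
  qed
  moreover have "Re (limit_exponent R u) \<le> 0"
  proof -
    have "0 \<le> F x0 * (1 - F x0)" using cdf_with_density_bounds(2,3)[OF F] by simp
    then have "0 \<le> (u (k, True))\<^sup>2 * (F x0 * (1 - F x0))" for k by (rule mult_nonneg_nonneg[OF zero_le_power2])
    then have "0 \<le> g x0 * c * ((u (k, True))\<^sup>2 * (F x0 * (1 - F x0)) / 2)" for k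
      using positive c by simp
    then show ?thesis
      unfolding limit_exponent_def Re_sum by (intro sum_nonpos) (simp del: of_real_mult of_real_divide of_real_power add: Re_complex_of_real)
  qed
  moreover have "\<forall>\<^sub>F n in sequentially. norm (\<phi> n) \<le> 1" using char by eventually_elim simp
  ultimately have "(\<lambda>n. \<phi> n ^ n) \<longlonglongrightarrow> exp (limit_exponent R u)" by (intro power_tendsto_exp)
  then show ?thesis by (rule Lim_transform_eventually) (use char in eventually_elim, simp)
qed

end

locale grid_limit_brownian = grid_limit F G f g a b x0 c M T X + brownian \<Omega> W
  for F G f g a b x0 c and M :: "nat \<Rightarrow> 'a measure" and T X and \<Omega> :: "'b measure" and W +
  fixes \<alpha> \<beta> :: real
  assumes \<alpha>: "\<alpha> = sqrt (F x0 * (1 - F x0) / g x0)" and \<beta>: "\<beta> = f x0 / 2"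
begin

text \<open>Horizontal distances in the cusum diagram are measured by G, which stretches time by
  g(x0). The same factor on the ordinates leaves the slopes unchanged.\<close>

definition Z' :: "nat \<Rightarrow> 'b \<Rightarrow> int \<times> bool \<Rightarrow> real" where
  "Z' R \<omega> i = (if fst i \<in> {- int R<..int R}
     then (if snd i then g x0 * (path c \<alpha> \<beta> \<omega> (fst i) - path c \<alpha> \<beta> \<omega> (fst i - 1)) else g x0 * c) else 0)"

lemma measurable_Z': "(\<lambda>\<omega>. Z' R \<omega> i) \<in> borel_measurable \<Omega>"
proof -
  note [measurable] = W_props(2)
  show ?thesis unfolding Z'_def path_def by measurable
qed

lemma Z'_char: "(\<integral>\<omega>. iexp (\<Sum>i\<in>{- int R<..int R} \<times> UNIV. u i * Z' R \<omega> i) \<partial>\<Omega>) = exp (limit_exponent R u)"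
proof -
  let ?A = "{- int R<..int R}"
  define A where "A k = u (k, True) * g x0 * \<alpha>" for k
  define D where "D k = g x0 * c * (u (k, True) * (f x0 * c * of_int k) + u (k, False))" for k
  have split: "(\<Sum>i\<in>?A \<times> UNIV. w i) = (\<Sum>k\<in>?A. w (k, True) + w (k, False))" for w :: "int \<times> bool \<Rightarrow> real"
    by (simp add: sum.cartesian_product' UNIV_bool add.commute)
  have "(\<Sum>i\<in>?A \<times> UNIV. u i * Z' R \<omega> i)
      = (\<Sum>k\<in>?A. A k * (W (c * of_int k) \<omega> - W (c * of_int (k - 1)) \<omega>) + D k)" for \<omega>
    unfolding split
  proof (intro sum.cong refl)
    fix k assume k: "k \<in> ?A"
    \<comment> \<open>The increments of k (1 + k) are 2 k: the drift of a cell is evaluated at its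
      right end, \<open>k\<close> cells from the base point. This explains the asymmetric drift of
      the limit.\<close>
    have Z': "Z' R \<omega> (k, True) = g x0 * (\<alpha> * (W (c * of_int k) \<omega> - W (c * of_int (k - 1)) \<omega>) + 2 * \<beta> * c\<^sup>2 * of_int k)"
      "Z' R \<omega> (k, False) = g x0 * c"
      using k by (simp_all add: Z'_def path_def algebra_simps)
    show "u (k, True) * Z' R \<omega> (k, True) + u (k, False) * Z' R \<omega> (k, False)
        = A k * (W (c * of_int k) \<omega> - W (c * of_int (k - 1)) \<omega>) + D k"
      unfolding Z' A_def D_def unfolding \<beta> by (simp add: algebra_simps power2_eq_square)
  qed
  then have "(\<integral>\<omega>. iexp (\<Sum>i\<in>?A \<times> UNIV. u i * Z' R \<omega> i) \<partial>\<Omega>)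
      = (\<integral>\<omega>. iexp (\<Sum>k\<in>?A. D k) * iexp (\<Sum>k\<in>?A. A k * (W (c * of_int k) \<omega> - W (c * of_int (k - 1)) \<omega>)) \<partial>\<Omega>)"
    by (simp only: sum.distrib of_real_add distrib_left exp_add mult.commute)
  also have "\<dots> = iexp (\<Sum>k\<in>?A. D k) * (\<integral>\<omega>. iexp (\<Sum>k\<in>?A. A k * (W (c * of_int k) \<omega> - W (c * of_int (k - 1)) \<omega>)) \<partial>\<Omega>)"
    by simp
  also have "(\<integral>\<omega>. iexp (\<Sum>k\<in>?A. A k * (W (c * of_int k) \<omega> - W (c * of_int (k - 1)) \<omega>)) \<partial>\<Omega>)
      = exp (- complex_of_real (\<Sum>k\<in>?A. (A k)\<^sup>2 * c / 2))"
  proof -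
    have "{- int R + 1..int R} = ?A" by auto
    then show ?thesis using increments_char[OF c, of A R] by (simp only:)
  qed
  also have "iexp (\<Sum>k\<in>?A. D k) * exp (- complex_of_real (\<Sum>k\<in>?A. (A k)\<^sup>2 * c / 2))
      = exp (\<Sum>k\<in>?A. \<i> * D k - complex_of_real ((A k)\<^sup>2 * c / 2))"
    by (simp only: exp_add[symmetric] of_real_sum sum_distrib_left sum_subtractf diff_conv_add_uminus[symmetric])
  also have "(\<Sum>k\<in>?A. \<i> * D k - complex_of_real ((A k)\<^sup>2 * c / 2)) = limit_exponent R u"
    unfolding limit_exponent_def
  proof (intro sum.cong refl)
    fix k
    have "0 \<le> F x0 * (1 - F x0) / g x0" using cdf_with_density_bounds(2,3)[OF F] positive by simp
    \<comment> \<open>This fixes \<alpha>: the increment variance g^2 \<alpha>^2 c must equal the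
      Bernoulli variance F (1 - F) times g c.\<close>
    then have "(A k)\<^sup>2 * c / 2 = g x0 * c * ((u (k, True))\<^sup>2 * (F x0 * (1 - F x0)) / 2)"
      using positive by (simp add: A_def \<alpha> power_mult_distrib) (simp add: power2_eq_square field_simps)
    then show "\<i> * D k - complex_of_real ((A k)\<^sup>2 * c / 2) = complex_of_real (g x0 * c) *
        (\<i> * complex_of_real (u (k, True) * (f x0 * c * of_int k) + u (k, False))
          - complex_of_real ((u (k, True))\<^sup>2 * (F x0 * (1 - F x0)) / 2))"
      by (simp only: D_def of_real_mult right_diff_distrib mult.left_commute)
  qed
  finally show ?thesis .
qed

lemma Z_weak_convergence:
  assumes H: "continuous_on UNIV H" and B: "\<And>v. \<bar>H v\<bar> \<le> (B::real)"
  shows "(\<lambda>n. \<integral>\<omega>. H (Z R n \<omega>) \<partial>M n) \<longlonglongrightarrow> (\<integral>\<omega>. H (Z' R \<omega>) \<partial>\<Omega>)"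
proof -
  \<comment> \<open>The cell sums belong to a genuine sample only for large \<open>n\<close>, so the
    sequences are shifted before the continuity theorem is applied.\<close>
  obtain n0 where n0: "\<And>n. n0 \<le> n \<Longrightarrow> grid_sample (M n) n F G a b (\<delta> n) (T n) (X n)"
    using eventually_grid_sample by (auto simp: eventually_sequentially)
  have "(\<lambda>n. \<integral>\<omega>. H (\<lambda>i. Z R (n + n0) \<omega> i) \<partial>M (n + n0)) \<longlonglongrightarrow> (\<integral>\<omega>. H (\<lambda>i. Z' R \<omega> i) \<partial>\<Omega>)"
  proof (rule multivariate_levy_continuity[where I = "{- int R<..int R} \<times> UNIV" and B = B
        and M = "\<lambda>n. M (n + n0)" and Z = "\<lambda>n i \<omega>. Z R (n + n0) \<omega> i" and M' = \<Omega> and Z' = "\<lambda>i \<omega>. Z' R \<omega> i" and h = H])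
    fix n
    interpret S: grid_sample "M (n + n0)" "n + n0" F G a b "\<delta> (n + n0)" "T (n + n0)" "X (n + n0)"
      by (rule n0) simp
    show "prob_space (M (n + n0))" by (rule S.prob_space_axioms)
    show "(\<lambda>\<omega>. Z R (n + n0) \<omega> i) \<in> borel_measurable (M (n + n0))" for i
      unfolding Z_def by (rule S.measurable_local_cells)
    show "Z R (n + n0) \<omega> i = 0" if "i \<notin> {- int R<..int R} \<times> UNIV" for i \<omega>
      using that by (cases i) (auto simp: Z_def S.local_cells_def)
  next
    show "prob_space \<Omega>" by (rule W_props)
    show "(\<lambda>\<omega>. Z' R \<omega> i) \<in> borel_measurable \<Omega>" for i by (rule measurable_Z')
    show "Z' R \<omega> i = 0" if "i \<notin> {- int R<..int R} \<times> UNIV" for i \<omega>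
      using that by (cases i) (auto simp: Z'_def)
    show "(\<lambda>n. \<integral>\<omega>. iexp (\<Sum>i\<in>{- int R<..int R} \<times> UNIV. u i * Z R (n + n0) \<omega> i) \<partial>M (n + n0))
        \<longlonglongrightarrow> (\<integral>\<omega>. iexp (\<Sum>i\<in>{- int R<..int R} \<times> UNIV. u i * Z' R \<omega> i) \<partial>\<Omega>)" for u
      unfolding Z'_char by (rule LIMSEQ_ignore_initial_segment[OF Z_char])
  qed (use H B in auto)
  then show ?thesis by (rule LIMSEQ_offset)
qed

end

section \<open>Convergence of the local process\<close>

lemma (in prob_space) expectation_diff_le:
  fixes u v :: "'a \<Rightarrow> real"
  assumes m[measurable]: "u \<in> borel_measurable M" "v \<in> borel_measurable M" "A \<in> sets M"
    and B: "\<And>\<omega>. \<bar>u \<omega>\<bar> \<le> B" "\<And>\<omega>. \<bar>v \<omega>\<bar> \<le> B"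
    and eq: "AE \<omega> in M. \<omega> \<notin> A \<longrightarrow> u \<omega> = v \<omega>"
  shows "\<bar>expectation u - expectation v\<bar> \<le> 2 * B * prob A"
proof -
  have int: "integrable M u" "integrable M v" using B by (auto intro!: integrable_const_bound[of _ B])
  have ind: "integrable M (indicator A :: 'a \<Rightarrow> real)"
    by (rule integrable_real_indicator) (auto simp: less_top[symmetric])
  have "\<bar>expectation u - expectation v\<bar> = \<bar>expectation (\<lambda>\<omega>. u \<omega> - v \<omega>)\<bar>" using int by simp
  also have "\<dots> \<le> expectation (\<lambda>\<omega>. \<bar>u \<omega> - v \<omega>\<bar>)" by (rule integral_abs_bound)
  also have "\<dots> \<le> expectation (\<lambda>\<omega>. 2 * B * indicator A \<omega>)"
  proof (rule integral_mono_AE)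
    show "integrable M (\<lambda>\<omega>. \<bar>u \<omega> - v \<omega>\<bar>)" using int by simp
    show "integrable M (\<lambda>\<omega>. 2 * B * indicator A \<omega>)" using ind by (rule integrable_mult_right)
    show "AE \<omega> in M. \<bar>u \<omega> - v \<omega>\<bar> \<le> 2 * B * indicator A \<omega>"
      using eq
    proof eventually_elim
      case (elim \<omega>)
      show ?case
      proof (cases "\<omega> \<in> A")
        case True then show ?thesis using B[of \<omega>] by simp
      qed (use elim in simp)
    qed
  qed
  also have "\<dots> = 2 * B * prob A" using ind by simp
  finally show ?thesis .
qed

context grid_limit_brownian
begin

text \<open>Half the limit of a scaled cell count, so that truncation is inactive in the limit and,
  with probability tending to one, for the sample.\<close>

definition q :: real where "q = g x0 * c / 2"

lemma q_pos: "0 < q" using positive c by (simp add: q_def)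

definition process :: "nat \<Rightarrow> 'a \<Rightarrow> int \<Rightarrow> real" where
  "process n \<omega> = local_process F a b c x0 n (\<lambda>j. X n j \<omega>) (\<lambda>j. status (T n j \<omega>) (X n j \<omega>))"

definition tail_event :: "nat \<Rightarrow> real \<Rightarrow> int \<Rightarrow> real \<Rightarrow> nat \<Rightarrow> 'a set" where
  "tail_event n s u0 B m0 = {\<omega> \<in> space (M n).
     \<exists>m\<in>{m0..max_distance n s u0}. dev n s (theta B n) (cells n s u0 m) \<omega> < 0}"

definition count_event :: "nat \<Rightarrow> nat \<Rightarrow> 'a set" where
  "count_event R n = {\<omega> \<in> space (M n). \<exists>k\<in>{- int R<..int R}. Z R n \<omega> (k, False) < q}"

text \<open>Each line has a steep side, where the tilt helps and failure is excluded from distance 1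
  on, and a flat side, where it is excluded only from the edge of the window: distance R - N from
  offset N and R - N - 1 from -N-1.\<close>

definition bad_event :: "nat \<Rightarrow> nat \<Rightarrow> real \<Rightarrow> nat \<Rightarrow> 'a set" where
  "bad_event N R B n = tail_event n 1 (int N) B (R - N) \<union> tail_event n (-1) (int N) B 1
     \<union> tail_event n 1 (- int N - 1) (- B) 1 \<union> tail_event n (-1) (- int N - 1) (- B) (R - N - 1) \<union> count_event R n"

lemma eventually_events:
  "\<forall>\<^sub>F n in sequentially. (\<forall>s u0 B m0. tail_event n s u0 B m0 \<in> sets (M n)) \<and> (\<forall>R. count_event R n \<in> sets (M n))"
  using eventually_grid_sample
proof eventually_elim
  case (elim n)
  then interpret S: grid_sample "M n" n F G a b "\<delta> n" "T n" "X n" .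
  have d: "(\<lambda>\<omega>. dev n s \<theta> J \<omega>) \<in> borel_measurable (M n)" if "finite J" for s \<theta> J
    unfolding dev_def S.deviation_cells[OF that] using S.measurable_cell(2) by measurable
  have "finite (cells n s u0 m)" for s u0 m by (simp add: cells_def Let_def)
  from d[OF this] have [measurable]: "(\<lambda>\<omega>. dev n s \<theta> (cells n s u0 m) \<omega>) \<in> borel_measurable (M n)" for s \<theta> u0 m .
  have [measurable]: "(\<lambda>\<omega>. Z R n \<omega> i) \<in> borel_measurable (M n)" for R i
    unfolding Z_def by (rule S.measurable_local_cells)
  show ?case unfolding tail_event_def count_event_def by measurable
qed

lemma eventually_process_measurable:
  "\<forall>\<^sub>F n in sequentially. \<forall>i. (\<lambda>\<omega>. process n \<omega> i) \<in> borel_measurable (M n)"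
  using eventually_grid_sample
proof eventually_elim
  case (elim n)
  then interpret S: grid_sample "M n" n F G a b "\<delta> n" "T n" "X n" .
  have [measurable]: "(\<lambda>\<omega>. npmle a b n (\<lambda>j. X n j \<omega>) (\<lambda>j. status (T n j \<omega>) (X n j \<omega>)) s) \<in> borel_measurable (M n)" for s
    by (rule measurable_npmle) (use S.measurable_sample in auto)
  show ?case unfolding process_def local_process_def Let_def by measurable
qed

text \<open>The localisation is exact, not approximate. It is only almost sure because observations
  may leave the grid on a null set.\<close>

lemma eventually_process_eq:
  assumes R: "N < R"
  shows "\<forall>\<^sub>F n in sequentially. AE \<omega> in M n. \<omega> \<notin> bad_event N R B n \<longrightarrow>
    (\<forall>i\<in>{- int N..int N}. process n \<omega> i = window_slope q (int R) (Z R n \<omega>) i)"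
  using eventually_grid_sample eventually_window[of "int R + 1"] eventually_last_grid_point eventually_gt_at_top[of 0]
proof eventually_elim
  case (elim n)
  then interpret S: grid_sample "M n" n F G a b "\<delta> n" "T n" "X n" by simp
  have "AE \<omega> in M n. \<forall>j\<in>{1..n}. X n j \<omega> \<in> t n ` {1..K n}"
    using S.AE_X_grid by (intro AE_finite_allI) auto
  then show ?case
    using AE_space
  proof eventually_elim
    case (elim \<omega>)
    then have \<omega>: "S.on_grid \<omega>" "\<omega> \<in> space (M n)" by (auto simp: S.on_grid_def)
    show ?case
    proof (intro impI ballI)
      fix i assume good: "\<omega> \<notin> bad_event N R B n" and i: "i \<in> {- int N..int N}"
      have tail: "0 \<le> S.deviation s (theta B' n) (cells n s u0 m) \<omega>"
        if "\<omega> \<notin> tail_event n s u0 B' m0" "m \<in> {m0..max_distance n s u0}" for s u0 B' m0 m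
      proof (rule ccontr)
        assume "\<not> ?thesis"
        then have "dev n s (theta B' n) (cells n s u0 m) \<omega> < 0" by (simp add: dev_def)
        then have "\<omega> \<in> tail_event n s u0 B' m0" unfolding tail_event_def using that(2) \<omega>(2) by blast
        then show False using that(1) by blast
      qed
      have not: "\<omega> \<notin> tail_event n 1 (int N) B (R - N)" "\<omega> \<notin> tail_event n (-1) (int N) B 1"
        "\<omega> \<notin> tail_event n 1 (- int N - 1) (- B) 1" "\<omega> \<notin> tail_event n (-1) (- int N - 1) (- B) (R - N - 1)"
        "\<omega> \<notin> count_event R n" using good by (auto simp: bad_event_def)
      have lo: "int (l n) - int N - 1 = int (l n) + (- int N - 1)" by simp
      have "(npmle a b n (\<lambda>j. X n j \<omega>) (\<lambda>j. status (T n j \<omega>) (X n j \<omega>)) (t n (nat (int (l n) + i))) - F (t n (l n))) / h n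
          = window_slope q (int R) (S.local_cells (h n) (l n) (int R) \<omega>) i"
      proof (rule S.npmle_local_cells[OF \<omega>(1), where N = "int N" and \<theta>lo = "theta (- B) n" and \<theta>hi = "theta B n"])
        show "int R < int (l n)" "int (l n) + int R \<le> int (K n)"
          using \<open>int R + 1 < int (l n) \<and> _\<close> by auto
        show "0 < h n" using h_pos \<open>0 < n\<close> by simp
        show "q \<le> S.local_cells (h n) (l n) (int R) \<omega> (k, False)" if "k \<in> {- int R<..int R}" for k
          using not(5) that \<omega>(2) unfolding count_event_def Z_def by force
        show "0 \<le> S.deviation 1 (theta B n) {nat (int (l n) + int N)<..nat (int (l n) + int N) + m} \<omega>"
          if "m \<in> {nat (int R - int N)..K n - nat (int (l n) + int N)}" for m
        proof -
          have "nat (int R - int N) = R - N" using R by simp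
          then show ?thesis using tail[OF not(1), of m] that by (simp add: cells_def max_distance_def Let_def)
        qed
        show "0 \<le> S.deviation (- 1) (theta B n) {nat (int (l n) + int N) - m<..nat (int (l n) + int N)} \<omega>"
          if "m \<in> {1..nat (int (l n) + int N)}" for m
          using tail[OF not(2), of m] that by (simp add: cells_def max_distance_def Let_def)
        show "0 \<le> S.deviation 1 (theta (- B) n) {nat (int (l n) - int N - 1)<..nat (int (l n) - int N - 1) + m} \<omega>"
          if "m \<in> {1..K n - nat (int (l n) - int N - 1)}" for m
          using tail[OF not(3), of m] that unfolding lo by (simp only: cells_def max_distance_def Let_def) simp
        show "0 \<le> S.deviation (- 1) (theta (- B) n) {nat (int (l n) - int N - 1) - m<..nat (int (l n) - int N - 1)} \<omega>"
          if "m \<in> {nat (int R - int N - 1)..nat (int (l n) - int N - 1)}" for m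
        proof -
          have "nat (int R - int N - 1) = R - N - 1" using R by simp
          then show ?thesis
            using tail[OF not(4), of m] that unfolding lo by (simp only: cells_def max_distance_def Let_def) simp
        qed
      qed (use R i q_pos in auto)
      moreover have "t n (nat (int (l n) + i)) = t n (l n) + c * of_int i * real n powr (- (1 / 3))"
      proof -
        have "0 \<le> int (l n) + i" using \<open>int R + 1 < int (l n) \<and> _\<close> i R by auto
        from grid_point_shift[OF this] show ?thesis by (simp add: \<delta>_eq h_def)
      qed
      moreover have "real n powr (1/3) * A = A / h n" for A
        unfolding inverse_h[OF \<open>0 < n\<close>, symmetric] by simp
      ultimately show "process n \<omega> i = window_slope q (int R) (Z R n \<omega>) i"
        using \<open>last_grid_point a b (\<delta> n) x0 = t n (l n)\<close>
        unfolding process_def local_process_def Let_def Z_def by simp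
    qed
  qed
qed

text \<open>The scaled counts have a constant limit above \<open>q\<close>, so a continuous function
  that dominates the indicator and vanishes at that constant has mean tending to 0.\<close>

lemma eventually_count_event:
  assumes e: "0 < e" shows "\<forall>\<^sub>F n in sequentially. measure (M n) (count_event R n) < e"
proof -
  let ?A = "{- int R<..int R}"
  \<comment> \<open>Equal to 1 below \<open>q\<close> and to 0 from 2 q = g c on.\<close>
  define \<phi> where "\<phi> v = min 1 (max 0 (2 - v / q))" for v :: real
  have \<phi>: "0 \<le> \<phi> v" "\<phi> v \<le> 1" "v < q \<Longrightarrow> \<phi> v = 1" "\<phi> (g x0 * c) = 0" for v
    using q_pos by (auto simp: \<phi>_def q_def field_simps)
  define H where "H v = (\<Sum>k\<in>?A. \<phi> (v (k, False)))" for v :: "int \<times> bool \<Rightarrow> real"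
  have H0: "0 \<le> H v" for v unfolding H_def using \<phi> by (intro sum_nonneg)
  have "H v \<le> (\<Sum>k\<in>?A. 1)" for v unfolding H_def using \<phi> by (intro sum_mono)
  then have HB: "\<bar>H v\<bar> \<le> real (card ?A)" for v using H0[of v] by simp
  have Hc: "continuous_on UNIV H"
    unfolding H_def[abs_def] \<phi>_def divide_inverse by (intro continuous_intros continuous_on_product_coordinates)
  have "(\<lambda>n. \<integral>\<omega>. H (Z R n \<omega>) \<partial>M n) \<longlonglongrightarrow> (\<integral>\<omega>. H (Z' R \<omega>) \<partial>\<Omega>)"
    by (rule Z_weak_convergence[OF Hc HB])
  moreover have "H (Z' R \<omega>) = 0" for \<omega> unfolding H_def by (intro sum.neutral) (simp add: Z'_def \<phi>)
  ultimately have "(\<lambda>n. \<integral>\<omega>. H (Z R n \<omega>) \<partial>M n) \<longlonglongrightarrow> 0" by simp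
  then have "\<forall>\<^sub>F n in sequentially. (\<integral>\<omega>. H (Z R n \<omega>) \<partial>M n) < e" using e by (auto dest: order_tendstoD)
  then show ?thesis
    using eventually_grid_sample eventually_events
  proof eventually_elim
    case (elim n)
    then interpret S: grid_sample "M n" n F G a b "\<delta> n" "T n" "X n" by simp
    have ev: "count_event R n \<in> sets (M n)" using elim by blast
    have [measurable]: "Z R n \<in> borel_measurable (M n)"
      unfolding Z_def by (intro measurable_coordinatewise_then_product S.measurable_local_cells)
    have [measurable]: "H \<in> borel_measurable borel" by (rule borel_measurable_continuous_onI[OF Hc])
    have "measure (M n) (count_event R n) = (\<integral>\<omega>. indicator (count_event R n) \<omega> \<partial>M n)"
      using sets.sets_into_space[OF ev] by (simp add: Int_absorb2)
    also have "\<dots> \<le> (\<integral>\<omega>. H (Z R n \<omega>) \<partial>M n)"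
    proof (rule integral_mono)
      show "integrable (M n) (indicator (count_event R n) :: _ \<Rightarrow> real)"
        using ev by (intro integrable_real_indicator) (auto simp: less_top[symmetric])
      show "integrable (M n) (\<lambda>\<omega>. H (Z R n \<omega>))"
        by (rule S.integrable_const_bound[of _ "real (card ?A)"]) (use HB in auto)
      fix \<omega>
      show "indicator (count_event R n) \<omega> \<le> H (Z R n \<omega>)"
      proof (cases "\<omega> \<in> count_event R n")
        case True
        then obtain k where k: "k \<in> ?A" "Z R n \<omega> (k, False) < q" by (auto simp: count_event_def)
        then have "1 = \<phi> (Z R n \<omega> (k, False))" using \<phi>(3) by simp
        also have "\<dots> \<le> H (Z R n \<omega>)" unfolding H_def using k \<phi>(1) by (intro member_le_sum) auto
        finally show ?thesis using True by simp
      qed (simp add: H0)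
    qed
    also have "\<dots> < e" by (rule elim(1))
    finally show ?case .
  qed
qed

text \<open>The choices are made in the order \<open>e\<close>, \<open>L\<close>, \<open>B\<close>,
  \<open>R0\<close>; the steep sides determine \<open>B\<close>, and the flat sides then determine
  how large the window has to be.\<close>

lemma eventually_bad_event:
  assumes e: "0 < e"
  obtains B R0 where "\<And>R. R0 \<le> R \<Longrightarrow> \<forall>\<^sub>F n in sequentially. measure (M n) (bad_event N R B n) \<le> 5 * e"
proof -
  obtain C where C: "0 \<le> C" and tail: "\<And>s u0 B L m0. s = 1 \<or> s = -1 \<Longrightarrow> 0 < L \<Longrightarrow> 1 \<le> m0 \<Longrightarrow>
    (\<And>m. m0 \<le> m \<Longrightarrow> L * sqrt (real m ^ 3) \<le> (g x0 * f x0 / 4) * (real m)\<^sup>2 / 2 - drift_loss s u0 B * real m) \<Longrightarrow>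
    \<forall>\<^sub>F n in sequentially. measure (M n) (tail_event n s u0 B m0) \<le> C / L\<^sup>2"
    using deviation_tail_limit unfolding tail_event_def by blast
  define E where "E = g x0 * f x0 / 4"
  have E: "0 < E" using positive by (simp add: E_def)
  \<comment> \<open>The summand 1 keeps \<open>L\<close> positive when \<open>C\<close> is
    0.\<close>
  define L where "L = sqrt (C / e) + 1"
  have L: "0 < L" "C / L\<^sup>2 \<le> e"
  proof -
    have s0: "0 \<le> sqrt (C / e)" using C e by simp
    then show "0 < L" unfolding L_def by linarith
    have "C / e = (sqrt (C / e))\<^sup>2" using C e by simp
    also have "\<dots> \<le> L\<^sup>2" unfolding L_def using s0 by (intro power_mono) auto
    finally show "C / L\<^sup>2 \<le> e" using \<open>0 < L\<close> e by (simp add: field_simps)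
  qed
  define d where "d = L\<^sup>2 / (2 * E)"
  have d: "0 \<le> d" using E by (simp add: d_def)
  \<comment> \<open>Cancels the offset term for all \<bar>u0\<bar> \<le> N + 1 and leaves a gain of
    \<open>d\<close> even at the smaller cell weight g/2, exactly what
    \<open>quadratic_dominates_steep\<close> asks for.\<close>
  define B where "B = c * (3 / 2 * f x0 * (real N + 2) + 2 * d / g x0)"
  have steep: "d \<le> - drift_loss s u0 \<beta>'" if "s * \<beta>' = - B" "\<bar>real_of_int u0\<bar> \<le> real N + 1" for s \<beta>' u0
  proof -
    define A where "A = 3 / 2 * f x0 * (\<bar>real_of_int u0\<bar> + 1) + s * \<beta>' / c"
    have "3 / 2 * f x0 * (\<bar>real_of_int u0\<bar> + 1) \<le> 3 / 2 * f x0 * (real N + 2)"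
      using that(2) positive by (intro mult_left_mono) auto
    moreover have "s * \<beta>' / c = - (3 / 2 * f x0 * (real N + 2) + 2 * d / g x0)"
      unfolding that(1) B_def using c by simp
    ultimately have A: "A \<le> - (2 * d / g x0)" by (simp add: A_def)
    have "g x0 / 2 * A \<le> g x0 / 2 * - (2 * d / g x0)" using A positive by (intro mult_left_mono) auto
    also have "\<dots> = - d" using positive by simp
    finally have 1: "g x0 / 2 * A \<le> - d" .
    have "3 / 2 * g x0 * A = 3 * (g x0 / 2 * A)" by simp
    then have 2: "3 / 2 * g x0 * A \<le> - d" using 1 d by linarith
    show ?thesis using 1 2 unfolding drift_loss_def Let_def A_def[symmetric] by simp
  qed
  have quad: "L * sqrt (real m ^ 3) \<le> (g x0 * f x0 / 4) * (real m)\<^sup>2 / 2 - drift_loss s u0 \<beta>' * real m"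
    if "s * \<beta>' = - B" "\<bar>real_of_int u0\<bar> \<le> real N + 1" for s \<beta>' u0 m
    using quadratic_dominates_steep[OF E, of L "- drift_loss s u0 \<beta>'" "real m"] steep[OF that] unfolding d_def E_def by simp
  \<comment> \<open>On the flat sides the tilt \<open>B\<close> counts as a loss, overcome only from
    a certain distance on.\<close>
  obtain m1 where m1: "1 \<le> m1" "\<And>m. m1 \<le> m \<Longrightarrow> L * sqrt (real m ^ 3) \<le> E * (real m)\<^sup>2 / 2 - drift_loss 1 (int N) B * real m"
    using quadratic_dominates_flat[OF E] by blast
  obtain m2 where m2: "1 \<le> m2" "\<And>m. m2 \<le> m \<Longrightarrow> L * sqrt (real m ^ 3) \<le> E * (real m)\<^sup>2 / 2 - drift_loss (-1) (- int N - 1) (- B) * real m"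
    using quadratic_dominates_flat[OF E] by blast
  show thesis
  proof (rule that[of "N + 1 + m1 + m2" B])
    fix R assume R: "N + 1 + m1 + m2 \<le> R"
    have t1: "\<forall>\<^sub>F n in sequentially. measure (M n) (tail_event n 1 (int N) B (R - N)) \<le> C / L\<^sup>2"
      using R m1 by (intro tail L(1)) (auto simp: E_def)
    have t2: "\<forall>\<^sub>F n in sequentially. measure (M n) (tail_event n (-1) (int N) B 1) \<le> C / L\<^sup>2"
      by (intro tail L(1) quad) auto
    have t3: "\<forall>\<^sub>F n in sequentially. measure (M n) (tail_event n 1 (- int N - 1) (- B) 1) \<le> C / L\<^sup>2"
      by (intro tail L(1) quad) auto
    have t4: "\<forall>\<^sub>F n in sequentially. measure (M n) (tail_event n (-1) (- int N - 1) (- B) (R - N - 1)) \<le> C / L\<^sup>2"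
    proof (rule tail[OF _ L(1)])
      show "1 \<le> R - N - 1" using R m1 by simp
      fix m assume "R - N - 1 \<le> m"
      then show "L * sqrt (real m ^ 3) \<le> g x0 * f x0 / 4 * (real m)\<^sup>2 / 2 - drift_loss (- 1) (- int N - 1) (- B) * real m"
        using m2(2)[of m] R unfolding E_def by simp
    qed simp
    show "\<forall>\<^sub>F n in sequentially. measure (M n) (bad_event N R B n) \<le> 5 * e"
      using t1 t2 t3 t4 eventually_count_event[OF e, of R] eventually_events eventually_grid_sample
    proof eventually_elim
      case (elim n)
      interpret S: grid_sample "M n" n F G a b "\<delta> n" "T n" "X n" by (rule elim(7))
      note Un = measure_Un_le[THEN order_trans]
      have ev: "tail_event n s u0 B m0 \<in> sets (M n)" "count_event R n \<in> sets (M n)" for s u0 B m0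
        using elim(6) by blast+
      have "measure (M n) (bad_event N R B n) \<le> C / L\<^sup>2 + C / L\<^sup>2 + C / L\<^sup>2 + C / L\<^sup>2 + e"
        unfolding bad_event_def using elim(1-5)
        by (intro Un add_mono sets.Un ev) (auto intro: less_imp_le)
      then show ?case using L(2) by simp
    qed
  qed
qed

lemma continuous_window_map:
  assumes "N < R"
  shows "continuous_on UNIV (\<lambda>v. \<lambda>i\<in>{- int N..int N}. window_slope q (int R) v i)"
proof (rule continuous_on_coordinatewise_then_product)
  fix i
  show "continuous_on UNIV (\<lambda>v. (\<lambda>i\<in>{- int N..int N}. window_slope q (int R) v i) i)"
    using assms continuous_window_slope[OF q_pos, of "int R" i] by (cases "i \<in> {- int N..int N}") auto
qed

text \<open>The limiting counts are twice the truncation level, and the factor g(x0) cancels between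
  numerator and denominator.\<close>

lemma limit_window_slope:
  assumes i: "- int R < i" "i \<le> int R"
  shows "window_slope q (int R) (Z' R \<omega>) i = maxmin_slope (int R) (\<lambda>k. c * of_int k) (path c \<alpha> \<beta> \<omega>) i"
proof -
  have "window_slope q (int R) (Z' R \<omega>) i = 1 * (maxmin_slope (int R) (\<lambda>k. c * of_int k) (path c \<alpha> \<beta> \<omega>) i - 0)"
  proof (rule window_slope_eq_maxmin[OF i])
    fix j m assume jm: "j \<in> {- int R..i - 1}" "m \<in> {i..int R}"
    then have le: "j \<le> m" and sub: "\<And>k. k \<in> {j<..m} \<Longrightarrow> k \<in> {- int R<..int R}" by auto
    have "(\<Sum>k\<in>{j<..m}. Z' R \<omega> (k, True)) = (\<Sum>k\<in>{j<..m}. g x0 * path c \<alpha> \<beta> \<omega> k - g x0 * path c \<alpha> \<beta> \<omega> (k - 1))"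
      using sub by (intro sum.cong refl) (auto simp: Z'_def right_diff_distrib)
    also have "\<dots> = g x0 * (path c \<alpha> \<beta> \<omega> m - path c \<alpha> \<beta> \<omega> j)"
      using sum_telescope_int[OF le, of "\<lambda>k. g x0 * path c \<alpha> \<beta> \<omega> k"] by (simp add: right_diff_distrib)
    finally have num: "(\<Sum>k\<in>{j<..m}. Z' R \<omega> (k, True)) = g x0 * (path c \<alpha> \<beta> \<omega> m - path c \<alpha> \<beta> \<omega> j)" .
    have "(\<Sum>k\<in>{j<..m}. max q (Z' R \<omega> (k, False))) = (\<Sum>k\<in>{j<..m}. g x0 * c)"
      using sub positive c by (intro sum.cong refl) (auto simp: Z'_def q_def)
    also have "\<dots> = g x0 * (c * of_int m - c * of_int j)" using le by (simp add: algebra_simps)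
    finally have den: "(\<Sum>k\<in>{j<..m}. max q (Z' R \<omega> (k, False))) = g x0 * (c * of_int m - c * of_int j)" .
    show "(\<Sum>k\<in>{j<..m}. Z' R \<omega> (k, True)) / (\<Sum>k\<in>{j<..m}. max q (Z' R \<omega> (k, False)))
        = 1 * ((path c \<alpha> \<beta> \<omega> m - path c \<alpha> \<beta> \<omega> j) / (c * of_int m - c * of_int j) - 0)"
      unfolding num den using positive by simp
  qed simp
  then show ?thesis by simp
qed

text \<open>Three errors are balanced: estimator against its window version, controlled by the bad
  event; the window version as n grows, by the continuity theorem; and the limiting window version
  as R grows, by dominated convergence.\<close>

theorem process_convergence:
  "converges_in_distribution M (\<lambda>n \<omega>. \<lambda>i\<in>{- int N..int N}. process n \<omega> i)
     \<Omega> (\<lambda>\<omega>. \<lambda>i\<in>{- int N..int N}. limit_slope c \<alpha> \<beta> (\<lambda>t. W t \<omega>) i)"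
proof -
  let ?r = "\<lambda>v. \<lambda>i\<in>{- int N..int N}. v i"
  let ?P = "\<lambda>n \<omega>. \<lambda>i\<in>{- int N..int N}. process n \<omega> i"
  let ?L = "\<lambda>\<omega>. \<lambda>i\<in>{- int N..int N}. limit_slope c \<alpha> \<beta> (\<lambda>t. W t \<omega>) i"
  define \<Phi> where "\<Phi> R v = (\<lambda>i\<in>{- int N..int N}. window_slope q (int R) v i)" for R v
  have \<beta>0: "0 < \<beta>" using positive by (simp add: \<beta>)
  have P: "\<forall>\<^sub>F n in sequentially. ?P n \<in> borel_measurable (M n)"
    using eventually_process_measurable
  proof eventually_elim
    case (elim n)
    show ?case
    proof (rule measurable_coordinatewise_then_product)
      show "(\<lambda>\<omega>. ?P n \<omega> i) \<in> borel_measurable (M n)" for i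
        using elim by (cases "i \<in> {- int N..int N}") auto
    qed
  qed
  have L[measurable]: "?L \<in> borel_measurable \<Omega>"
  proof (rule measurable_coordinatewise_then_product)
    show "(\<lambda>\<omega>. ?L \<omega> i) \<in> borel_measurable \<Omega>" for i
      using measurable_limit_slope[OF c W_props(2)] by (cases "i \<in> {- int N..int N}") auto
  qed
  have Z'[measurable]: "Z' R \<in> borel_measurable \<Omega>" for R
    by (intro measurable_coordinatewise_then_product measurable_Z')
  have lim: "(\<lambda>n. \<integral>\<omega>. H (?P n \<omega>) \<partial>M n) \<longlonglongrightarrow> (\<integral>\<omega>. H (?L \<omega>) \<partial>\<Omega>)"
    if H: "continuous_on UNIV H" and bd: "bounded (range H)" for H :: "(int \<Rightarrow> real) \<Rightarrow> real"
  proof (rule tendstoI)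
    fix r :: real assume r: "0 < r"
    obtain B0 where B0: "\<And>v. \<bar>H v\<bar> \<le> B0" using bd by (auto simp: bounded_iff)
    have B0': "0 \<le> B0" using B0 abs_ge_zero order_trans by blast
    have [measurable]: "H \<in> borel_measurable borel" by (rule borel_measurable_continuous_onI[OF H])
    have \<Phi>c: "continuous_on UNIV (\<Phi> R)" if "N < R" for R
      using continuous_window_map[OF that] unfolding \<Phi>_def[abs_def] .
    have H\<Phi>: "continuous_on UNIV (\<lambda>v. H (\<Phi> R v))" if "N < R" for R
      by (rule continuous_on_compose2[OF H \<Phi>c[OF that]]) simp
    \<comment> \<open>The window map is known to be continuous, hence measurable, only for windows
      larger than \<open>N\<close>.\<close>
    have "(\<lambda>R. \<integral>\<omega>. H (\<Phi> (R + Suc N) (Z' (R + Suc N) \<omega>)) \<partial>\<Omega>) \<longlonglongrightarrow> (\<integral>\<omega>. H (?L \<omega>) \<partial>\<Omega>)"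
    proof (rule integral_dominated_convergence[where w = "\<lambda>_. B0"])
      show "(\<lambda>\<omega>. H (\<Phi> (R + Suc N) (Z' (R + Suc N) \<omega>))) \<in> borel_measurable \<Omega>" for R
        by (rule measurable_compose[OF Z' borel_measurable_continuous_onI[OF H\<Phi>]]) simp
      show "AE \<omega> in \<Omega>. (\<lambda>R. H (\<Phi> (R + Suc N) (Z' (R + Suc N) \<omega>))) \<longlonglongrightarrow> H (?L \<omega>)"
        using AE_limit_slope_window[OF c \<beta>0, of \<alpha>]
      proof eventually_elim
        case (elim \<omega>)
        then have "\<forall>\<^sub>F R in sequentially. \<forall>i\<in>{- int N..int N}. limit_slope c \<alpha> \<beta> (\<lambda>t. W t \<omega>) i
            = maxmin_slope (int R) (\<lambda>k. c * of_int k) (path c \<alpha> \<beta> \<omega>) i"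
          by (intro eventually_ball_finite) auto
        then have "\<forall>\<^sub>F R in sequentially. \<Phi> R (Z' R \<omega>) = ?L \<omega>"
          using eventually_gt_at_top[of N]
        proof eventually_elim
          case (elim R)
          show ?case unfolding \<Phi>_def
            by (intro restrict_ext) (use elim limit_window_slope in auto)
        qed
        then have "\<forall>\<^sub>F R in sequentially. H (\<Phi> R (Z' R \<omega>)) = H (?L \<omega>)" by eventually_elim simp
        then have "(\<lambda>R. H (\<Phi> R (Z' R \<omega>))) \<longlonglongrightarrow> H (?L \<omega>)" by (rule tendsto_eventually)
        then show ?case by (rule LIMSEQ_ignore_initial_segment)
      qed
    qed (use B0 in auto)
    then have "(\<lambda>R. \<integral>\<omega>. H (\<Phi> R (Z' R \<omega>)) \<partial>\<Omega>) \<longlonglongrightarrow> (\<integral>\<omega>. H (?L \<omega>) \<partial>\<Omega>)" by (rule LIMSEQ_offset)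
    then have "\<forall>\<^sub>F R in sequentially. dist (\<integral>\<omega>. H (\<Phi> R (Z' R \<omega>)) \<partial>\<Omega>) (\<integral>\<omega>. H (?L \<omega>) \<partial>\<Omega>) < r / 3"
      using r by (intro tendstoD) auto
    then obtain R1 where R1: "\<And>R. R1 \<le> R \<Longrightarrow> dist (\<integral>\<omega>. H (\<Phi> R (Z' R \<omega>)) \<partial>\<Omega>) (\<integral>\<omega>. H (?L \<omega>) \<partial>\<Omega>) < r / 3"
      by (auto simp: eventually_sequentially)
    \<comment> \<open>The bad event has probability at most 5 e and the integrands differ there by
      at most 2 B0; this makes the product at most r/3.\<close>
    define e where "e = r / (30 * (B0 + 1))"
    have e: "0 < e" "2 * B0 * (5 * e) \<le> r / 3"
      using r B0' by (auto simp: e_def field_simps)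
    obtain B R0 where BR: "\<And>R. R0 \<le> R \<Longrightarrow> \<forall>\<^sub>F n in sequentially. measure (M n) (bad_event N R B n) \<le> 5 * e"
      using eventually_bad_event[OF e(1)] by blast
    define R where "R = max (Suc N) (max R0 R1)"
    have R: "N < R" "R0 \<le> R" "R1 \<le> R" by (auto simp: R_def)
    have "(\<lambda>n. \<integral>\<omega>. H (\<Phi> R (Z R n \<omega>)) \<partial>M n) \<longlonglongrightarrow> (\<integral>\<omega>. H (\<Phi> R (Z' R \<omega>)) \<partial>\<Omega>)"
      by (rule Z_weak_convergence[OF H\<Phi>[OF R(1)] B0])
    then have zw: "\<forall>\<^sub>F n in sequentially. dist (\<integral>\<omega>. H (\<Phi> R (Z R n \<omega>)) \<partial>M n) (\<integral>\<omega>. H (\<Phi> R (Z' R \<omega>)) \<partial>\<Omega>) < r / 3"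
      using r by (intro tendstoD) auto
    show "\<forall>\<^sub>F n in sequentially. dist (\<integral>\<omega>. H (?P n \<omega>) \<partial>M n) (\<integral>\<omega>. H (?L \<omega>) \<partial>\<Omega>) < r"
      using zw BR[OF R(2)] eventually_process_eq[OF R(1), of B] P eventually_events eventually_grid_sample
    proof eventually_elim
      case (elim n)
      interpret S: grid_sample "M n" n F G a b "\<delta> n" "T n" "X n" by (rule elim(6))
      have Zm: "Z R n \<in> borel_measurable (M n)"
        unfolding Z_def by (intro measurable_coordinatewise_then_product S.measurable_local_cells)
      have "\<bar>(\<integral>\<omega>. H (?P n \<omega>) \<partial>M n) - (\<integral>\<omega>. H (\<Phi> R (Z R n \<omega>)) \<partial>M n)\<bar> \<le> 2 * B0 * measure (M n) (bad_event N R B n)"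
      proof (rule S.expectation_diff_le)
        show "(\<lambda>\<omega>. H (?P n \<omega>)) \<in> borel_measurable (M n)"
          by (rule measurable_compose[OF elim(4) borel_measurable_continuous_onI[OF H]])
        show "(\<lambda>\<omega>. H (\<Phi> R (Z R n \<omega>))) \<in> borel_measurable (M n)"
          by (rule measurable_compose[OF Zm borel_measurable_continuous_onI[OF H\<Phi>[OF R(1)]]])
        show "bad_event N R B n \<in> sets (M n)" unfolding bad_event_def
          by (intro sets.Un elim(5)[THEN conjunct1, rule_format] elim(5)[THEN conjunct2, rule_format])
        show "AE \<omega> in M n. \<omega> \<notin> bad_event N R B n \<longrightarrow> H (?P n \<omega>) = H (\<Phi> R (Z R n \<omega>))"
          using elim(3)
        proof eventually_elim
          case (elim \<omega>)
          show ?case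
          proof
            assume "\<omega> \<notin> bad_event N R B n"
            then have "?P n \<omega> = \<Phi> R (Z R n \<omega>)" unfolding \<Phi>_def using elim by (intro restrict_ext) auto
            then show "H (?P n \<omega>) = H (\<Phi> R (Z R n \<omega>))" by simp
          qed
        qed
      qed (use B0 in auto)
      also have "\<dots> \<le> 2 * B0 * (5 * e)" using elim(2) B0' by (intro mult_left_mono) auto
      also have "\<dots> \<le> r / 3" by (rule e(2))
      finally show ?case using elim(1) R1[OF R(3)] unfolding dist_real_def by linarith
    qed
  qed
  show ?thesis
    unfolding converges_in_distribution_def
  proof (intro conjI allI impI)
    fix H :: "(int \<Rightarrow> real) \<Rightarrow> real" assume "continuous_on UNIV H \<and> bounded (range H)"
    then show "(\<lambda>n. \<integral>\<omega>. H (?P n \<omega>) \<partial>M n) \<longlonglongrightarrow> (\<integral>\<omega>. H (?L \<omega>) \<partial>\<Omega>)" by (elim conjE) (rule lim)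
  qed (rule P L)+
qed

end

section \<open>Weak convergence at a single grid point\<close>

lemma weak_conv_m_if_converges_in_distribution:
  fixes \<xi> :: "nat \<Rightarrow> 'a \<Rightarrow> real"
  assumes conv: "converges_in_distribution M \<xi> M' \<eta>" and M: "\<forall>\<^sub>F n in sequentially. prob_space (M n)" "prob_space M'"
  shows "weak_conv_m (\<lambda>n. distr (M n) borel (\<xi> n)) (distr M' borel \<eta>)"
proof -
  have "\<forall>\<^sub>F n in sequentially. prob_space (M n) \<and> \<xi> n \<in> borel_measurable (M n)"
    using M(1) conv by (intro eventually_conj) (auto simp: converges_in_distribution_def)
  then obtain n0 where n0: "\<And>n. n0 \<le> n \<Longrightarrow> prob_space (M n)" "\<And>n. n0 \<le> n \<Longrightarrow> \<xi> n \<in> borel_measurable (M n)"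
    by (auto simp: eventually_sequentially)
  have \<eta>: "\<eta> \<in> borel_measurable M'" using conv by (simp add: converges_in_distribution_def)
  \<comment> \<open>The shift drops the finitely many indices at which the image measure need not be
    a probability distribution.\<close>
  have "weak_conv_m (\<lambda>n. distr (M (n + n0)) borel (\<xi> (n + n0))) (distr M' borel \<eta>)"
  proof (rule integral_bdd_continuous_conv_imp_weak_conv)
    show "real_distribution (distr (M (n + n0)) borel (\<xi> (n + n0)))" for n
      using n0[of "n + n0"] by (intro prob_space.real_distribution_distr) auto
    show "real_distribution (distr M' borel \<eta>)" using M(2) \<eta> by (intro prob_space.real_distribution_distr)
    fix f :: "real \<Rightarrow> real" assume f: "\<And>x. isCont f x" "\<And>x. \<bar>f x\<bar> \<le> 1"
    have "continuous_on UNIV f" using f(1) by (simp add: continuous_at_imp_continuous_on)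
    moreover from this have [measurable]: "f \<in> borel_measurable borel" by (rule borel_measurable_continuous_onI)
    moreover have "bounded (range f)" using f(2) by (auto simp: bounded_iff)
    ultimately have "(\<lambda>n. \<integral>\<omega>. f (\<xi> n \<omega>) \<partial>M n) \<longlonglongrightarrow> (\<integral>\<omega>. f (\<eta> \<omega>) \<partial>M')"
      using conv by (auto simp: converges_in_distribution_def)
    from LIMSEQ_ignore_initial_segment[OF this, of n0]
    show "(\<lambda>n. integral\<^sup>L (distr (M (n + n0)) borel (\<xi> (n + n0))) f) \<longlonglongrightarrow> integral\<^sup>L (distr M' borel \<eta>) f"
      using n0(2) \<eta> by (simp add: integral_distr)
  qed
  then have "(\<lambda>n. cdf (distr (M n) borel (\<xi> n)) x) \<longlonglongrightarrow> cdf (distr M' borel \<eta>) x"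
    if "isCont (cdf (distr M' borel \<eta>)) x" for x
    using that by - (rule LIMSEQ_offset[where k = n0], simp add: weak_conv_m_def weak_conv_def)
  then show ?thesis unfolding weak_conv_m_def weak_conv_def by (intro allI impI)
qed

lemma converges_in_distribution_compose:
  fixes \<phi> :: "'c::topological_space \<Rightarrow> 'd::topological_space"
  assumes conv: "converges_in_distribution M \<xi> M' \<eta>" and \<phi>: "continuous_on UNIV \<phi>"
  shows "converges_in_distribution M (\<lambda>n \<omega>. \<phi> (\<xi> n \<omega>)) M' (\<lambda>\<omega>. \<phi> (\<eta> \<omega>))"
  unfolding converges_in_distribution_def
proof (intro conjI allI impI)
  note conv = conv[unfolded converges_in_distribution_def]
  have m: "\<phi> \<in> borel_measurable borel" by (rule borel_measurable_continuous_onI[OF \<phi>])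
  show "\<forall>\<^sub>F n in sequentially. (\<lambda>\<omega>. \<phi> (\<xi> n \<omega>)) \<in> borel_measurable (M n)"
    using conv[THEN conjunct1] by eventually_elim (rule measurable_compose[OF _ m])
  show "(\<lambda>\<omega>. \<phi> (\<eta> \<omega>)) \<in> borel_measurable M'"
    by (rule measurable_compose[OF conv[THEN conjunct2, THEN conjunct1] m])
  fix h :: "'d \<Rightarrow> real" assume h: "continuous_on UNIV h \<and> bounded (range h)"
  have "continuous_on UNIV (\<lambda>v. h (\<phi> v))"
    by (rule continuous_on_compose2[OF conjunct1[OF h] \<phi>]) simp
  moreover have "bounded (range (\<lambda>v. h (\<phi> v)))"
    by (rule bounded_subset[OF conjunct2[OF h]]) auto
  ultimately show "(\<lambda>n. \<integral>\<omega>. h (\<phi> (\<xi> n \<omega>)) \<partial>M n) \<longlonglongrightarrow> (\<integral>\<omega>. h (\<phi> (\<eta> \<omega>)) \<partial>M')"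
    by (intro conv[THEN conjunct2, THEN conjunct2, rule_format] conjI)
qed

theorem theorem3p7:
  fixes F G f g :: "real \<Rightarrow> real"
    and a a' b x\<^sub>0 c \<alpha> \<beta> :: real and b' :: ereal and N :: nat
    and M :: "nat \<Rightarrow> 'a measure" and T X :: "nat \<Rightarrow> nat \<Rightarrow> 'a \<Rightarrow> real"
    and \<Omega> :: "'b measure" and W :: "real \<Rightarrow> 'b \<Rightarrow> real"
  assumes F: "cdf_with_density F f"
    and F_range: "emeasure (density lborel f) {x. a' \<le> x \<and> ereal x \<le> b'} = 1"
    and interval: "0 \<le> a'" "ereal a' < b'" "a' \<le> a" "a < b" "ereal b < b'"
    and G: "cdf_with_density G g"
    and G_support: "{a..b} \<subseteq> measure_support (density lborel g)"
    and c: "0 < c"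
    and sample: "\<And>n. 2 \<le> grid_size a b (grid_step c (1/3) n) \<Longrightarrow>
      current_status_sample (M n) n F (design_distribution G a b (grid_step c (1/3) n)) (T n) (X n)"
    and x\<^sub>0: "x\<^sub>0 \<in> {a<..<b}"
    and smooth: "C1_near F f x\<^sub>0" "C1_near G g x\<^sub>0" "lipschitz_near g x\<^sub>0"
    and positive: "0 < f x\<^sub>0" "0 < g x\<^sub>0"
    and \<alpha>: "\<alpha> = sqrt (F x\<^sub>0 * (1 - F x\<^sub>0) / g x\<^sub>0)"
    and \<beta>: "\<beta> = f x\<^sub>0 / 2"
    and W: "two_sided_brownian_motion \<Omega> W"
  shows "converges_in_distribution
           M (\<lambda>n \<omega>. \<lambda>i\<in>{- int N..int N}. local_process F a b c x\<^sub>0 n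
                (\<lambda>j. X n j \<omega>) (\<lambda>j. status (T n j \<omega>) (X n j \<omega>)) i)
           \<Omega> (\<lambda>\<omega>. \<lambda>i\<in>{- int N..int N}. limit_slope c \<alpha> \<beta> (\<lambda>t. W t \<omega>) i)
    \<and> weak_conv_m
           (\<lambda>n. distr (M n) borel (\<lambda>\<omega>.
              let t\<^sub>l = last_grid_point a b (grid_step c (1/3) n) x\<^sub>0
              in real n powr (1/3) *
                 (npmle a b n (\<lambda>j. X n j \<omega>) (\<lambda>j. status (T n j \<omega>) (X n j \<omega>)) t\<^sub>l - F t\<^sub>l)))
           (distr \<Omega> borel (\<lambda>\<omega>. limit_slope c \<alpha> \<beta> (\<lambda>t. W t \<omega>) 0))"
proof -
  interpret L: grid_limit_brownian F G f g a b x\<^sub>0 c M T X \<Omega> W \<alpha> \<beta>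
    by unfold_locales (fact F G c sample x\<^sub>0 smooth(1,2) positive W \<alpha> \<beta>)+
  let ?Y = "\<lambda>n \<omega>. local_process F a b c x\<^sub>0 n (\<lambda>j. X n j \<omega>) (\<lambda>j. status (T n j \<omega>) (X n j \<omega>))"
  have conv: "converges_in_distribution M (\<lambda>n \<omega>. \<lambda>i\<in>{- int N..int N}. ?Y n \<omega> i)
      \<Omega> (\<lambda>\<omega>. \<lambda>i\<in>{- int N..int N}. limit_slope c \<alpha> \<beta> (\<lambda>t. W t \<omega>) i)"
    using L.process_convergence unfolding L.process_def .
  \<comment> \<open>Offset 0 lies in the index range for every \<open>N\<close>, so the restriction
    to the range does not affect this coordinate.\<close>
  have "continuous_on UNIV (\<lambda>v::int \<Rightarrow> real. v 0)" by (rule continuous_on_product_coordinates)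
  from converges_in_distribution_compose[OF conv this]
  have conv0: "converges_in_distribution M (\<lambda>n \<omega>. ?Y n \<omega> 0) \<Omega> (\<lambda>\<omega>. limit_slope c \<alpha> \<beta> (\<lambda>t. W t \<omega>) 0)" by simp
  have "\<forall>\<^sub>F n in sequentially. prob_space (M n)"
    using L.eventually_grid_sample by eventually_elim (simp add: grid_sample_def)
  from weak_conv_m_if_converges_in_distribution[OF conv0 this L.W_props(1)]
  show ?thesis using conv by (simp add: local_process_def Let_def)
qed

end
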